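(* Assume that $0$ is an exceptional point of the first kind for $H$, i.e. $\det K(0)=0$, $Q_1\neq0$ and $Q_2=0$ (this forces $\Gamma_1\neq 0$). Then the reduced time evolution operator satisfies $$\tilde U(t)=\frac{1}{\lambda^2\log t}(Q_1\Gamma_1Q_1)^{-1}+O((\log t)^{-2})\qquad(t\to\infty).$$
   Context: Let $N\ge 1$ and $\mathcal H=\mathbb C^N\oplus L^2((0,\infty))$, where $|1\rangle,\dots,|N\rangle$ is the standard orthonormal basis of $\mathbb C^N$; vectors are written $|c\rangle+|f\rangle$ with $c\in\mathbb C^N$, $f\in L^2((0,\infty))$. Let $\omega_1\le\dots\le\omega_N$ be real numbers, $\lambda\in\mathbb R$, and $v_1,\dots,v_N\in L^2((0,\infty))$ (form factors). The Hamiltonian is $H=H_0+\lambda V$ with $H_0(|c\rangle+|f\rangle)=\sum_n\omega_nc_n|n\rangle+\omega f(\omega)$ on $D(H_0)=\{|c\rangle+|f\rangle:\int_0^\infty|\omega f(\omega)|^2d\omega<\infty\}$ and $V(|c\rangle+|f\rangle)=\sum_n\langle v_n|f\rangle|n\rangle+\sum_n c_n v_n$; $H$ is self-adjoint on $D(H_0)$. Form-factor assumption: for all $m,n$, $v_m^*(\omega)v_n(\omega)=\pi_{mn}(\omega)/\rho_{mn}(\omega)$ with polynomials such that $\deg\rho_{mn}\ge\deg\pi_{mn}+2$, $\rho_{mn}$ has no zeros in $[0,\infty)$, and $\pi_{mn}(0)=0$. $\Gamma(z)$ is the $N\times N$ matrix of the meromorphic continuations $v_m^*(z)v_n(z)$;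 its Taylor expansion at $0$ is $\Gamma(\omega)=\sum_{k\ge1}\omega^k\Gamma_k$. Self energy: $S_{mn}(z)=\int_0^\infty\frac{v_m^*(\omega)v_n(\omega)}{\omega-z}d\omega$ ($z\notin[0,\infty)$), $S_{mn}(0)=\int_0^\infty v_m^*v_n\,\omega^{-1}d\omega$; $K_0=\mathrm{diag}(\omega_1,\dots,\omega_N)$, $K(0)=K_0-\lambda^2S(0)$. For $\omega>0$ let $D_{mn}(\omega)=P\!\int_0^\infty\frac{v_m^*(\omega')v_n(\omega')}{\omega'-\omega}d\omega'$ and $K^\pm(\omega)=K_0-\lambda^2D(\omega)\mp i\pi\lambda^2\Gamma(\omega)$. Standing assumption: $\det[K^\pm(\omega)-\omega]\neq0$ for all $\omega>0$. Zero-energy classification: $M=\{\psi\in\mathbb C^N:K(0)\psi=0\}$; for $\psi\in M$ put $f_\psi(\omega)=-\lambda\sum_n\psi_nv_n(\omega)/\omega$; $M_2=\{\psi\in M: f_\psi\in L^2((0,\infty))\}$; $M_0=M^\perp$; $M_1=(M_0\oplus M_2)^\perp$; $Q_0,Q_1,Q_2$ are the orthogonal projections onto $M_0,M_1,M_2$. $(Q_1\Gamma_1Q_1)^{-1}$ denotes the inverse of $Q_1\Gamma_1Q_1$ restricted to $M_1$ (extended by $0$ on $M_1^\perp$). Let $\{E(B)\}$ be the spectral measure of $H$ and $P=E((0,\infty))$. The reduced time evolution operator $\tilde U(t)$ is the $N\times N$ matrix with entries $\tilde U_{mn}(t)=\langle m|Pe^{-itH}P|n\rangle$. *)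

theory Defs
  imports "HOL-Analysis.Analysis" "HOL-Computational_Algebra.Polynomial"
begin

definition cinner :: "complex^('n::finite) \<Rightarrow> complex^('n::finite) \<Rightarrow> complex" where
  "cinner x y = (\<Sum>i\<in>UNIV. cnj (x$i) * y$i)"

definition ortho_compl :: "(complex^('n::finite)) set \<Rightarrow> (complex^('n::finite)) set" where
  "ortho_compl S = {x. \<forall>y\<in>S. cinner y x = 0}"

definition mat_adj :: "complex^('n::finite)^('n::finite) \<Rightarrow> complex^('n::finite)^('n::finite)" where
  "mat_adj A = (\<chi> i j. cnj (A$j$i))"

definition cscale :: "complex \<Rightarrow> complex^('n::finite)^('n::finite) \<Rightarrow> complex^('n::finite)^('n::finite)" where
  "cscale c A = (\<chi> i j. c * A$i$j)"

definition orth_proj :: "(complex^('n::finite)) set \<Rightarrow> complex^('n::finite)^('n::finite)" where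
  "orth_proj S = (THE P. P ** P = P \<and> mat_adj P = P \<and> range (\<lambda>x. P *v x) = S)"

type_synonym 'n hvec = "(complex^'n) \<times> (real \<Rightarrow> complex)"

definition sq_int :: "(real \<Rightarrow> complex) \<Rightarrow> bool" where
  "sq_int f \<longleftrightarrow> f \<in> borel_measurable lborel \<and>
     set_integrable lborel {0<..} (\<lambda>x. (cmod (f x))^2)"

definition inH :: "('n::finite) hvec \<Rightarrow> bool" where
  "inH u \<longleftrightarrow> sq_int (snd u)"

definition hinner :: "('n::finite) hvec \<Rightarrow> ('n::finite) hvec \<Rightarrow> complex" where
  "hinner u w = cinner (fst u) (fst w) + (LINT x:{0<..}|lborel. cnj (snd u x) * snd w x)"

definition hlin :: "complex \<Rightarrow> ('n::finite) hvec \<Rightarrow> complex \<Rightarrow> ('n::finite) hvec \<Rightarrow> ('n::finite) hvec" where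
  "hlin a u b w = (\<chi> i. a * fst u $ i + b * fst w $ i, \<lambda>x. a * snd u x + b * snd w x)"

definition heq :: "('n::finite) hvec \<Rightarrow> ('n::finite) hvec \<Rightarrow> bool" where
  "heq u w \<longleftrightarrow> (let d = hlin 1 u (-1) w in hinner d d = 0)"

definition ket :: "('n::finite) \<Rightarrow> ('n::finite) hvec" where
  "ket m = (axis m 1, \<lambda>x. 0)"

definition inD :: "('n::finite) hvec \<Rightarrow> bool" where
  "inD u \<longleftrightarrow> inH u \<and> sq_int (\<lambda>x. complex_of_real x * snd u x)"

definition Hop :: "(('n::finite) \<Rightarrow> real) \<Rightarrow> real \<Rightarrow> (('n::finite) \<Rightarrow> real \<Rightarrow> complex) \<Rightarrow> ('n::finite) hvec \<Rightarrow> ('n::finite) hvec" where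
  "Hop om lam v u =
     (\<chi> n. complex_of_real (om n) * fst u $ n
            + complex_of_real lam * (LINT x:{0<..}|lborel. cnj (v n x) * snd u x),
      \<lambda>x. complex_of_real x * snd u x + complex_of_real lam * (\<Sum>n\<in>UNIV. fst u $ n * v n x))"

definition spec_meas :: "(real set \<Rightarrow> ('n::finite) hvec \<Rightarrow> ('n::finite) hvec) \<Rightarrow> ('n::finite) hvec \<Rightarrow> real measure" where
  "spec_meas E u = measure_of UNIV (sets borel) (\<lambda>B. ennreal (Re (hinner u (E B u))))"

text \<open>E is a projection-valued measure on the Borel sets and H = integral of x dE(x):
  D(H) = {u. integral x^2 d<u,E u> < oo} and <u,Hu> = integral x d<u,E u> on D(H).\<close>
definition is_spectral_measure_of ::
  "(('n::finite) \<Rightarrow> real) \<Rightarrow> real \<Rightarrow> (('n::finite) \<Rightarrow> real \<Rightarrow> complex) \<Rightarrow> (real set \<Rightarrow> ('n::finite) hvec \<Rightarrow> ('n::finite) hvec) \<Rightarrow> bool" where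
  "is_spectral_measure_of om lam v E \<longleftrightarrow>
     (\<forall>B\<in>sets borel. \<forall>u. inH u \<longrightarrow> inH (E B u)) \<and>
     (\<forall>B\<in>sets borel. \<forall>u w a b. inH u \<longrightarrow> inH w \<longrightarrow>
         heq (E B (hlin a u b w)) (hlin a (E B u) b (E B w))) \<and>
     (\<forall>B\<in>sets borel. \<forall>u w. inH u \<longrightarrow> inH w \<longrightarrow> hinner (E B u) w = hinner u (E B w)) \<and>
     (\<forall>A\<in>sets borel. \<forall>B\<in>sets borel. \<forall>u. inH u \<longrightarrow> heq (E A (E B u)) (E (A \<inter> B) u)) \<and>
     (\<forall>u. inH u \<longrightarrow> heq (E UNIV u) u) \<and>
     (\<forall>u. inH u \<longrightarrow> countably_additive (sets borel) (\<lambda>B. ennreal (Re (hinner u (E B u))))) \<and>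
     (\<forall>u. inH u \<longrightarrow> (inD u \<longleftrightarrow> integrable (spec_meas E u) (\<lambda>x. x^2))) \<and>
     (\<forall>u. inD u \<longrightarrow> hinner u (Hop om lam v u) = complex_of_real (\<integral>x. x \<partial>spec_meas E u))"

text \<open>Reduced time evolution <m| P e^{-itH} P |n> with P = E((0,oo)), i.e.
  the integral of e^{-itx} over (0,oo) w.r.t. the complex measure <m|E(.)|n>,
  obtained by polarisation from the positive spectral measures.\<close>
definition U_red :: "(real set \<Rightarrow> ('n::finite) hvec \<Rightarrow> ('n::finite) hvec) \<Rightarrow> 'n \<Rightarrow> 'n \<Rightarrow> real \<Rightarrow> complex" where
  "U_red E m n t = (1/4) * (\<Sum>k<4::nat. cnj (\<i>^k) *
      (LINT x:{0<..}|spec_meas E (hlin 1 (ket m) (\<i>^k) (ket n)). exp (- \<i> * complex_of_real (t * x))))"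

definition K0 :: "(('n::finite) \<Rightarrow> real) \<Rightarrow> complex^('n::finite)^('n::finite)" where
  "K0 om = (\<chi> m n. if m = n then complex_of_real (om m) else 0)"

definition S0 :: "(('n::finite) \<Rightarrow> real \<Rightarrow> complex) \<Rightarrow> complex^('n::finite)^('n::finite)" where
  "S0 v = (\<chi> m n. LINT x:{0<..}|lborel. cnj (v m x) * v n x / complex_of_real x)"

definition Kzero :: "(('n::finite) \<Rightarrow> real) \<Rightarrow> real \<Rightarrow> (('n::finite) \<Rightarrow> real \<Rightarrow> complex) \<Rightarrow> complex^('n::finite)^('n::finite)" where
  "Kzero om lam v = K0 om - (lam^2) *\<^sub>R S0 v"

text \<open>Gamma(omega) for omega > 0, and Gamma_1 from the meromorphic continuation pi/rho.\<close>
definition Gam :: "(('n::finite) \<Rightarrow> real \<Rightarrow> complex) \<Rightarrow> real \<Rightarrow> complex^('n::finite)^('n::finite)" where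
  "Gam v w = (\<chi> m n. cnj (v m w) * v n w)"

definition Gam1 :: "(('n::finite) \<Rightarrow> 'n \<Rightarrow> complex poly) \<Rightarrow> (('n::finite) \<Rightarrow> 'n \<Rightarrow> complex poly) \<Rightarrow> complex^('n::finite)^('n::finite)" where
  "Gam1 pp rr = (\<chi> m n. deriv (\<lambda>z. poly (pp m n) z / poly (rr m n) z) 0)"

definition pv :: "(real \<Rightarrow> complex) \<Rightarrow> real \<Rightarrow> complex" where
  "pv g w = Lim (at_right 0)
     (\<lambda>e. LINT x:({0<..} - {w - e..w + e})|lborel. g x / complex_of_real (x - w))"

definition Dmat :: "(('n::finite) \<Rightarrow> real \<Rightarrow> complex) \<Rightarrow> real \<Rightarrow> complex^('n::finite)^('n::finite)" where
  "Dmat v w = (\<chi> m n. pv (\<lambda>x. cnj (v m x) * v n x) w)"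

text \<open>K^{+}(w) (s = 1) and K^{-}(w) (s = -1).\<close>
definition Kpm :: "(('n::finite) \<Rightarrow> real) \<Rightarrow> real \<Rightarrow> (('n::finite) \<Rightarrow> real \<Rightarrow> complex) \<Rightarrow> real \<Rightarrow> real \<Rightarrow> complex^('n::finite)^('n::finite)" where
  "Kpm om lam v s w = K0 om - (lam^2) *\<^sub>R Dmat v w
        - cscale (complex_of_real s * \<i> * complex_of_real (pi * lam^2)) (Gam v w)"

definition Mspace :: "(('n::finite) \<Rightarrow> real) \<Rightarrow> real \<Rightarrow> (('n::finite) \<Rightarrow> real \<Rightarrow> complex) \<Rightarrow> (complex^('n::finite)) set" where
  "Mspace om lam v = {psi. Kzero om lam v *v psi = 0}"

definition fpsi :: "real \<Rightarrow> (('n::finite) \<Rightarrow> real \<Rightarrow> complex) \<Rightarrow> complex^('n::finite) \<Rightarrow> real \<Rightarrow> complex" where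
  "fpsi lam v psi x = - complex_of_real lam * (\<Sum>n\<in>UNIV. psi$n * v n x) / complex_of_real x"

definition M2 :: "(('n::finite) \<Rightarrow> real) \<Rightarrow> real \<Rightarrow> (('n::finite) \<Rightarrow> real \<Rightarrow> complex) \<Rightarrow> (complex^('n::finite)) set" where
  "M2 om lam v = {psi \<in> Mspace om lam v. sq_int (fpsi lam v psi)}"

definition M0 :: "(('n::finite) \<Rightarrow> real) \<Rightarrow> real \<Rightarrow> (('n::finite) \<Rightarrow> real \<Rightarrow> complex) \<Rightarrow> (complex^('n::finite)) set" where
  "M0 om lam v = ortho_compl (Mspace om lam v)"

definition M1 :: "(('n::finite) \<Rightarrow> real) \<Rightarrow> real \<Rightarrow> (('n::finite) \<Rightarrow> real \<Rightarrow> complex) \<Rightarrow> (complex^('n::finite)) set" where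
  "M1 om lam v = ortho_compl {x + y | x y. x \<in> M0 om lam v \<and> y \<in> M2 om lam v}"

end

(*
Eliminating the continuum component from (H - z) w = u gives <u, (H - z)^(-1) u> = c^* A(z)^(-1) c
for u = |c>, where A(z) = K(z) - z and K(z) = K_0 - lambda^2 S(z).  For rational form factors
S(z) = p(z) - Gamma(z) (log z - i pi) with p rational, so A extends continuously to (0,oo), where it
is invertible by the standing assumption.  By Stieltjes inversion the spectral measure of u has on
(0,oo) the density Im (c^* A(w)^(-1) c) / pi = lambda^2 y^* Gamma(w) y with A(w) y = c.
Near 0 we have A(w) = K(0) + lambda^2 w (log w - i pi) Gamma_1 + O(w).  With R the inverse of
Q_1 Gamma_1 Q_1 and Y chosen such that Gamma_1 R + K(0) Y = 1, the matrix
R / (lambda^2 w (log w - i pi)) + Y inverts A(w) up to a relative error O(1 / log w).  Hence the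
density is c^* R c / (lambda^2 w log^2 w) + O(1 / (w |log w|^3)); its integral over (0, 1/t) yields the
leading term, while on (1/t, oo) the oscillation of exp(-i t w) is exploited by averaging over a shift
of half a period, using Lipschitz bounds for the density and the finite second moment at infinity.
Finally the matrix entries are recovered by polarisation.
*)
theory Submission
  imports Defs
begin

section \<open>Spectral measures and the resolvent\<close>

text \<open>The axioms describe \<open>E\<close> through diagonal data: one positive measure per
  vector, whose second moment decides membership in the domain and whose mean is the quadratic form
  of \<open>H\<close>. There is no functional calculus to start from, so the resolvent formula is
  extracted by polarisation: the complex measure of a pair of vectors is a combination of four
  positive ones, and identities between such combinations on Borel sets are carried over to
  integrands. The classification at zero energy enters through \<open>Q_2 = 0\<close>. It makes
  \<open>Gamma_1\<close> definite on the kernel of \<open>K(0)\<close>, since a null vector of its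
  form would have a square integrable \<open>f_psi\<close>, and it excludes the value 0 for the
  coupling. The main term depends on time only through the cut-off: the integral of
  \<open>1 / (w log^2 w)\<close> over \<open>(0, h)\<close> is \<open>1 / |log h|\<close>, so every
  \<open>h\<close> of order \<open>1 / t\<close> yields it, and \<open>h = pi / t\<close> is the
  choice for which a shift by \<open>h\<close> reverses the phase. The Lipschitz constant
  \<open>1 / (s^2 log^2 s)\<close> of the density is just good enough: integrated from
  \<open>h\<close> on and multiplied by \<open>h\<close> it leaves
  \<open>1 / log^2 h\<close>.\<close>

lemma sq_int_measurable [measurable_dest]: "sq_int f \<Longrightarrow> f \<in> borel_measurable borel"
  by (simp add: sq_int_def)

lemma borel_measurable_cnj [measurable]:
  "f \<in> borel_measurable M \<Longrightarrow> (\<lambda>x. cnj (f x)) \<in> borel_measurable M"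
  by (rule measurable_compose[OF _ borel_measurable_continuous_onI]) (auto intro: continuous_intros)

lemma cmod_lincomb_sq: "(cmod (a * x + b * y))\<^sup>2 \<le> 2 * (cmod a)\<^sup>2 * (cmod x)\<^sup>2 + 2 * (cmod b)\<^sup>2 * (cmod y)\<^sup>2"
proof -
  have "cmod (a * x + b * y) \<le> cmod a * cmod x + cmod b * cmod y"
    by (metis norm_mult norm_triangle_ineq)
  then have "(cmod (a * x + b * y))\<^sup>2 \<le> (cmod a * cmod x + cmod b * cmod y)\<^sup>2"
    by (rule power_mono) simp
  also have "\<dots> \<le> 2 * (cmod a * cmod x)\<^sup>2 + 2 * (cmod b * cmod y)\<^sup>2"
    using zero_le_power2[of "cmod a * cmod x - cmod b * cmod y"]
    by (simp add: power2_eq_square algebra_simps)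
  finally show ?thesis by (simp add: power_mult_distrib)
qed

section \<open>Square integrable functions and the semidefinite inner product\<close>

lemma sq_int_zero [simp]: "sq_int (\<lambda>x. 0)"
  by (simp add: sq_int_def set_integrable_def)

lemma sq_int_lincomb:
  assumes "sq_int f" "sq_int g"
  shows "sq_int (\<lambda>x. a * f x + b * g x)"
proof -
  have [measurable]: "f \<in> borel_measurable borel" "g \<in> borel_measurable borel"
    using assms by (auto simp: sq_int_def)
  have "set_integrable lborel {0<..} (\<lambda>x. (2 * (cmod a)\<^sup>2) * (cmod (f x))\<^sup>2 + (2 * (cmod b)\<^sup>2) * (cmod (g x))\<^sup>2)"
    using assms unfolding sq_int_def by (intro set_integral_add set_integrable_mult_right) auto
  then have "set_integrable lborel {0<..} (\<lambda>x. (cmod (a * f x + b * g x))\<^sup>2)"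
    by (rule set_integrable_bound) (use cmod_lincomb_sq in \<open>auto simp: set_borel_measurable_def\<close>)
  then show ?thesis by (simp add: sq_int_def)
qed

lemma sq_int_add: "sq_int f \<Longrightarrow> sq_int g \<Longrightarrow> sq_int (\<lambda>x. f x + g x)"
  using sq_int_lincomb[of f g 1 1] by simp

lemma sq_int_cmult: "sq_int f \<Longrightarrow> sq_int (\<lambda>x. a * f x)"
  using sq_int_lincomb[of f f a 0] by simp

lemma sq_int_sum: "(\<And>i. i \<in> I \<Longrightarrow> sq_int (f i)) \<Longrightarrow> sq_int (\<lambda>x. \<Sum>i\<in>I. f i x)"
  by (induction I rule: infinite_finite_induct) (auto intro: sq_int_add)

lemma sq_int_bounded_mult:
  assumes f: "sq_int f" and [measurable]: "k \<in> borel_measurable borel"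
    and C: "\<And>x. x > 0 \<Longrightarrow> cmod (k x) \<le> C"
  shows "sq_int (\<lambda>x. k x * f x)"
proof -
  have [measurable]: "f \<in> borel_measurable borel"
    using assms by (auto simp: sq_int_def)
  have "set_integrable lborel {0<..} (\<lambda>x. C\<^sup>2 * (cmod (f x))\<^sup>2)"
    using f unfolding sq_int_def by auto
  then have "set_integrable lborel {0<..} (\<lambda>x. (cmod (k x * f x))\<^sup>2)"
  proof (rule set_integrable_bound)
    show "AE x in lborel. x \<in> {0<..} \<longrightarrow> norm ((cmod (k x * f x))\<^sup>2) \<le> norm (C\<^sup>2 * (cmod (f x))\<^sup>2)"
      using C by (auto simp: norm_mult power_mult_distrib intro!: mult_right_mono power_mono)
  qed (auto simp: set_borel_measurable_def)
  then show ?thesis by (simp add: sq_int_def)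
qed

lemma sq_int_product:
  assumes "sq_int f" "sq_int g"
  shows "set_integrable lborel {0<..} (\<lambda>x. cnj (f x) * g x)"
proof -
  have [measurable]: "f \<in> borel_measurable borel" "g \<in> borel_measurable borel"
    using assms by (auto simp: sq_int_def)
  have *: "cmod x * cmod y \<le> (cmod x)\<^sup>2 + (cmod y)\<^sup>2" for x y
    using zero_le_power2[of "cmod x - cmod y"] mult_nonneg_nonneg[of "cmod x" "cmod y"]
    by (simp add: power2_eq_square algebra_simps del: mult_nonneg_nonneg)
  have "set_integrable lborel {0<..} (\<lambda>x. (cmod (f x))\<^sup>2 + (cmod (g x))\<^sup>2)"
    using assms unfolding sq_int_def by (intro set_integral_add) auto
  then show ?thesis
    by (rule set_integrable_bound) (use * in \<open>auto simp: set_borel_measurable_def norm_mult\<close>)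
qed

lemma inH_hlin: "inH u \<Longrightarrow> inH w \<Longrightarrow> inH (hlin a u b w)"
  by (simp add: inH_def hlin_def sq_int_lincomb)

lemma inD_inH: "inD u \<Longrightarrow> inH u"
  by (simp add: inD_def)

lemma inD_hlin:
  assumes "inD u" "inD w"
  shows "inD (hlin a u b w)"
proof -
  have "sq_int (\<lambda>x. a * (complex_of_real x * snd u x) + b * (complex_of_real x * snd w x))"
    using assms by (auto simp: inD_def intro: sq_int_lincomb)
  then show ?thesis
    using assms inH_hlin[of u w a b] by (simp add: inD_def hlin_def algebra_simps)
qed

lemma cinner_cnj: "cinner x y = cnj (cinner y x)"
  by (simp add: cinner_def mult.commute)

lemma hinner_cnj: "hinner u w = cnj (hinner w u)"
proof -
  have "(LINT x:{0<..}|lborel. cnj (snd u x) * snd w x) = cnj (LINT x:{0<..}|lborel. cnj (snd w x) * snd u x)"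
    unfolding set_lebesgue_integral_def
    by (subst Bochner_Integration.integral_cnj[symmetric]) (auto intro!: Bochner_Integration.integral_cong simp: mult.commute)
  then show ?thesis
    by (simp add: hinner_def cinner_cnj[of "fst u" "fst w"])
qed

lemma hinner_hlin_right:
  assumes "inH y" "inH u" "inH w"
  shows "hinner y (hlin a u b w) = a * hinner y u + b * hinner y w"
proof -
  have *: "set_integrable lborel {0<..} (\<lambda>x. a * (cnj (snd y x) * snd u x))"
    "set_integrable lborel {0<..} (\<lambda>x. b * (cnj (snd y x) * snd w x))"
    using assms by (auto simp: inH_def sq_int_product)
  have "(LINT x:{0<..}|lborel. cnj (snd y x) * (a * snd u x + b * snd w x)) =
        (LINT x:{0<..}|lborel. a * (cnj (snd y x) * snd u x) + b * (cnj (snd y x) * snd w x))"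
    by (simp add: algebra_simps)
  also have "\<dots> = a * (LINT x:{0<..}|lborel. cnj (snd y x) * snd u x) + b * (LINT x:{0<..}|lborel. cnj (snd y x) * snd w x)"
    by (subst set_integral_add(2)[OF *]) simp
  finally show ?thesis
    by (simp add: hinner_def hlin_def cinner_def sum_distrib_left sum.distrib algebra_simps)
qed

lemma hinner_hlin_left:
  assumes "inH y" "inH u" "inH w"
  shows "hinner (hlin a u b w) y = cnj a * hinner u y + cnj b * hinner w y"
  using hinner_hlin_right[OF assms, of a b] by (simp add: hinner_cnj[of _ y])

lemma hinner_self: 
  "hinner u u = complex_of_real ((\<Sum>i\<in>UNIV. (cmod (fst u $ i))\<^sup>2) + (LINT x:{0<..}|lborel. (cmod (snd u x))\<^sup>2))"
proof -
  have "(LINT x:{0<..}|lborel. cnj (snd u x) * snd u x) = (LINT x:{0<..}|lborel. complex_of_real ((cmod (snd u x))\<^sup>2))"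
    by (simp add: mult.commute[of "cnj _"] complex_norm_square del: of_real_power)
  then show ?thesis
    unfolding hinner_def cinner_def
    by (simp only: set_integral_complex_of_real) (simp add: mult.commute[of "cnj _"] complex_norm_square del: of_real_power)
qed

lemma set_integral_norm2_nonneg: "(LINT x:{0<..}|lborel. (cmod (f x))\<^sup>2) \<ge> 0"
  unfolding set_lebesgue_integral_def by (intro Bochner_Integration.integral_nonneg) simp

lemma hinner_self_nonneg: "hinner u u = complex_of_real (Re (hinner u u))" "Re (hinner u u) \<ge> 0"
  by (simp_all add: hinner_self set_integral_norm2_nonneg sum_nonneg del: of_real_add)

text \<open>Vectors are built from functions, not from classes, so \<open>hinner\<close> is only
  semidefinite. A null vector has vanishing discrete part and a continuum part that is zero almost
  everywhere on the half-line; no pairing detects it.\<close>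

lemma hinner_null:
  assumes "inH d" "inH y" "hinner d d = 0"
  shows "hinner y d = 0"
proof -
  have [measurable]: "snd d \<in> borel_measurable borel" "snd y \<in> borel_measurable borel"
    using assms by (auto simp: inH_def sq_int_def)
  have s: "(\<Sum>i\<in>UNIV. (cmod (fst d $ i))\<^sup>2) = 0" and l: "(LINT x:{0<..}|lborel. (cmod (snd d x))\<^sup>2) = 0"
    using assms(3) set_integral_norm2_nonneg[of "snd d"] sum_nonneg[of UNIV "\<lambda>i. (cmod (fst d $ i))\<^sup>2"]
    unfolding hinner_self of_real_eq_0_iff by auto
  have 1: "fst d $ i = 0" for i
    using s by (auto simp: sum_nonneg_eq_0_iff)
  have "integrable lborel (\<lambda>x. indicator {0<..} x *\<^sub>R (cmod (snd d x))\<^sup>2)"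
    using assms by (simp add: inH_def sq_int_def set_integrable_def)
  then have "AE x in lborel. indicator {0<..} x *\<^sub>R (cmod (snd d x))\<^sup>2 = 0"
    using l unfolding set_lebesgue_integral_def by (subst (asm) integral_nonneg_eq_0_iff_AE) auto
  then have "AE x\<in>{0<..} in lborel. cnj (snd y x) * snd d x = 0"
    by eventually_elim auto
  from set_lebesgue_integral_cong_AE[OF _ _ _ this]
  have "(LINT x:{0<..}|lborel. cnj (snd y x) * snd d x) = (LINT x:{0<..}|lborel. 0)"
    by simp
  then show ?thesis
    using 1 by (simp add: hinner_def cinner_def)
qed

text \<open>Several axioms for \<open>E\<close> hold up to \<open>heq\<close>. Pairing with a third
  vector turns them into equations between numbers, which is why the facts on \<open>E\<close> below
  are stated inside \<open>hinner\<close>.\<close>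

lemma hinner_heq:
  assumes "inH y" "inH u" "inH w" "heq u w"
  shows "hinner y u = hinner y w" "hinner u y = hinner w y"
proof -
  have "hinner y (hlin 1 u (-1) w) = 0"
    by (rule hinner_null) (use assms in \<open>auto simp: heq_def Let_def inH_hlin\<close>)
  then show "hinner y u = hinner y w"
    using assms by (simp add: hinner_hlin_right)
  then show "hinner u y = hinner w y"
    by (simp add: hinner_cnj[of u y] hinner_cnj[of w y])
qed

lemma Hop_hlin:
  assumes v: "\<And>n. sq_int (v n)" and "inH u" "inH w"
  shows "Hop om lam v (hlin a u b w) = hlin a (Hop om lam v u) b (Hop om lam v w)"
proof -
  have i: "(LINT x:{0<..}|lborel. cnj (v n x) * (a * snd u x + b * snd w x)) = 
    a * (LINT x:{0<..}|lborel. cnj (v n x) * snd u x) + b * (LINT x:{0<..}|lborel. cnj (v n x) * snd w x)" for n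
  proof -
    have *: "set_integrable lborel {0<..} (\<lambda>x. a * (cnj (v n x) * snd u x))"
      "set_integrable lborel {0<..} (\<lambda>x. b * (cnj (v n x) * snd w x))"
      using assms by (auto simp: inH_def sq_int_product)
    have "(LINT x:{0<..}|lborel. cnj (v n x) * (a * snd u x + b * snd w x)) =
        (LINT x:{0<..}|lborel. a * (cnj (v n x) * snd u x) + b * (cnj (v n x) * snd w x))"
      by (simp add: algebra_simps)
    also have "\<dots> = a * (LINT x:{0<..}|lborel. cnj (v n x) * snd u x) + b * (LINT x:{0<..}|lborel. cnj (v n x) * snd w x)"
      by (subst set_integral_add(2)[OF *]) simp
    finally show ?thesis .
  qed
  show ?thesis
    unfolding Hop_def hlin_def fst_conv snd_conv i
    by (simp add: vec_eq_iff fun_eq_iff sum_distrib_left sum.distrib algebra_simps)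
qed

lemma inH_Hop:
  assumes v: "\<And>n. sq_int (v n)" and "inD u"
  shows "inH (Hop om lam v u)"
  unfolding inH_def Hop_def using assms
  by (auto simp: inD_def intro!: sq_int_add sq_int_cmult sq_int_sum)

lemma sum_lessThan_4: "(\<Sum>k<4::nat. f k) = f 0 + f 1 + f 2 + f 3"
  by (simp add: eval_nat_numeral)

text \<open>In the expansion of the four products the term with \<open>hinner u w'\<close> carries
  the factor \<open>\<i>^k\<close>; against \<open>cnj (\<i>^k)\<close> it is the one that survives
  the sum. The images \<open>u'\<close> and \<open>w'\<close> are separate vectors because
  \<open>E B\<close> is linear only up to \<open>heq\<close>.\<close>

lemma polarisation_hinner:
  assumes A: "\<And>k. A (hlin 1 u (\<i>^k) w) = hinner (hlin 1 u (\<i>^k) w) (hlin 1 u' (\<i>^k) w')"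
    and "inH u" "inH w" "inH u'" "inH w'"
  shows "(1/4) * (\<Sum>k<4::nat. cnj (\<i>^k) * A (hlin 1 u (\<i>^k) w)) = hinner u w'"
  unfolding sum_lessThan_4 A using assms(2-)
  by (simp add: hinner_hlin_left hinner_hlin_right inH_hlin power2_eq_square power3_eq_cube algebra_simps)

lemma integral_indicator_complex:
  assumes "A \<in> sets M"
  shows "(\<integral>x. indicator A x \<partial>M) = complex_of_real (measure M A)"
proof -
  have "(\<integral>x. indicator A x \<partial>M) = (\<integral>x. complex_of_real (indicator A x) \<partial>M)"
    by (intro Bochner_Integration.integral_cong) (auto simp: indicator_def)
  also have "\<dots> = complex_of_real (measure M A)"
    using sets.sets_into_space[OF assms] by (subst integral_complex_of_real) (simp add: Int_absorb2)
  finally show ?thesis .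
qed

text \<open>Stands in for the fact that a vanishing complex measure integrates every function to
  zero, the measure being the combination of the \<open>c i * h i\<close> against the
  \<open>M i\<close>. Simple functions follow from sets, general ones by dominated convergence. It
  is applied with \<open>g x = x\<close> and with \<open>g x = 1 / (x - z)\<close>.\<close>

lemma measure_relation_extend:
  fixes c :: "'i \<Rightarrow> complex" and h :: "'i \<Rightarrow> 'a \<Rightarrow> complex" and g :: "'a \<Rightarrow> complex"
  assumes "finite I" and S: "\<And>i. i \<in> I \<Longrightarrow> sets (M i) = sets N"
    and h: "\<And>i. i \<in> I \<Longrightarrow> integrable (M i) (h i)"
    and g: "g \<in> borel_measurable N"
    and gh: "\<And>i. i \<in> I \<Longrightarrow> integrable (M i) (\<lambda>x. g x * h i x)"
    and 0: "\<And>A. A \<in> sets N \<Longrightarrow> (\<Sum>i\<in>I. c i * (\<integral>x. indicator A x * h i x \<partial>M i)) = 0"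
  shows "(\<Sum>i\<in>I. c i * (\<integral>x. g x * h i x \<partial>M i)) = 0"
proof -
  have Sp: "space (M i) = space N" if "i \<in> I" for i
    using sets_eq_imp_space_eq[OF S[OF that]] .
  \<comment> \<open>The approximation is centred at 0, so the simple functions stay below
    \<open>2 * cmod (g x)\<close>; this provides the dominating function at the end.\<close>
  obtain F where F: "\<And>i. simple_function N (F i)" "\<And>x. x \<in> space N \<Longrightarrow> (\<lambda>i. F i x) \<longlonglongrightarrow> g x"
    "\<And>i x. x \<in> space N \<Longrightarrow> cmod (F i x) \<le> 2 * cmod (g x)"
    using borel_measurable_implies_sequence_metric[OF g, of 0] unfolding dist_0_norm dist_complex_def diff_zero by metis
  have Fm: "F j \<in> borel_measurable N" for j
    using F(1) by (rule borel_measurable_simple_function)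
  have simp: "(\<Sum>i\<in>I. c i * (\<integral>x. F j x * h i x \<partial>M i)) = 0" for j
  proof -
    define Y where "Y = F j ` space N"
    have fin: "finite Y" using F(1) by (simp add: Y_def simple_function_def)
    have set: "F j -` {y} \<inter> space N \<in> sets N" for y
      using F(1)[of j] Fm[of j] by (auto intro: measurable_sets)
    have rep: "F j x = (\<Sum>y\<in>Y. y * indicator (F j -` {y} \<inter> space N) x)" if "x \<in> space N" for x
    proof -
      have "(\<Sum>y\<in>Y. y * indicator (F j -` {y} \<inter> space N) x) = (\<Sum>y\<in>Y. if y = F j x then y else 0)"
        using that by (intro sum.cong) (auto simp: indicator_def)
      also have "\<dots> = F j x" using fin that by (simp add: Y_def)
      finally show ?thesis by simp
    qed
    have int: "integrable (M i) (\<lambda>x. indicator A x * h i x)" if "i \<in> I" "A \<in> sets N" for i A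
    proof -
      have "(\<lambda>x. indicator A x *\<^sub>R h i x) = (\<lambda>x. indicator A x * h i x)"
        by (auto simp: indicator_def)
      then show ?thesis
        using integrable_mult_indicator[of A "M i" "h i"] h that S[OF that(1)] by simp
    qed
    have "(\<integral>x. F j x * h i x \<partial>M i) = (\<Sum>y\<in>Y. y * (\<integral>x. indicator (F j -` {y} \<inter> space N) x * h i x \<partial>M i))"
      if i: "i \<in> I" for i
    proof -
      have "(\<integral>x. F j x * h i x \<partial>M i) = (\<integral>x. (\<Sum>y\<in>Y. y * (indicator (F j -` {y} \<inter> space N) x * h i x)) \<partial>M i)"
      proof (rule Bochner_Integration.integral_cong)
        fix x assume "x \<in> space (M i)"
        then have "x \<in> space N" using Sp[OF i] by simp
        from rep[OF this] show "F j x * h i x = (\<Sum>y\<in>Y. y * (indicator (F j -` {y} \<inter> space N) x * h i x))"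
          by (metis (no_types, lifting) mult.assoc sum.cong sum_distrib_right)
      qed simp
      also have "\<dots> = (\<Sum>y\<in>Y. y * (\<integral>x. indicator (F j -` {y} \<inter> space N) x * h i x \<partial>M i))"
        using int[OF i set] by (subst Bochner_Integration.integral_sum) auto
      finally show ?thesis .
    qed
    then have "(\<Sum>i\<in>I. c i * (\<integral>x. F j x * h i x \<partial>M i)) =
       (\<Sum>i\<in>I. \<Sum>y\<in>Y. y * (c i * (\<integral>x. indicator (F j -` {y} \<inter> space N) x * h i x \<partial>M i)))"
      by (intro sum.cong) (simp_all add: sum_distrib_left mult.left_commute)
    also have "\<dots> = (\<Sum>y\<in>Y. y * (\<Sum>i\<in>I. c i * (\<integral>x. indicator (F j -` {y} \<inter> space N) x * h i x \<partial>M i)))"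
      by (subst sum.swap) (simp add: sum_distrib_left)
    also have "\<dots> = 0" using 0[OF set] by simp
    finally show ?thesis .
  qed
  have "(\<lambda>j. \<integral>x. F j x * h i x \<partial>M i) \<longlonglongrightarrow> (\<integral>x. g x * h i x \<partial>M i)" if i: "i \<in> I" for i
  proof (rule integral_dominated_convergence[where w="\<lambda>x. 2 * cmod (g x * h i x)"])
    have hm: "h i \<in> borel_measurable (M i)" using h[OF i] by simp
    show "(\<lambda>x. g x * h i x) \<in> borel_measurable (M i)" using gh[OF i] by simp
    show "(\<lambda>x. F j x * h i x) \<in> borel_measurable (M i)" for j
      using Fm[of j] hm measurable_cong_sets[OF S[OF i] refl] by (intro borel_measurable_times) auto
    show "integrable (M i) (\<lambda>x. 2 * cmod (g x * h i x))" using gh[OF i] by simp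
    show "AE x in M i. (\<lambda>j. F j x * h i x) \<longlonglongrightarrow> g x * h i x"
      by (rule AE_I2) (auto simp: Sp[OF i] intro!: tendsto_intros F(2))
    show "AE x in M i. cmod (F j x * h i x) \<le> 2 * cmod (g x * h i x)" for j
      by (rule AE_I2) (auto simp: Sp[OF i] norm_mult mult.assoc[symmetric] intro!: mult_right_mono F(3))
  qed
  then have "(\<lambda>j. \<Sum>i\<in>I. c i * (\<integral>x. F j x * h i x \<partial>M i)) \<longlonglongrightarrow> (\<Sum>i\<in>I. c i * (\<integral>x. g x * h i x \<partial>M i))"
    by (intro tendsto_intros)
  with simp show ?thesis by (simp add: LIMSEQ_const_iff)
qed


section \<open>From diagonal spectral data to the resolvent\<close>

locale hamiltonian_spectral_measure =
  fixes om :: "'n::finite \<Rightarrow> real" and lam :: real and v :: "'n \<Rightarrow> real \<Rightarrow> complex"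
    and E :: "real set \<Rightarrow> 'n hvec \<Rightarrow> 'n hvec"
  assumes v_L2: "\<And>n. sq_int (v n)"
    and E_spec: "is_spectral_measure_of om lam v E"
begin

abbreviation "\<mu> u \<equiv> spec_meas E u"

lemma inH_E: "B \<in> sets borel \<Longrightarrow> inH u \<Longrightarrow> inH (E B u)"
  using E_spec unfolding is_spectral_measure_of_def by blast

lemma E_sym: "B \<in> sets borel \<Longrightarrow> inH u \<Longrightarrow> inH w \<Longrightarrow> hinner (E B u) w = hinner u (E B w)"
  using E_spec unfolding is_spectral_measure_of_def by blast

lemma E_Int:
  assumes "A \<in> sets borel" "B \<in> sets borel" "inH u" "inH y"
  shows "hinner y (E A (E B u)) = hinner y (E (A \<inter> B) u)"
proof -
  have "heq (E A (E B u)) (E (A \<inter> B) u)"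
    using E_spec assms unfolding is_spectral_measure_of_def by blast
  then show ?thesis
    using assms by (intro hinner_heq inH_E) auto
qed

lemma E_UNIV:
  assumes "inH u" "inH y"
  shows "hinner y (E UNIV u) = hinner y u"
proof -
  have "heq (E UNIV u) u"
    using E_spec assms unfolding is_spectral_measure_of_def by blast
  then show ?thesis
    using assms by (intro hinner_heq inH_E) auto
qed

lemma E_hlin:
  assumes "B \<in> sets borel" "inH u" "inH w" "inH y"
  shows "hinner y (E B (hlin a u b w)) = hinner y (hlin a (E B u) b (E B w))"
proof -
  have "heq (E B (hlin a u b w)) (hlin a (E B u) b (E B w))"
    using E_spec assms unfolding is_spectral_measure_of_def by blast
  then show ?thesis
    using assms by (intro hinner_heq inH_E inH_hlin) auto
qed

lemma inD_iff: "inH u \<Longrightarrow> inD u \<longleftrightarrow> integrable (\<mu> u) (\<lambda>x. x^2)"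
  using E_spec unfolding is_spectral_measure_of_def by blast

lemma mean_value: "inD u \<Longrightarrow> hinner u (Hop om lam v u) = complex_of_real (\<integral>x. x \<partial>\<mu> u)"
  using E_spec unfolding is_spectral_measure_of_def by blast

text \<open>\<open>E B\<close> is symmetric and idempotent, so the value is the squared norm of
  \<open>E B u\<close>. This matters because \<open>spec_meas\<close> passes through
  \<open>ennreal (Re _)\<close>, which would silently cut off an imaginary or a negative
  part.\<close>

lemma hinner_E_self:
  assumes "B \<in> sets borel" "inH u"
  shows "hinner u (E B u) = complex_of_real (Re (hinner u (E B u)))" "0 \<le> Re (hinner u (E B u))"
proof -
  have "hinner u (E B u) = hinner (E B u) (E B u)"
    using E_Int[OF assms(1,1,2,2)] E_sym[OF assms(1,2) inH_E[OF assms]] by simp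
  then show "hinner u (E B u) = complex_of_real (Re (hinner u (E B u)))" "0 \<le> Re (hinner u (E B u))"
    using hinner_self_nonneg[of "E B u"] by simp_all
qed

lemma sets_spec [simp, measurable_cong]: "sets (\<mu> u) = sets borel"
  unfolding spec_meas_def using sets.sigma_sets_eq[of borel] by simp

lemma space_spec [simp]: "space (\<mu> u) = UNIV"
  unfolding spec_meas_def by (simp add: space_measure_of_conv)

lemma emeasure_spec:
  assumes u: "inH u" and B: "B \<in> sets borel"
  shows "emeasure (\<mu> u) B = ennreal (Re (hinner u (E B u)))"
  unfolding spec_meas_def
proof (rule emeasure_measure_of_sigma)
  let ?m = "\<lambda>B. ennreal (Re (hinner u (E B u)))"
  show "sigma_algebra UNIV (sets (borel :: real measure))"
    using sets.sigma_algebra_axioms[of "borel :: real measure"] by simp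
  show ca: "countably_additive (sets borel) ?m"
    using E_spec u unfolding is_spectral_measure_of_def by blast
  \<comment> \<open>The empty set has measure zero by countable additivity: the constant sequence of
    empty sets is disjoint, so twice the value is at most the value, and the value is
    finite.\<close>
  have "(\<Sum>i::nat. ?m {}) = ?m {}"
    using ca unfolding countably_additive_def disjoint_family_on_def by force
  moreover have "?m {} + ?m {} \<le> (\<Sum>i::nat. ?m {})"
    using sum_le_suminf[of "\<lambda>_. ?m {}" "{0, 1::nat}"] by (simp add: mult_2[symmetric])
  moreover have r: "0 \<le> Re (hinner u (E {} u))"
    using hinner_E_self[of "{}" u] u by simp
  ultimately have "ennreal (Re (hinner u (E {} u)) + Re (hinner u (E {} u))) \<le> ennreal (Re (hinner u (E {} u)))"
    by (metis ennreal_plus)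
  then have "Re (hinner u (E {} u)) = 0"
    using r by (subst (asm) ennreal_le_iff) auto
  then show "positive (sets borel) ?m"
    by (simp add: positive_def)
  show "B \<in> sets borel" by fact
qed

lemma finite_measure_spec: "inH u \<Longrightarrow> finite_measure (\<mu> u)"
  by (rule finite_measureI) (simp add: emeasure_spec)

lemma measure_spec:
  assumes "inH u" "B \<in> sets borel"
  shows "complex_of_real (measure (\<mu> u) B) = hinner u (E B u)"
  using emeasure_spec[OF assms] hinner_E_self[OF assms(2,1)] by (simp add: measure_def)

lemma integrable_spec_bounded:
  fixes f :: "real \<Rightarrow> complex"
  assumes "inH u" "f \<in> borel_measurable borel" "\<And>x. cmod (f x) \<le> C"
  shows "integrable (\<mu> u) f"
proof -
  interpret finite_measure "\<mu> u" by (rule finite_measure_spec[OF assms(1)])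
  show ?thesis using assms by (intro integrable_const_bound[where B=C]) auto
qed

lemma integrable_spec_x:
  assumes "inD u"
  shows "integrable (\<mu> u) (\<lambda>x. x)"
proof -
  have u: "inH u" using assms by (rule inD_inH)
  interpret finite_measure "\<mu> u" by (rule finite_measure_spec[OF u])
  have "integrable (\<mu> u) (\<lambda>x. 1 + x^2)"
    using assms inD_iff[OF u] by auto
  then show ?thesis
  proof (rule Bochner_Integration.integrable_bound)
    have "\<bar>x\<bar> \<le> 1 + x^2" for x :: real
      using zero_le_power2[of "\<bar>x\<bar> - 1"] by (simp add: power2_eq_square algebra_simps)
    then show "AE x in \<mu> u. norm x \<le> norm (1 + x^2)" by auto
  qed auto
qed

lemma integrable_spec_x_indicator:
  assumes "inD u" "B \<in> sets borel"
  shows "integrable (\<mu> u) (\<lambda>x. complex_of_real x * indicator B x)"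
proof (rule Bochner_Integration.integrable_bound[OF integrable_spec_x[OF assms(1)]])
  show "AE x in \<mu> u. norm (complex_of_real x * indicator B x) \<le> norm x"
    by (auto simp: indicator_def)
qed (use assms(2) in measurable)

lemma polarisation_measure:
  assumes "inH u" "inH w" and B: "B \<in> sets borel"
  shows "(1/4) * (\<Sum>k<4::nat. cnj (\<i>^k) * complex_of_real (measure (\<mu> (hlin 1 u (\<i>^k) w)) B)) = hinner u (E B w)"
proof (rule polarisation_hinner[of "\<lambda>x. complex_of_real (measure (\<mu> x) B)" u w "E B u" "E B w"])
  fix k :: nat
  show "complex_of_real (measure (\<mu> (hlin 1 u (\<i>^k) w)) B) = hinner (hlin 1 u (\<i>^k) w) (hlin 1 (E B u) (\<i>^k) (E B w))"
    using assms by (simp add: measure_spec E_hlin inH_hlin)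
qed (use assms inH_E in auto)

lemma polarisation_mean:
  assumes "inD u" "inD w"
  shows "(1/4) * (\<Sum>k<4::nat. cnj (\<i>^k) * complex_of_real (\<integral>x. x \<partial>\<mu> (hlin 1 u (\<i>^k) w))) = hinner u (Hop om lam v w)"
proof (rule polarisation_hinner[of "\<lambda>y. complex_of_real (\<integral>x. x \<partial>\<mu> y)" u w "Hop om lam v u" "Hop om lam v w"])
  fix k :: nat
  show "complex_of_real (\<integral>x. x \<partial>\<mu> (hlin 1 u (\<i>^k) w)) = hinner (hlin 1 u (\<i>^k) w) (hlin 1 (Hop om lam v u) (\<i>^k) (Hop om lam v w))"
    using assms by (simp add: mean_value[symmetric] inD_hlin Hop_hlin v_L2 inD_inH)
qed (simp_all add: assms v_L2 inH_Hop inD_inH)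

lemma measure_spec_E:
  assumes "inH u" "A \<in> sets borel" "B \<in> sets borel"
  shows "emeasure (\<mu> (E B u)) A = emeasure (\<mu> u) (A \<inter> B)"
proof -
  have "hinner (E B u) (E A (E B u)) = hinner u (E B (E A (E B u)))"
    using assms by (simp add: E_sym inH_E)
  also have "\<dots> = hinner u (E (A \<inter> B) u)"
    using assms by (simp add: E_Int inH_E Int_ac)
  finally show ?thesis
    using assms by (simp add: emeasure_spec inH_E)
qed

text \<open>The measure of \<open>E B u\<close> is that of \<open>u\<close> restricted to
  \<open>B\<close>, so its second moment can only shrink and the domain criterion is
  inherited.\<close>

lemma inD_E:
  assumes "inD u" and B: "B \<in> sets borel"
  shows "inD (E B u)"
proof -
  have u: "inH u" using assms by (simp add: inD_inH)
  have "\<mu> (E B u) = density (\<mu> u) (\<lambda>x. ennreal (indicator B x))"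
  proof (rule measure_eqI)
    fix A assume "A \<in> sets (\<mu> (E B u))"
    then have A: "A \<in> sets borel" by simp
    have "emeasure (density (\<mu> u) (\<lambda>x. ennreal (indicator B x))) A = (\<integral>\<^sup>+x. indicator (A \<inter> B) x \<partial>\<mu> u)"
      using A B by (subst emeasure_density) (auto simp: indicator_def intro!: nn_integral_cong simp del: nn_integral_indicator)
    also have "\<dots> = emeasure (\<mu> u) (A \<inter> B)"
      using A B by (intro nn_integral_indicator) auto
    finally show "emeasure (\<mu> (E B u)) A = emeasure (density (\<mu> u) (\<lambda>x. ennreal (indicator B x))) A"
      using measure_spec_E[OF u A B] by simp
  qed simp
  moreover have "integrable (\<mu> u) (\<lambda>x. indicator B x *\<^sub>R x^2)"
    using inD_iff[OF u] assms by (intro integrable_mult_indicator) auto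
  ultimately show ?thesis
    unfolding inD_iff[OF inH_E[OF B u]] using B by (simp add: integrable_density)
qed

text \<open>Weak form of \<open>H = \<integral> x dE\<close>, localised to \<open>B\<close>. The
  mean value is polarised at the pair \<open>(E B u, w)\<close>; on a Borel set \<open>A\<close> the
  complex measure of this pair agrees with that of \<open>(u, w)\<close> on
  \<open>A \<inter> B\<close>, and this agreement is integrated against \<open>x\<close>.\<close>

lemma mean_restricted:
  assumes "inD u" "inD w" and B[measurable]: "B \<in> sets borel"
  shows "hinner (E B u) (Hop om lam v w) =
    (1/4) * (\<Sum>k<4::nat. cnj (\<i>^k) * (\<integral>x. complex_of_real x * indicator B x \<partial>\<mu> (hlin 1 u (\<i>^k) w)))"
proof -
  have uw: "inH u" "inH w" using assms by (auto simp: inD_inH)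
  \<comment> \<open>The flag separates the two sides of the relation: \<open>True\<close> marks the
    measures of \<open>(E B u, w)\<close> with weight 1, \<open>False\<close> those of
    \<open>(u, w)\<close> with weight \<open>indicator B\<close> and the opposite sign.\<close>
  define M where "M = (\<lambda>(k, b). if b then \<mu> (hlin 1 (E B u) (\<i>^k) w) else \<mu> (hlin 1 u (\<i>^k) w))"
  define c where "c = (\<lambda>(k::nat, b). if b then cnj (\<i>^k) else - cnj (\<i>^k))"
  define h where "h = (\<lambda>(k::nat, b) x::real. if b then 1 else indicator B x :: complex)"
  let ?I = "{..<4} \<times> UNIV :: (nat \<times> bool) set"
  have split: "(\<Sum>i\<in>?I. f i) = (\<Sum>k<4. f (k, True) + f (k, False))" for f :: "nat \<times> bool \<Rightarrow> complex"
    by (simp add: sum.cartesian_product' UNIV_bool add.commute)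
  have H: "inH (hlin 1 (E B u) (\<i>^k) w)" "inH (hlin 1 u (\<i>^k) w)"
    "inD (hlin 1 (E B u) (\<i>^k) w)" "inD (hlin 1 u (\<i>^k) w)" for k :: nat
    using assms uw by (auto intro!: inH_hlin inH_E inD_hlin inD_E)
  have "(\<Sum>i\<in>?I. c i * (\<integral>x. complex_of_real x * h i x \<partial>M i)) = 0"
  proof (rule measure_relation_extend[where N = borel])
    fix A :: "real set" assume A[measurable]: "A \<in> sets borel"
    have I1: "(\<integral>x. indicator A x \<partial>\<mu> y) = complex_of_real (measure (\<mu> y) A)" for y
      using A by (intro integral_indicator_complex) simp
    have I2: "(\<integral>x. indicator A x * indicator B x \<partial>\<mu> y) = complex_of_real (measure (\<mu> y) (A \<inter> B))" for y
      using A by (subst indicator_inter_arith[symmetric], intro integral_indicator_complex) simp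
    have "hinner (E B u) (E A w) = hinner u (E (A \<inter> B) w)"
      using uw A by (simp add: E_sym inH_E E_Int Int_commute)
    then show "(\<Sum>i\<in>?I. c i * (\<integral>x. indicator A x * h i x \<partial>M i)) = 0"
      using polarisation_measure[OF inH_E[OF B uw(1)] uw(2) A] polarisation_measure[OF uw sets.Int[OF A B]]
      unfolding split by (simp add: c_def h_def M_def I1 I2 sum.distrib sum_subtractf)
  next
    show "integrable (M i) (h i)" if "i \<in> ?I" for i
      using H by (cases i) (auto simp: M_def h_def indicator_def intro!: integrable_spec_bounded[where C=1])
    show "integrable (M i) (\<lambda>x. complex_of_real x * h i x)" if "i \<in> ?I" for i
      using H integrable_spec_x_indicator[OF H(3), of UNIV] integrable_spec_x_indicator[OF H(4) B]
      by (cases i) (auto simp: M_def h_def)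
  qed (auto simp: M_def split: if_splits)
  then have "(\<Sum>k<4::nat. cnj (\<i>^k) * complex_of_real (\<integral>x. x \<partial>\<mu> (hlin 1 (E B u) (\<i>^k) w))) =
     (\<Sum>k<4::nat. cnj (\<i>^k) * (\<integral>x. complex_of_real x * indicator B x \<partial>\<mu> (hlin 1 u (\<i>^k) w)))"
    unfolding split by (simp add: c_def h_def M_def sum_subtractf)
  then show ?thesis
    using polarisation_mean[OF inD_E[OF assms(1) B] assms(2)] by simp
qed

text \<open>\<open>H w = u + z w\<close> says that the complex measure of \<open>(u, w)\<close>,
  multiplied by \<open>x - z\<close>, is the measure of \<open>u\<close>. Integrating
  \<open>1 / (x - z)\<close> against both leaves the total mass of the former, which is
  \<open>hinner u w\<close>. An explicit solution \<open>w\<close> thus replaces the construction of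
  a resolvent.\<close>

proposition resolvent_integral:
  assumes u: "inD u" and w: "inD w" and z: "Im z \<noteq> 0" and eq: "Hop om lam v w = hlin 1 u z w"
  shows "(\<integral>x. 1 / (complex_of_real x - z) \<partial>\<mu> u) = hinner u w"
proof -
  have uw: "inH u" "inH w" using assms by (auto simp: inD_inH)
  have nz: "complex_of_real x - z \<noteq> 0" for x using z by (auto simp: complex_eq_iff)
  \<comment> \<open>Indices 0 to 3 are the polarising measures with weight \<open>x - z\<close>;
    index 4 is the measure of \<open>u\<close> with the sign reversed.\<close>
  define M where "M = (\<lambda>k::nat. if k < 4 then \<mu> (hlin 1 u (\<i>^k) w) else \<mu> u)"
  define c where "c = (\<lambda>k::nat. if k < 4 then (1/4) * cnj (\<i>^k) else - 1)"
  define h where "h = (\<lambda>(k::nat) x. if k < 4 then complex_of_real x - z else 1)"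
  have split: "(\<Sum>i<5. f i) = (\<Sum>k<4. f k) + f 4" for f :: "nat \<Rightarrow> complex"
    by (simp add: eval_nat_numeral)
  have H: "inH (hlin 1 u (\<i>^k) w)" "inD (hlin 1 u (\<i>^k) w)" for k :: nat
    using assms uw by (auto intro!: inH_hlin inD_hlin)
  have bound: "cmod (1 / (complex_of_real x - z)) \<le> 1 / \<bar>Im z\<bar>" for x
    using abs_Im_le_cmod[of "complex_of_real x - z"] z nz[of x] by (auto simp: norm_divide intro!: divide_left_mono)
  have int1: "integrable (\<mu> y) (\<lambda>x. (complex_of_real x - z) * indicator A x)" if "inD y" "A \<in> sets borel" for y A
  proof -
    have "integrable (\<mu> y) (\<lambda>x. z * indicator A x)"
      using that inD_inH[OF that(1)] by (auto simp: indicator_def intro!: integrable_spec_bounded[where C="cmod z"])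
    with integrable_spec_x_indicator[OF that] show ?thesis
      by (simp add: left_diff_distrib)
  qed
  have "(\<Sum>i<5. c i * (\<integral>x. (1 / (complex_of_real x - z)) * h i x \<partial>M i)) = 0"
  proof (rule measure_relation_extend[where N = borel])
    fix B :: "real set" assume B[measurable]: "B \<in> sets borel"
    have I1: "(\<integral>x. indicator B x \<partial>\<mu> y) = complex_of_real (measure (\<mu> y) B)" for y
      using B by (intro integral_indicator_complex) simp
    have I2: "(\<integral>x. indicator B x * (complex_of_real x - z) \<partial>\<mu> y) = 
       (\<integral>x. complex_of_real x * indicator B x \<partial>\<mu> y) - z * complex_of_real (measure (\<mu> y) B)" if y: "inD y" for y
    proof -
      have "(\<integral>x. indicator B x * (complex_of_real x - z) \<partial>\<mu> y) = (\<integral>x. complex_of_real x * indicator B x - z * indicator B x \<partial>\<mu> y)"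
        by (simp add: algebra_simps)
      also have "\<dots> = (\<integral>x. complex_of_real x * indicator B x \<partial>\<mu> y) - (\<integral>x. z * indicator B x \<partial>\<mu> y)"
        using B inD_inH[OF y]
        by (intro Bochner_Integration.integral_diff integrable_spec_x_indicator y)
           (auto simp: indicator_def intro!: integrable_spec_bounded[where C="cmod z"])
      finally show ?thesis
        using I1 by simp
    qed
    have "hinner (E B u) (Hop om lam v w) = hinner (E B u) u + z * hinner (E B u) w"
      using uw B by (simp add: eq hinner_hlin_right inH_E)
    moreover have "(\<Sum>k<4. (1/4) * cnj (\<i>^k) * (\<integral>x. indicator B x * (complex_of_real x - z) \<partial>\<mu> (hlin 1 u (\<i>^k) w))) =
       hinner (E B u) (Hop om lam v w) - z * hinner u (E B w)"
      unfolding mean_restricted[OF u w B] polarisation_measure[OF uw B, symmetric] I2[OF H(2)]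
      by (simp add: right_diff_distrib sum_subtractf sum_distrib_left mult_ac)
    ultimately show "(\<Sum>i<5. c i * (\<integral>x. indicator B x * h i x \<partial>M i)) = 0"
      using measure_spec[OF uw(1) B] E_sym[OF B uw] E_sym[OF B uw(1,1)]
      unfolding split by (simp add: c_def h_def M_def I1)
  next
    show "integrable (M i) (h i)" if "i \<in> {..<5}" for i
      using H int1[of _ UNIV] uw by (auto simp: M_def h_def intro!: integrable_spec_bounded[where C=1])
    have "integrable (\<mu> y) (\<lambda>x. 1 / (complex_of_real x - z))" if "inH y" for y
      by (rule integrable_spec_bounded[OF that _ bound]) simp
    moreover have "integrable (\<mu> y) (\<lambda>x. 1 :: complex)" if "inH y" for y
      by (rule integrable_spec_bounded[OF that, where C=1]) auto
    ultimately show "integrable (M i) (\<lambda>x. 1 / (complex_of_real x - z) * h i x)" if "i \<in> {..<5}" for i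
      using H uw nz by (simp add: M_def h_def)
  qed (auto simp: M_def)
  then have "(\<integral>x. 1 / (complex_of_real x - z) \<partial>\<mu> u) = (\<Sum>k<4. (1/4) * cnj (\<i>^k) * complex_of_real (measure (\<mu> (hlin 1 u (\<i>^k) w)) UNIV))"
    unfolding split using nz by (simp add: c_def h_def M_def scaleR_conv_of_real mult.commute)
  also have "\<dots> = hinner u (E UNIV w)"
    using polarisation_measure[OF uw, of UNIV] by (simp add: sum_distrib_left mult_ac)
  finally show ?thesis
    using uw by (simp add: E_UNIV)
qed

text \<open>Chebyshev's inequality with the second moment, which is finite on the domain of
  \<open>H\<close>. It will supply the decay of the spectral density at infinity.\<close>

lemma spec_tail:
  assumes u: "inD u" and T: "T > 0"
  shows "measure (\<mu> u) {T<..} \<le> (\<integral>x. x^2 \<partial>\<mu> u) / T^2"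
proof -
  have uH: "inH u" using u by (rule inD_inH)
  interpret finite_measure "\<mu> u" by (rule finite_measure_spec[OF uH])
  have "measure (\<mu> u) {T<..} = (\<integral>x. indicator {T<..} x \<partial>\<mu> u)" by simp
  also have "\<dots> \<le> (\<integral>x. x^2 / T^2 \<partial>\<mu> u)"
  proof (rule integral_mono)
    show "integrable (\<mu> u) (\<lambda>x. x\<^sup>2 / T\<^sup>2)" using u inD_iff[OF uH] by auto
    show "indicator {T<..} x \<le> x\<^sup>2 / T\<^sup>2" for x
      using T by (auto simp: indicator_def divide_simps intro!: power_mono)
    show "integrable (\<mu> u) (indicator {T<..} :: real \<Rightarrow> real)"
      by (rule integrable_real_indicator) (auto simp: emeasure_spec uH)
  qed
  finally show ?thesis by simp
qed

end

section \<open>Stieltjes transforms of rational functions\<close>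

lemma rational_bounded_aux:
  fixes p q :: "complex poly"
  assumes "degree p < degree q" and nz: "\<And>x::real. x \<ge> 0 \<Longrightarrow> poly q (of_real x) \<noteq> 0"
  shows "\<exists>C\<ge>0. \<forall>x\<ge>0. cmod (poly p (of_real x) / poly q (of_real x)) \<le> C"
proof -
  have "((\<lambda>x. poly p x / poly q x) \<longlongrightarrow> 0) at_infinity"
    using assms(1) by (rule poly_divide_tendsto_0_at_infinity)
  then have "\<forall>\<^sub>F x in at_infinity. dist (poly p x / poly q x) 0 < 1"
    by (rule tendstoD) simp
  then have "\<forall>\<^sub>F x in at_infinity. cmod (poly p x / poly q x) < 1"
    by (simp add: dist_norm)
  then obtain b where b: "\<And>x. b \<le> cmod x \<Longrightarrow> cmod (poly p x / poly q x) < 1"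
    unfolding eventually_at_infinity by auto
  have "compact ((\<lambda>x::real. poly p (of_real x) / poly q (of_real x)) ` {0..\<bar>b\<bar>})"
    using nz by (intro compact_continuous_image continuous_intros) auto
  then have "bounded ((\<lambda>x::real. poly p (of_real x) / poly q (of_real x)) ` {0..\<bar>b\<bar>})"
    by (rule compact_imp_bounded)
  then obtain C where C: "\<And>x. x \<in> {0..\<bar>b\<bar>} \<Longrightarrow> cmod (poly p (of_real x) / poly q (of_real x)) \<le> C"
    unfolding bounded_iff by blast
  show ?thesis
  proof (intro exI conjI allI impI)
    fix x :: real assume "x \<ge> 0"
    then show "cmod (poly p (of_real x) / poly q (of_real x)) \<le> max C 1"
      using C[of x] b[of "of_real x"] less_imp_le
      by (cases "x \<le> \<bar>b\<bar>") (auto simp: le_max_iff_disj not_le abs_less_iff)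
  qed simp
qed

lemma rational_bounded:
  fixes p q :: "complex poly"
  assumes deg: "degree p \<le> degree q" and nz: "\<And>x::real. x \<ge> 0 \<Longrightarrow> poly q (of_real x) \<noteq> 0"
  shows "\<exists>C\<ge>0. \<forall>x\<ge>0. cmod (poly p (of_real x) / poly q (of_real x)) \<le> C"
proof (cases "degree q = 0")
  case True
  then obtain a b where "p = [:a:]" "q = [:b:]" using deg by (metis degree_eq_zeroE le_zero_eq)
  then show ?thesis by (intro exI[of _ "cmod (a / b)"]) auto
next
  case False
  \<comment> \<open>Removing the limit \<open>c\<close> at infinity leaves a numerator of strictly
    smaller degree.\<close>
  define c where "c = coeff p (degree q) / lead_coeff q"
  define r where "r = p - smult c q"
  have "coeff r k = 0" if "k \<ge> degree q" for k
  proof (cases "k = degree q")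
    case True
    have "q \<noteq> 0" using False by auto
    then show ?thesis using True by (simp add: r_def c_def)
  next
    case False
    then show ?thesis using that deg by (simp add: r_def coeff_eq_0)
  qed
  then have "degree r < degree q" using False by (intro degree_lessI) auto
  from rational_bounded_aux[OF this nz] obtain C where C: "C \<ge> 0"
    "\<And>x::real. x \<ge> 0 \<Longrightarrow> cmod (poly r (of_real x) / poly q (of_real x)) \<le> C" by auto
  show ?thesis
  proof (intro exI conjI allI impI)
    show "cmod c + C \<ge> 0" using C by simp
    fix x :: real assume x: "x \<ge> 0"
    have "poly p (of_real x) / poly q (of_real x) = c + poly r (of_real x) / poly q (of_real x)"
      using nz[OF x] by (simp add: r_def field_simps)
    then show "cmod (poly p (of_real x) / poly q (of_real x)) \<le> cmod c + C"
      using norm_triangle_mono[OF order_refl C(2)[OF x], of c] by simp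
  qed
qed

text \<open>The numerator of the derivative has degree at most that of \<open>q * q\<close>, so the
  derivative is again a bounded rational function on the half-line and the mean value inequality
  applies.\<close>

lemma rational_lipschitz:
  fixes p q :: "complex poly"
  assumes deg: "degree p \<le> degree q" and nz: "\<And>x::real. x \<ge> 0 \<Longrightarrow> poly q (of_real x) \<noteq> 0"
  shows "\<exists>C\<ge>0. \<forall>s\<ge>0. \<forall>t\<ge>0. cmod (poly p (of_real s) / poly q (of_real s) - poly p (of_real t) / poly q (of_real t)) \<le> C * \<bar>s - t\<bar>"
proof -
  define d where "d = pderiv p * q - p * pderiv q"
  have "q \<noteq> 0" using nz[of 0] by auto
  then have "degree (pderiv p * q) \<le> degree (q * q)" "degree (p * pderiv q) \<le> degree (q * q)"
    using deg by (auto intro!: order_trans[OF degree_mult_le] simp: degree_pderiv degree_mult_eq_0 degree_mult_eq)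
  then have "degree d \<le> degree (q * q)"
    unfolding d_def using degree_diff_le by blast
  from rational_bounded[OF this] nz obtain C where C: "C \<ge> 0"
    "\<And>x::real. x \<ge> 0 \<Longrightarrow> cmod (poly d (of_real x) / poly (q * q) (of_real x)) \<le> C" by auto
  have D: "((\<lambda>x. poly p (of_real x) / poly q (of_real x)) has_vector_derivative poly d (of_real x) / poly (q * q) (of_real x)) (at x within {0..})" if "x \<ge> 0" for x :: real
    using nz[OF that]
    by (intro has_vector_derivative_real_field) (auto intro!: derivative_eq_intros simp: d_def)
  show ?thesis
  proof (intro exI conjI allI impI)
    fix s t :: real assume st: "s \<ge> 0" "t \<ge> 0"
    show "cmod (poly p (of_real s) / poly q (of_real s) - poly p (of_real t) / poly q (of_real t)) \<le> C * \<bar>s - t\<bar>"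
      unfolding real_norm_def[symmetric]
    proof (rule differentiable_bound[of "{0..}" _ "\<lambda>x h. h *\<^sub>R (poly d (of_real x) / poly (q * q) (of_real x))"])
      fix x :: real assume x: "x \<in> {0..}"
      show "((\<lambda>x. poly p (of_real x) / poly q (of_real x)) has_derivative (\<lambda>h. h *\<^sub>R (poly d (of_real x) / poly (q * q) (of_real x)))) (at x within {0..})"
        using D x unfolding has_vector_derivative_def by auto
      show "onorm (\<lambda>h. h *\<^sub>R (poly d (of_real x) / poly (q * q) (of_real x))) \<le> C"
      proof (rule onorm_bound)
        show "norm (h *\<^sub>R (poly d (of_real x) / poly (q * q) (of_real x))) \<le> C * norm h" for h :: real
          unfolding norm_scaleR real_norm_def mult.commute[of "\<bar>h\<bar>"]
          using C x by (intro mult_right_mono C(2)) auto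
      qed (rule C)
    qed (use st in auto)
  qed (use C in auto)
qed

lemma set_integrable_inverse_square_shift: "set_integrable lborel {0<..} (\<lambda>x::real. 1 / (1 + x)^2)"
proof -
  let ?F = "\<lambda>x::real. - 1 / (1 + x)"
  have z: "(0::ereal) = ereal 0" by simp
  have 1: "((?F \<circ> real_of_ereal) \<longlongrightarrow> ?F 0) (at_right 0)"
    unfolding z ereal_tendsto_simps by (intro tendsto_intros) auto
  have 2: "((?F \<circ> real_of_ereal) \<longlongrightarrow> 0) (at_left \<infinity>)"
    unfolding ereal_tendsto_simps by real_asymp
  have "set_integrable lborel (einterval 0 \<infinity>) (\<lambda>x::real. 1 / (1 + x)^2)"
    by (rule interval_integral_FTC_nonneg[where F = ?F];
        use 1 2 in \<open>auto intro!: derivative_eq_intros continuous_intros simp: power2_eq_square add_eq_0_iff\<close>)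
  then show ?thesis by (simp add: z einterval_def greaterThan_def)
qed

lemma set_integrable_inverse_square_bound:
  fixes f :: "real \<Rightarrow> complex"
  assumes "f \<in> borel_measurable borel" "\<And>x. x > 0 \<Longrightarrow> cmod (f x) \<le> C / (1 + x)^2"
  shows "set_integrable lborel {0<..} f"
proof (rule set_integrable_bound)
  show "set_integrable lborel {0<..} (\<lambda>x. C * (1 / (1 + x)^2))"
    by (intro set_integrable_mult_right set_integrable_inverse_square_shift)
  show "AE x in lborel. x \<in> {0<..} \<longrightarrow> cmod (f x) \<le> norm (C * (1 / (1 + x)^2))"
  proof (intro AE_I2 impI)
    fix x :: real assume "x \<in> {0<..}"
    then have "cmod (f x) \<le> C * (1 / (1 + x)^2)" using assms(2) by simp
    from order_trans[OF this abs_ge_self] show "cmod (f x) \<le> norm (C * (1 / (1 + x)^2))"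
      unfolding real_norm_def .
  qed
  show "set_borel_measurable lborel {0<..} f"
    using assms(1) by (simp add: set_borel_measurable_def)
qed

lemma rational_decay:
  fixes p q :: "complex poly"
  assumes deg: "degree p + 2 \<le> degree q" and nz: "\<And>x::real. x \<ge> 0 \<Longrightarrow> poly q (of_real x) \<noteq> 0"
  shows "\<exists>C\<ge>0. \<forall>x\<ge>0. cmod (poly p (of_real x) / poly q (of_real x)) \<le> C / (1 + x)^2"
proof -
  have "degree (p * [:1, 1:]^2) \<le> degree q"
    using deg by (intro order_trans[OF degree_mult_le]) (simp add: degree_power_eq)
  from rational_bounded[OF this nz] obtain C where C: "C \<ge> 0"
    "\<And>x::real. x \<ge> 0 \<Longrightarrow> cmod (poly (p * [:1, 1:]^2) (of_real x) / poly q (of_real x)) \<le> C" by auto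
  show ?thesis
  proof (intro exI conjI allI impI)
    fix x :: real assume x: "x \<ge> 0"
    have "cmod (1 + complex_of_real x) = 1 + x"
      using x by (metis abs_of_nonneg add_nonneg_nonneg norm_of_real of_real_1 of_real_add zero_le_one)
    then have "cmod (poly p (of_real x) / poly q (of_real x)) * (1 + x)^2 \<le> C"
      using C(2)[OF x] by (simp add: norm_mult norm_divide norm_power)
    then show "cmod (poly p (of_real x) / poly q (of_real x)) \<le> C / (1 + x)^2"
      using x by (simp add: pos_le_divide_eq)
  qed (use C in auto)
qed

lemma borel_measurable_poly [measurable]: "(\<lambda>x. poly p (complex_of_real x)) \<in> borel_measurable borel"
  by (intro borel_measurable_continuous_onI continuous_intros)

text \<open>Polynomials in two variables of degree below \<open>n\<close> in each, with the powers
  of \<open>z\<close> pulled out: an integration over \<open>x\<close> then acts on the coefficients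
  and leaves a polynomial in \<open>z\<close>.\<close>

definition bipoly :: "nat \<Rightarrow> (complex \<Rightarrow> complex \<Rightarrow> complex) \<Rightarrow> bool" where
  "bipoly n g \<longleftrightarrow> (\<exists>q :: nat \<Rightarrow> complex poly. (\<forall>j. degree (q j) \<le> n - 1) \<and>
     (\<forall>x z. g x z = (\<Sum>j<n. z^j * poly (q j) x)))"

lemma bipoly_add:
  assumes "bipoly n f" "bipoly n g" shows "bipoly n (\<lambda>x z. f x z + g x z)"
proof -
  obtain p q where *: "\<And>j. degree (p j) \<le> n - 1" "\<And>j. degree (q j) \<le> n - 1"
    "\<And>x z. f x z = (\<Sum>j<n. z^j * poly (p j) x)" "\<And>x z. g x z = (\<Sum>j<n. z^j * poly (q j) x)"
    using assms unfolding bipoly_def by blast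
  then show ?thesis
    unfolding bipoly_def
    by (intro exI[of _ "\<lambda>j. p j + q j"]) (auto intro: degree_add_le simp: sum.distrib algebra_simps)
qed

lemma bipoly_cmult:
  assumes "bipoly n f" shows "bipoly n (\<lambda>x z. c * f x z)"
proof -
  obtain p where *: "\<And>j. degree (p j) \<le> n - 1" "\<And>x z. f x z = (\<Sum>j<n. z^j * poly (p j) x)"
    using assms unfolding bipoly_def by blast
  then show ?thesis
    unfolding bipoly_def
    by (intro exI[of _ "\<lambda>j. smult c (p j)"])
       (auto intro: order_trans[OF degree_smult_le] simp: sum_distrib_left algebra_simps)
qed

lemma bipoly_sum: "(\<And>i. i \<in> I \<Longrightarrow> bipoly n (f i)) \<Longrightarrow> bipoly n (\<lambda>x z. \<Sum>i\<in>I. f i x z)"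
proof (induction I rule: infinite_finite_induct)
  case (insert i I)
  then show ?case by (auto intro!: bipoly_add)
qed (auto simp: bipoly_def intro!: exI[of _ "\<lambda>_. 0"])

lemma bipoly_monom:
  assumes "a < n" "b < n" shows "bipoly n (\<lambda>x z. z^a * x^b)"
  unfolding bipoly_def
proof (intro exI[of _ "\<lambda>j. if j = a then monom 1 b else 0"] conjI allI)
  show "degree (if j = a then monom (1::complex) b else 0) \<le> n - 1" for j
    using assms by (cases n) (auto simp: degree_monom_eq)
  show "z^a * x^b = (\<Sum>j<n. z^j * poly (if j = a then monom 1 b else 0) x)" for x z :: complex
    using assms by (simp add: poly_monom if_distrib if_distribR cong: if_cong)
qed

text \<open>For \<open>i \<le> k\<close> the difference is \<open>(x * z)^i\<close> times a
  difference of pure powers, hence a geometric sum; the other case follows by antisymmetry in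
  \<open>i\<close> and \<open>k\<close>.\<close>

lemma bipoly_divided_difference_monom:
  assumes "i \<le> n" "k \<le> n"
  shows "\<exists>g. bipoly n g \<and> (\<forall>x z::complex. z^i * x^k - x^i * z^k = (x - z) * g x z)"
proof -
  have *: "\<exists>g. bipoly n g \<and> (\<forall>x z::complex. z^i * x^k - x^i * z^k = (x - z) * g x z)" if "i \<le> k" "k \<le> n" for i k
  proof (intro exI conjI allI)
    let ?g = "\<lambda>x z::complex. \<Sum>l<k-i. z^(i + (k - i - Suc l)) * x^(i + l)"
    show "bipoly n ?g" using that by (intro bipoly_sum bipoly_monom) auto
    fix x z :: complex
    have "z^i * x^k - x^i * z^k = (x * z)^i * (x^(k-i) - z^(k-i))"
      using that by (simp add: power_mult_distrib algebra_simps flip: power_add)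
    also have "\<dots> = (x - z) * ((x * z)^i * (\<Sum>l<k-i. z^(k - i - Suc l) * x^l))"
      by (subst power_diff_sumr2) simp
    also have "(x * z)^i * (\<Sum>l<k-i. z^(k - i - Suc l) * x^l) = ?g x z"
      unfolding sum_distrib_left by (intro sum.cong refl) (simp only: power_mult_distrib power_add mult_ac)
    finally show "z^i * x^k - x^i * z^k = (x - z) * ?g x z" .
  qed
  show ?thesis
  proof (cases "i \<le> k")
    case True
    then show ?thesis using * assms by blast
  next
    case False
    then obtain g where g: "bipoly n g" "\<And>x z::complex. z^k * x^i - x^k * z^i = (x - z) * g x z"
      using *[of k i] assms by auto
    show ?thesis
    proof (intro exI[of _ "\<lambda>x z. (-1) * g x z"] conjI allI)
      show "bipoly n (\<lambda>x z. (-1) * g x z)" by (intro bipoly_cmult g)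
      show "z^i * x^k - x^i * z^k = (x - z) * ((-1) * g x z)" for x z :: complex
        using g(2)[of z x] by (simp add: algebra_simps)
    qed
  qed
qed

text \<open>The quotient \<open>g\<close> is the Bezoutian of \<open>p\<close> and \<open>r\<close>.
  Expanding both polynomials reduces the division to pairs of monomials.\<close>

lemma bipoly_divided_difference:
  fixes p r :: "complex poly"
  assumes "degree p \<le> n" "degree r \<le> n"
  shows "\<exists>g. bipoly n g \<and> (\<forall>x z. poly r z * poly p x - poly r x * poly p z = (x - z) * g x z)"
proof -
  obtain g where g: "\<And>i k. i \<le> n \<Longrightarrow> k \<le> n \<Longrightarrow> bipoly n (g i k)"
    "\<And>i k x z. i \<le> n \<Longrightarrow> k \<le> n \<Longrightarrow> z^i * x^k - x^i * z^k = (x - z) * g i k x z"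
    using bipoly_divided_difference_monom[of _ n] by metis
  have alt: "poly q x = (\<Sum>i\<le>n. coeff q i * x^i)" if "degree q \<le> n" for q and x :: complex
    by (subst poly_as_sum_of_monoms'[OF that, symmetric]) (simp add: poly_sum poly_monom)
  show ?thesis
  proof (intro exI conjI allI)
    let ?g = "\<lambda>x z. \<Sum>i\<le>n. \<Sum>k\<le>n. (coeff r i * coeff p k) * g i k x z"
    show "bipoly n ?g" using g by (intro bipoly_sum bipoly_cmult) auto
    fix x z :: complex
    have "poly r z * poly p x - poly r x * poly p z = (\<Sum>i\<le>n. \<Sum>k\<le>n. (coeff r i * coeff p k) * (z^i * x^k - x^i * z^k))"
      unfolding alt[OF assms(1)] alt[OF assms(2)] sum_product sum_subtractf[symmetric]
      by (intro sum.cong refl) (simp add: algebra_simps)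
    also have "\<dots> = (\<Sum>i\<le>n. \<Sum>k\<le>n. (coeff r i * coeff p k) * ((x - z) * g i k x z))"
      by (intro sum.cong refl) (simp add: g(2))
    also have "\<dots> = (x - z) * ?g x z"
      by (simp add: sum_distrib_left mult_ac)
    finally show "poly r z * poly p x - poly r x * poly p z = (x - z) * ?g x z" .
  qed
qed

text \<open>\<open>1 / (x - z)\<close> is not integrable on the half-line, while this kernel is
  \<open>1 / (x - z) - 1 / (1 + x)\<close> and decays quadratically. Its primitive stays on the
  principal branch because \<open>x - z\<close> lies in the lower half-plane. At 0 the primitive is
  \<open>Ln (- z)\<close>, which equals \<open>Ln z - \<i> * pi\<close> for \<open>z\<close> above
  the axis.\<close>

lemma integral_cauchy_kernel:
  assumes z: "Im z > 0"
  shows "set_integrable lborel {0<..} (\<lambda>x. (1 + z) / ((complex_of_real x - z) * (1 + complex_of_real x)))"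
    and "(LINT x:{0<..}|lborel. (1 + z) / ((complex_of_real x - z) * (1 + complex_of_real x))) = - (Ln z - \<i> * pi)"
proof -
  have nz: "complex_of_real x - z \<noteq> 0" "complex_of_real x - z \<notin> \<real>\<^sub>\<le>\<^sub>0" for x
    using z by (auto simp: complex_eq_iff complex_nonpos_Reals_iff)
  have nz1: "1 + complex_of_real x \<noteq> 0" "1 + complex_of_real x \<notin> \<real>\<^sub>\<le>\<^sub>0" if "x \<ge> 0" for x
    using that by (auto simp: complex_eq_iff complex_nonpos_Reals_iff)
  have n1: "cmod (1 + complex_of_real x) = 1 + x" if "x \<ge> 0" for x
    using that by (metis abs_of_nonneg add_nonneg_nonneg norm_of_real of_real_1 of_real_add zero_le_one)
  let ?f = "\<lambda>x. (1 + z) / ((complex_of_real x - z) * (1 + complex_of_real x))"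
  let ?C = "1 + cmod (1 + z) / Im z"
  show int: "set_integrable lborel {0<..} ?f"
  proof (rule set_integrable_inverse_square_bound[where C = "cmod (1 + z) * ?C"])
    fix x :: real assume x: "x > 0"
    have "(1 + complex_of_real x) / (complex_of_real x - z) = 1 + (1 + z) / (complex_of_real x - z)"
      using nz[of x] by (simp add: field_simps)
    also have "cmod \<dots> \<le> 1 + cmod (1 + z) / cmod (complex_of_real x - z)"
      using norm_triangle_ineq[of 1 "(1 + z) / (complex_of_real x - z)"] by (simp add: norm_divide)
    also have "\<dots> \<le> ?C"
      using abs_Im_le_cmod[of "complex_of_real x - z"] z nz[of x]
      by (intro add_left_mono divide_left_mono) (auto intro!: mult_pos_pos)
    finally have "cmod ((1 + complex_of_real x) / (complex_of_real x - z)) \<le> ?C" .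
    moreover have "?f x = (1 + z) * ((1 + complex_of_real x) / (complex_of_real x - z)) / (1 + complex_of_real x)^2"
      using nz1[of x] x by (simp add: power2_eq_square)
    then have "cmod (?f x) = cmod (1 + z) * cmod ((1 + complex_of_real x) / (complex_of_real x - z)) / (1 + x)^2"
      using n1[of x] x by (simp only: norm_mult norm_divide norm_power less_imp_le)
    ultimately show "cmod (?f x) \<le> cmod (1 + z) * ?C / (1 + x)^2"
      by (simp only:) (intro divide_right_mono mult_left_mono; simp)
  qed measurable
  let ?F = "\<lambda>x. Ln (complex_of_real x - z) - Ln (1 + complex_of_real x)"
  have ei: "einterval 0 \<infinity> = {0<..}" by (auto simp: einterval_def)
  have z0: "(0::ereal) = ereal 0" by simp
  have "(LBINT x=0..\<infinity>. ?f x) = 0 - ?F 0"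
  proof (rule interval_integral_FTC_integrable)
    fix x :: real assume "0 < ereal x"
    then have x: "x > 0" by simp
    have "((\<lambda>w. Ln (w - z) - Ln (1 + w)) has_field_derivative ?f x) (at (complex_of_real x))"
      using nz[of x] nz1[of x] x by (auto intro!: derivative_eq_intros simp: divide_simps)
    then show "(?F has_vector_derivative ?f x) (at x)"
      by (rule has_vector_derivative_real_field)
    show "isCont ?f x"
      using nz[of x] nz1[of x] x by (intro continuous_intros) auto
  next
    show "set_integrable lborel (einterval 0 \<infinity>) ?f" unfolding ei by (rule int)
    show "((?F \<circ> real_of_ereal) \<longlongrightarrow> ?F 0) (at_right 0)"
      unfolding z0 ereal_tendsto_simps using nz[of 0] by (intro tendsto_intros) (auto simp: complex_nonpos_Reals_iff)
    \<comment> \<open>Both logarithms diverge; their difference is the logarithm of a quotient that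
      tends to 1, the denominator being a positive real.\<close>
    have "((\<lambda>x. Ln ((complex_of_real x - z) / complex_of_real (1 + x))) \<longlongrightarrow> Ln 1) at_top"
    proof (rule tendsto_Ln)
      have "((\<lambda>x. 1 - (1 + z) * complex_of_real (1 / (1 + x))) \<longlongrightarrow> 1 - (1 + z) * complex_of_real 0) at_top"
        by (intro tendsto_intros) real_asymp
      moreover have "\<forall>\<^sub>F x in at_top. 1 - (1 + z) * complex_of_real (1 / (1 + x)) = (complex_of_real x - z) / complex_of_real (1 + x)"
        using eventually_gt_at_top[of 0] by eventually_elim (use nz1 in \<open>simp add: field_simps\<close>)
      ultimately show "((\<lambda>x. (complex_of_real x - z) / complex_of_real (1 + x)) \<longlongrightarrow> 1) at_top"
        by (simp add: tendsto_cong)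
    qed simp
    moreover have "\<forall>\<^sub>F x in at_top. Ln ((complex_of_real x - z) / complex_of_real (1 + x)) = ?F x"
      using eventually_gt_at_top[of 0]
    proof eventually_elim
      case (elim x)
      have "Ln (1 + complex_of_real x) = complex_of_real (ln (1 + x))"
        using Ln_of_real[of "1 + x"] elim by simp
      then show ?case
        using Ln_divide_of_real[of "1 + x" "complex_of_real x - z"] elim nz[of x] by simp
    qed
    ultimately show "((?F \<circ> real_of_ereal) \<longlongrightarrow> 0) (at_left \<infinity>)"
      unfolding ereal_tendsto_simps by (simp add: tendsto_cong)
  qed simp
  then have "(LINT x:{0<..}|lborel. ?f x) = - Ln (- z)"
    by (simp add: interval_lebesgue_integral_0_infty)
  then show "(LINT x:{0<..}|lborel. ?f x) = - (Ln z - \<i> * pi)"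
    using z by (subst (asm) Ln_minus) auto
qed

text \<open>Counterpart of the preceding kernel on the cut. The primitives contribute
  \<open>ln e\<close> from the two sides of \<open>w\<close> with opposite signs, so the value stays
  finite as the excision shrinks.\<close>

lemma principal_value_kernel:
  fixes w e :: real
  assumes we: "0 < e" "e < w"
  defines "A \<equiv> {0<..} - {w - e..w + e}" and "k \<equiv> \<lambda>x. (1 + w) / ((x - w) * (1 + x))"
  shows "set_integrable lborel A k"
    and "(LINT x:A|lborel. k x) = ln (1 + w + e) - ln (1 + w - e) - ln w"
proof -
  have z: "(0::ereal) = ereal 0" by simp
  have ei: "einterval 0 (ereal (w - e)) = {0<..<w - e}" "einterval (ereal (w + e)) \<infinity> = {w + e<..}"
    by (auto simp: einterval_def z)
  let ?F1 = "\<lambda>x. ln (1 + x) - ln (w - x)" and ?F2 = "\<lambda>x. ln (x - w) - ln (1 + x)"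
  have lim1: "((?F1 \<circ> real_of_ereal) \<longlongrightarrow> ?F1 0) (at_right 0)"
    unfolding z ereal_tendsto_simps using we by (intro tendsto_intros) auto
  have lim2: "((?F1 \<circ> real_of_ereal) \<longlongrightarrow> ?F1 (w - e)) (at_left (ereal (w - e)))"
    unfolding z ereal_tendsto_simps using we by (intro tendsto_intros) auto
  have lim3: "((?F2 \<circ> real_of_ereal) \<longlongrightarrow> ?F2 (w + e)) (at_right (ereal (w + e)))"
    unfolding z ereal_tendsto_simps using we by (intro tendsto_intros) auto
  have lim4: "((?F2 \<circ> real_of_ereal) \<longlongrightarrow> 0) (at_left \<infinity>)"
    unfolding z ereal_tendsto_simps by real_asymp
  \<comment> \<open>Left of \<open>w\<close> the kernel is negative, so the nonnegative integrand
    there is \<open>- k\<close>.\<close>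
  have n1: "AE x in lborel. 0 < ereal x \<longrightarrow> ereal x < ereal (w - e) \<longrightarrow> 0 \<le> - k x"
    using we by (intro AE_I2) (auto simp: k_def z intro!: divide_nonneg_nonpos mult_nonpos_nonneg)
  have n2: "AE x in lborel. ereal (w + e) < ereal x \<longrightarrow> ereal x < \<infinity> \<longrightarrow> 0 \<le> k x"
    using we by (intro AE_I2) (auto simp: k_def intro!: divide_nonneg_nonneg mult_nonneg_nonneg)
  have d1: "DERIV ?F1 x :> - k x" if "0 < x" "x < w - e" for x
  proof -
    have "DERIV ?F1 x :> 1 / (1 + x) - (-1) / (w - x)"
      using that we by (auto intro!: derivative_eq_intros)
    also have "1 / (1 + x) - (-1) / (w - x) = - k x"
      using that we by (simp add: k_def divide_simps) (simp add: algebra_simps)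
    finally show ?thesis .
  qed
  have d2: "DERIV ?F2 x :> k x" if "w + e < x" for x
  proof -
    have "DERIV ?F2 x :> 1 / (x - w) - 1 / (1 + x)"
      using that we by (auto intro!: derivative_eq_intros)
    also have "1 / (x - w) - 1 / (1 + x) = k x"
      using that we by (simp add: k_def field_simps)
    finally show ?thesis .
  qed
  have c: "isCont k x" if "x > 0" "x \<noteq> w" for x
    unfolding k_def using that by (intro continuous_intros) auto
  have I1: "set_integrable lborel (einterval 0 (ereal (w - e))) (\<lambda>x. - k x)" "(LBINT x=0..ereal (w - e). - k x) = ?F1 (w - e) - ?F1 0"
    by (rule interval_integral_FTC_nonneg[OF _ _ _ n1 lim1 lim2]; use we d1 c in \<open>auto simp: z intro!: continuous_intros\<close>)+
  have I2: "set_integrable lborel (einterval (ereal (w + e)) \<infinity>) k" "(LBINT x=ereal (w + e)..\<infinity>. k x) = 0 - ?F2 (w + e)"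
    by (rule interval_integral_FTC_nonneg[OF _ _ _ n2 lim3 lim4]; use we d2 c in auto)+
  have A: "A = {0<..<w - e} \<union> {w + e<..}" using we by (auto simp: A_def)
  have i1: "set_integrable lborel {0<..<w - e} k" and v1: "(LINT x:{0<..<w - e}|lborel. k x) = - (?F1 (w - e) - ?F1 0)"
  proof -
    show "set_integrable lborel {0<..<w - e} k"
      using set_integrable_mult_right[of "-1" lborel "{0<..<w - e}" "\<lambda>x. - k x"] I1(1) by (simp add: ei)
    have "(LINT x:{0<..<w - e}|lborel. - k x) = ?F1 (w - e) - ?F1 0"
      using I1(2) we unfolding interval_lebesgue_integral_def ei by simp
    then show "(LINT x:{0<..<w - e}|lborel. k x) = - (?F1 (w - e) - ?F1 0)"
      using set_integral_mult_right[of lborel "{0<..<w - e}" "-1" k] by simp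
  qed
  have i2: "set_integrable lborel {w + e<..} k" and v2: "(LINT x:{w + e<..}|lborel. k x) = - ?F2 (w + e)"
    using I2 by (simp_all add: ei interval_integral_to_infinity_eq)
  show "set_integrable lborel A k"
    unfolding A by (rule set_integrable_Un[OF i1 i2]) auto
  have "(LINT x:A|lborel. k x) = - (?F1 (w - e) - ?F1 0) - ?F2 (w + e)"
    unfolding A using we by (subst set_integral_Un[OF _ i1 i2]) (auto simp: v1 v2)
  then show "(LINT x:A|lborel. k x) = ln (1 + w + e) - ln (1 + w - e) - ln w"
    by (simp add: algebra_simps)
qed

lemma set_integral_remove_small_interval:
  fixes f :: "real \<Rightarrow> complex"
  assumes f: "set_integrable lborel {0<..} f" and C: "\<And>x. x > 0 \<Longrightarrow> cmod (f x) \<le> C" and w: "w > 0"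
  shows "((\<lambda>e. LINT x:({0<..} - {w - e..w + e})|lborel. f x) \<longlongrightarrow> (LINT x:{0<..}|lborel. f x)) (at_right 0)"
proof (rule LIM_zero_cancel, rule Lim_null_comparison)
  let ?A = "\<lambda>e. {0<..} - {w - e..w + e}"
  have "((\<lambda>e. 2 * e * C) \<longlongrightarrow> 2 * 0 * C) (at_right 0)" by (intro tendsto_intros)
  then show "((\<lambda>e. 2 * e * C) \<longlongrightarrow> 0) (at_right 0)" by simp
  show "\<forall>\<^sub>F e in at_right 0. cmod ((LINT x:?A e|lborel. f x) - (LINT x:{0<..}|lborel. f x)) \<le> 2 * e * C"
    unfolding eventually_at_right_field
  proof (intro exI conjI allI impI)
    show "0 < w" by fact
    fix e :: real assume e: "0 < e" "e < w"
    have "{0<..} = ?A e \<union> {w - e..w + e}" using e by auto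
    moreover have iA: "set_integrable lborel (?A e) f" and iB: "set_integrable lborel {w - e..w + e} f"
      using e by (intro set_integrable_subset[OF f]; force)+
    moreover have "(LINT x:?A e \<union> {w - e..w + e}|lborel. f x) = (LINT x:?A e|lborel. f x) + (LINT x:{w - e..w + e}|lborel. f x)"
      by (rule set_integral_Un[OF _ iA iB]) auto
    ultimately have "cmod ((LINT x:{0<..}|lborel. f x) - (LINT x:?A e|lborel. f x)) = cmod (LINT x:{w - e..w + e}|lborel. f x)"
      by simp
    also have "\<dots> \<le> (LINT x:{w - e..w + e}|lborel. cmod (f x))"
      by (rule set_integral_norm_bound[OF iB])
    also have "\<dots> \<le> (LINT x:{w - e..w + e}|lborel. C)"
    proof (rule set_integral_mono[OF set_integrable_norm[OF iB]])
      show "set_integrable lborel {w - e..w + e} (\<lambda>x. C)"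
        unfolding set_integrable_def real_scaleR_def
        using emeasure_bounded_finite[of "{w - e..w + e}"]
        by (intro integrable_mult_left integrable_real_indicator) auto
    qed (use C e in auto)
    also have "\<dots> = 2 * e * C" using e by (simp add: set_integral_const)
    finally show "cmod ((LINT x:?A e|lborel. f x) - (LINT x:{0<..}|lborel. f x)) \<le> 2 * e * C"
      by (simp only: norm_minus_commute)
  qed
qed

text \<open>On the cut the Stieltjes transform of a rational function is a rational function plus a
  rational multiple of the logarithm, since the divided difference of the integrand is again rational.\<close>
proposition rational_stieltjes_transform:
  fixes p r :: "complex poly"
  assumes deg: "degree p + 2 \<le> degree r" and nz: "\<And>x::real. x \<ge> 0 \<Longrightarrow> poly r (of_real x) \<noteq> 0"
  defines "f \<equiv> \<lambda>x::real. poly p (of_real x) / poly r (of_real x)"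
  shows "\<exists>P. degree P \<le> degree r \<and>
    (\<forall>z. Im z > 0 \<longrightarrow> poly r z * (LINT x:{0<..}|lborel. f x / (of_real x - z)) = poly P z - poly p z * (Ln z - \<i> * pi)) \<and>
    (\<forall>w>0. ((\<lambda>e. LINT x:({0<..} - {w - e..w + e})|lborel. f x / of_real (x - w)) \<longlongrightarrow> pv f w) (at_right 0) \<and>
       poly r (of_real w) * pv f w = poly P (of_real w) - poly p (of_real w) * of_real (ln w)) \<and>
    (poly p 0 = 0 \<longrightarrow> poly r 0 * (LINT x:{0<..}|lborel. f x / of_real x) = poly P 0)"
proof -
  define n where "n = degree r"
  have n: "n \<ge> 2" using deg by (simp add: n_def)
  \<comment> \<open>The factor \<open>1 + x\<close> is attached to \<open>p\<close> so that the
    remainder of the division carries the integrable kernel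
    \<open>(1 + z) / ((x - z) * (1 + x))\<close> in place of \<open>1 / (x - z)\<close>. The degree
    gap leaves room for it.\<close>
  have "degree (p * [:1, 1:]) \<le> n" "degree r \<le> n"
    using deg degree_mult_le[of p "[:1, 1:]"] by (auto simp: n_def)
  from bipoly_divided_difference[OF this] obtain g where g: "bipoly n g"
    "\<And>x z. poly r z * poly (p * [:1, 1:]) x - poly r x * poly (p * [:1, 1:]) z = (x - z) * g x z" by blast
  have "poly (p * [:1, 1:]) x = poly p x * (1 + x)" for x by (simp add: algebra_simps)
  note pe = this
  obtain q :: "nat \<Rightarrow> complex poly" where q0: "\<forall>j. degree (q j) \<le> n - 1" "\<forall>x z. g x z = (\<Sum>j<n. z^j * poly (q j) x)"
    using g(1) unfolding bipoly_def by blast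
  have q1: "degree (q j) \<le> n - 1" for j using q0 by blast
  have q2: "poly r z * (poly p x * (1 + x)) - poly r x * (poly p z * (1 + z)) = (x - z) * (\<Sum>j<n. z^j * poly (q j) x)" for x z
    using g(2)[of z x] q0(2) unfolding pe by simp
  \<comment> \<open>Coefficients of the Bezoutian over \<open>r\<close> times \<open>1 + x\<close>:
    degree at most \<open>n - 1\<close> over degree \<open>n + 1\<close>, which is the inverse
    square decay that makes them integrable.\<close>
  define g where "g = (\<lambda>j (x::real). poly (q j) (of_real x) / poly (r * [:1, 1:]) (of_real x))"
  have r0: "r \<noteq> 0" using nz[of 0] by auto
  have nz1: "1 + complex_of_real x \<noteq> 0" if "x \<ge> 0" for x using that by (auto simp: complex_eq_iff)
  have "\<exists>C\<ge>0. \<forall>x\<ge>0. cmod (g j x) \<le> C / (1 + x)^2" for j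
    unfolding g_def
  proof (rule rational_decay)
    have "degree (r * [:1, 1:]) = n + 1" using r0 by (subst degree_mult_eq) (auto simp: n_def)
    then show "degree (q j) + 2 \<le> degree (r * [:1, 1:])" using q1[of j] n by simp
    show "poly (r * [:1, 1:]) (complex_of_real x) \<noteq> 0" if "x \<ge> 0" for x
    proof -
      have "poly (r * [:1, 1:]) (complex_of_real x) = poly r (complex_of_real x) * (1 + complex_of_real x)"
        by (simp add: algebra_simps)
      then show ?thesis using nz[OF that] nz1[OF that] by (simp only: mult_eq_0_iff simp_thms)
    qed
  qed
  then obtain C where C: "\<And>j. C j \<ge> 0" "\<And>j x. x \<ge> 0 \<Longrightarrow> cmod (g j x) \<le> C j / (1 + x)^2" by metis
  have gi: "set_integrable lborel {0<..} (g j)" for j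
    by (rule set_integrable_inverse_square_bound[where C = "C j"]) (use C(2) in \<open>auto simp: g_def\<close>)
  define c where "c = (\<lambda>j. LINT x:{0<..}|lborel. g j x)"
  define P where "P = (\<Sum>j<n. monom (c j) j)"
  define \<Phi> where "\<Phi> = (\<lambda>z x. \<Sum>j<n. z^j * g j x)"
  have degP: "degree P \<le> degree r"
    unfolding P_def by (intro degree_sum_le) (auto simp: n_def intro: order_trans[OF degree_monom_le])
  have PhiI: "set_integrable lborel {0<..} (\<Phi> z)" "(LINT x:{0<..}|lborel. \<Phi> z x) = poly P z" for z
  proof -
    have i: "integrable lborel (\<lambda>x. z^j * (indicator {0<..} x *\<^sub>R g j x))" for j
      using gi[of j] unfolding set_integrable_def by (intro integrable_mult_right)
    have e: "(\<lambda>x. indicator {0<..} x *\<^sub>R \<Phi> z x) = (\<lambda>x. \<Sum>j<n. z^j * (indicator {0<..} x *\<^sub>R g j x))"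
      by (simp add: \<Phi>_def scaleR_sum_right)
    show "set_integrable lborel {0<..} (\<Phi> z)"
      unfolding set_integrable_def e by (intro Bochner_Integration.integrable_sum i)
    show "(LINT x:{0<..}|lborel. \<Phi> z x) = poly P z"
      unfolding set_lebesgue_integral_def e Bochner_Integration.integral_sum[OF i] P_def
        integral_mult_right_zero poly_sum poly_monom c_def
      by (simp only: mult.commute)
  qed
  have Phib: "cmod (\<Phi> z x) \<le> (\<Sum>j<n. cmod z^j * C j)" if "x > 0" for x z
  proof -
    have "cmod (g j x) \<le> C j" for j
    proof -
      have "1 \<le> (1 + x)^2" using that by (simp add: one_le_power)
      then have "C j / (1 + x)^2 \<le> C j / 1" using C(1)[of j] by (intro divide_left_mono) auto
      then show ?thesis using C(2)[of x j] that by simp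
    qed
    then show ?thesis
      unfolding \<Phi>_def by (intro order_trans[OF norm_sum] sum_mono) (simp add: norm_mult norm_power mult_left_mono)
  qed
  \<comment> \<open>A partial fraction identity in \<open>x\<close>: a regular part
    \<open>\<Phi>\<close>, polynomial in \<open>z\<close>, plus \<open>poly p z\<close> times the
    logarithmic kernel. All three assertions arise by integrating it, above the cut, on the cut and
    at 0.\<close>
  have key: "poly r z * (f x / (of_real x - z)) = \<Phi> z x + poly p z * ((1 + z) / ((of_real x - z) * (1 + of_real x)))"
    if "x \<ge> 0" "of_real x \<noteq> z" for x z
  proof -
    let ?x = "complex_of_real x"
    have nn: "poly r ?x \<noteq> 0" "1 + ?x \<noteq> 0" "?x - z \<noteq> 0" using nz nz1 that by auto
    have "\<Phi> z x = (\<Sum>j<n. z^j * poly (q j) ?x) / (poly r ?x * (1 + ?x))"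
    proof -
      have "poly (r * [:1, 1:]) ?x = poly r ?x * (1 + ?x)" by (simp add: algebra_simps)
      then show ?thesis unfolding \<Phi>_def g_def by (simp only: sum_divide_distrib times_divide_eq_right)
    qed
    also have "(\<Sum>j<n. z^j * poly (q j) ?x) = (poly r z * (poly p ?x * (1 + ?x)) - poly r ?x * (poly p z * (1 + z))) / (?x - z)"
      using q2[of z ?x] nn by simp
    finally have "\<Phi> z x = (poly r z * (poly p ?x * (1 + ?x)) - poly r ?x * (poly p z * (1 + z))) / (?x - z) / (poly r ?x * (1 + ?x))" .
    then show ?thesis using nn unfolding f_def by (simp add: divide_simps) (simp add: algebra_simps)
  qed
  have 1: "poly r z * (LINT x:{0<..}|lborel. f x / (of_real x - z)) = poly P z - poly p z * (Ln z - \<i> * pi)" if z: "Im z > 0" for z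
  proof -
    let ?k = "\<lambda>x. (1 + z) / ((complex_of_real x - z) * (1 + complex_of_real x))"
    have "poly r z * (LINT x:{0<..}|lborel. f x / (of_real x - z)) = (LINT x:{0<..}|lborel. poly r z * (f x / (of_real x - z)))"
      by (simp only: set_integral_mult_right)
    also have "\<dots> = (LINT x:{0<..}|lborel. \<Phi> z x + poly p z * ?k x)"
    proof (rule set_lebesgue_integral_cong, simp, intro allI impI)
      fix x :: real assume "x \<in> {0<..}"
      then have "x \<ge> 0" "of_real x \<noteq> z" using z by auto
      from key[OF this] show "poly r z * (f x / (of_real x - z)) = \<Phi> z x + poly p z * ?k x" .
    qed
    also have "\<dots> = poly P z + poly p z * - (Ln z - \<i> * pi)"
      by (subst set_integral_add(2)) (simp_all only: PhiI set_integrable_mult_right integral_cauchy_kernel[OF z] set_integral_mult_right)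
    finally show ?thesis by (simp only: mult_minus_right diff_conv_add_uminus)
  qed
  have 2: "((\<lambda>e. LINT x:({0<..} - {w - e..w + e})|lborel. f x / of_real (x - w)) \<longlongrightarrow> pv f w) (at_right 0) \<and>
     poly r (of_real w) * pv f w = poly P (of_real w) - poly p (of_real w) * of_real (ln w)" if w: "w > 0" for w
  proof -
    let ?w = "complex_of_real w"
    let ?A = "\<lambda>e. {0<..} - {w - e..w + e}"
    let ?I = "\<lambda>e. LINT x:?A e|lborel. f x / complex_of_real (x - w)"
    have eq: "?I e = ((LINT x:?A e|lborel. \<Phi> ?w x) + poly p ?w * of_real (ln (1 + w + e) - ln (1 + w - e) - ln w)) / poly r ?w"
      if e: "0 < e" "e < w" for e
    proof -
      have S: "?A e \<in> sets lborel" by simp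
      note pk = principal_value_kernel[OF e]
      have ik: "set_integrable lborel (?A e) (\<lambda>x. complex_of_real ((1 + w) / ((x - w) * (1 + x))))"
        using pk(1) unfolding set_integrable_def scaleR_conv_of_real of_real_mult[symmetric]
        by (intro integrable_of_real) simp
      have iP: "set_integrable lborel (?A e) (\<Phi> ?w)"
        by (rule set_integrable_subset[OF PhiI(1)]) auto
      have "poly r ?w * ?I e = (LINT x:?A e|lborel. poly r ?w * (f x / complex_of_real (x - w)))"
        by (simp only: set_integral_mult_right)
      also have "\<dots> = (LINT x:?A e|lborel. \<Phi> ?w x + poly p ?w * complex_of_real ((1 + w) / ((x - w) * (1 + x))))"
      proof (rule set_lebesgue_integral_cong[OF S], intro allI impI)
        fix x assume "x \<in> ?A e"
        then have "x \<ge> 0" "of_real x \<noteq> ?w" using e by auto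
        from key[OF this] show "poly r ?w * (f x / complex_of_real (x - w)) = \<Phi> ?w x + poly p ?w * complex_of_real ((1 + w) / ((x - w) * (1 + x)))"
          by simp
      qed
      also have "\<dots> = (LINT x:?A e|lborel. \<Phi> ?w x) + poly p ?w * of_real (ln (1 + w + e) - ln (1 + w - e) - ln w)"
        by (subst set_integral_add(2)[OF iP set_integrable_mult_right[OF ik]])
           (simp only: set_integral_mult_right set_integral_complex_of_real pk(2))
      finally show ?thesis using nz[of w] w by (simp add: eq_divide_eq mult.commute)
    qed
    have "((\<lambda>e. ((LINT x:?A e|lborel. \<Phi> ?w x) + poly p ?w * of_real (ln (1 + w + e) - ln (1 + w - e) - ln w)) / poly r ?w)
        \<longlongrightarrow> (poly P ?w + poly p ?w * of_real (ln (1 + w + 0) - ln (1 + w - 0) - ln w)) / poly r ?w) (at_right 0)"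
      using set_integral_remove_small_interval[OF PhiI(1) Phib w, of ?w] w nz[of w]
      by (intro tendsto_intros) (auto simp: PhiI)
    moreover have "\<forall>\<^sub>F e in at_right 0. ((LINT x:?A e|lborel. \<Phi> ?w x) + poly p ?w * of_real (ln (1 + w + e) - ln (1 + w - e) - ln w)) / poly r ?w = ?I e"
      unfolding eventually_at_right_field
    proof (intro exI conjI allI impI)
      fix e assume "0 < e" "e < w"
      from eq[OF this] show "((LINT x:?A e|lborel. \<Phi> ?w x) + poly p ?w * of_real (ln (1 + w + e) - ln (1 + w - e) - ln w)) / poly r ?w = ?I e"
        by (rule sym)
    qed (rule w)
    ultimately have lim: "(?I \<longlongrightarrow> (poly P ?w + poly p ?w * of_real (ln (1 + w + 0) - ln (1 + w - 0) - ln w)) / poly r ?w) (at_right 0)"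
      by (rule Lim_transform_eventually)
    then have pv: "pv f w = (poly P ?w + poly p ?w * of_real (ln (1 + w + 0) - ln (1 + w - 0) - ln w)) / poly r ?w"
      unfolding pv_def by (intro tendsto_Lim) auto
    then show ?thesis using lim nz[of w] w by simp
  qed
  \<comment> \<open>At \<open>z = 0\<close> the factor \<open>poly p 0\<close> removes the kernel,
    whose integral would diverge there.\<close>
  have 3: "poly r 0 * (LINT x:{0<..}|lborel. f x / of_real x) = poly P 0" if "poly p 0 = 0"
  proof -
    have "poly r 0 * (LINT x:{0<..}|lborel. f x / of_real x) = (LINT x:{0<..}|lborel. poly r 0 * (f x / of_real x))"
      by (simp only: set_integral_mult_right)
    also have "\<dots> = (LINT x:{0<..}|lborel. \<Phi> 0 x)"
      using key[of _ 0] that by (intro set_lebesgue_integral_cong) auto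
    finally show ?thesis by (simp add: PhiI)
  qed
  show ?thesis using degP 1 2 3 by blast
qed

section \<open>Stieltjes inversion\<close>

lemma poisson_kernel_integral:
  fixes a b x e :: real
  assumes "a \<le> b" "e > 0"
  shows "integrable lborel (\<lambda>w. indicator {a..b} w * (e / ((x - w)^2 + e^2)))"
    and "(\<integral>w. indicator {a..b} w * (e / ((x - w)^2 + e^2)) \<partial>lborel) = arctan ((b - x) / e) - arctan ((a - x) / e)"
proof -
  have pos: "(x - w)^2 + e^2 > 0" for w using assms by (simp add: add_nonneg_pos)
  have d: "DERIV (\<lambda>w. arctan ((w - x) / e)) w :> e / ((x - w)^2 + e^2)" for w
  proof -
    have "DERIV (\<lambda>w. arctan ((w - x) / e)) w :> inverse (1 + ((w - x) / e)^2) * (1 / e)"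
      using assms by (auto intro!: derivative_eq_intros)
    also have "inverse (1 + ((w - x) / e)^2) * (1 / e) = e / ((x - w)^2 + e^2)"
    proof -
      have "1 + ((w - x) / e)^2 = ((x - w)^2 + e^2) / e^2"
        using assms by (simp add: power_divide power2_commute[of w x] add_divide_distrib)
      then show ?thesis using assms pos[of w] by (simp add: power2_eq_square)
    qed
    finally show ?thesis .
  qed
  have c: "isCont (\<lambda>w. e / ((x - w)^2 + e^2)) w" for w
    using pos[of w] by (intro continuous_intros) auto
  have "has_bochner_integral lborel (\<lambda>w. (e / ((x - w)^2 + e^2)) * indicator {a..b} w) (arctan ((b - x) / e) - arctan ((a - x) / e))"
    by (rule has_bochner_integral_FTC_Icc_real[OF assms(1) d c])
  then show "integrable lborel (\<lambda>w. indicator {a..b} w * (e / ((x - w)^2 + e^2)))"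
    "(\<integral>w. indicator {a..b} w * (e / ((x - w)^2 + e^2)) \<partial>lborel) = arctan ((b - x) / e) - arctan ((a - x) / e)"
    by (simp_all only: has_bochner_integral_iff mult.commute)
qed

text \<open>The sign vanishes at 0; this is the source of the half weights at the end points in the
  inversion formula.\<close>

lemma tendsto_arctan_divide:
  assumes "\<And>n. e n > 0" "e \<longlonglongrightarrow> 0"
  shows "(\<lambda>n. arctan (c / e n)) \<longlonglongrightarrow> sgn c * (pi / 2)"
proof -
  have "\<forall>\<^sub>F n in sequentially. e n \<in> {0<..} \<and> e n \<noteq> 0"
    by (intro always_eventually) (metis assms(1) greaterThan_iff less_irrefl)
  then have e: "filterlim e (at_right 0) sequentially"
    using assms(2) by (simp add: filterlim_at)
  consider "c > 0" | "c = 0" | "c < 0" by linarith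
  then show ?thesis
  proof cases
    case 1
    have "filterlim (\<lambda>n. c / e n) at_top sequentially"
      using e 1 by (intro filterlim_compose[where g = "\<lambda>x. c / x", OF _ e]) real_asymp
    from filterlim_compose[OF tendsto_arctan_at_top this] 1 show ?thesis by simp
  next
    case 3
    have "filterlim (\<lambda>n. c / e n) at_bot sequentially"
      using e 3 by (intro filterlim_compose[where g = "\<lambda>x. c / x", OF _ e]) real_asymp
    from filterlim_compose[OF tendsto_arctan_at_bot this] 3 show ?thesis by simp
  qed simp
qed

text \<open>\<open>F\<close> continues the Stieltjes transform of \<open>M\<close> from the upper
  half-plane across the positive axis. Agreement is demanded above the axis: below it the
  continuation and the transform in general differ, by the jump that encodes the density.\<close>

locale stieltjes_boundary =
  fixes M :: "real measure" and F :: "complex \<Rightarrow> complex" and U :: "complex set"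
  assumes fin: "finite_measure M" and sets_M [simp, measurable_cong]: "sets M = sets borel"
    and U: "open U" "\<And>x::real. x > 0 \<Longrightarrow> of_real x \<in> U"
    and F: "continuous_on U F"
    and transform: "\<And>z. z \<in> U \<Longrightarrow> Im z > 0 \<Longrightarrow> (\<integral>x. 1 / (complex_of_real x - z) \<partial>M) = F z"
begin

sublocale finite_measure M by (rule fin)

lemma space_M [simp]: "space M = UNIV"
  using sets_eq_imp_space_eq[OF sets_M] by simp

definition "\<rho> x = Im (F (complex_of_real x)) / pi"

lemma Im_transform:
  assumes "Complex w e \<in> U" "e > 0"
  shows "Im (F (Complex w e)) = (\<integral>x. e / ((x - w)^2 + e^2) \<partial>M)"
proof -
  have b: "cmod (1 / (complex_of_real x - Complex w e)) \<le> 1 / e" for x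
  proof -
    have "e \<le> cmod (complex_of_real x - Complex w e)"
      using abs_Im_le_cmod[of "complex_of_real x - Complex w e"] assms by simp
    then show ?thesis using assms by (auto simp: norm_divide intro!: divide_left_mono mult_pos_pos)
  qed
  have int: "integrable M (\<lambda>x. 1 / (complex_of_real x - Complex w e))"
    using b by (intro integrable_const_bound[where B = "1 / e"]) auto
  have "Im (F (Complex w e)) = (\<integral>x. Im (1 / (complex_of_real x - Complex w e)) \<partial>M)"
    using transform[OF assms(1)] assms(2) by (simp only: integral_Im[OF int]) simp
  also have "(\<lambda>x. Im (1 / (complex_of_real x - Complex w e))) = (\<lambda>x. e / ((x - w)^2 + e^2))"
    by (simp add: Im_divide power2_eq_square)
  finally show ?thesis .
qed

text \<open>By compactness a whole rectangle above \<open>[a, b]\<close> lies in \<open>U\<close>,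
  and \<open>F\<close> is bounded on it. The bound dominates the integrands when the height tends to
  zero.\<close>

lemma thick_interval:
  assumes "0 < a"
  obtains e0 B where "e0 > 0" "\<And>w e. a \<le> w \<Longrightarrow> w \<le> b \<Longrightarrow> 0 \<le> e \<Longrightarrow> e \<le> e0 \<Longrightarrow> Complex w e \<in> U"
    "\<And>w e. a \<le> w \<Longrightarrow> w \<le> b \<Longrightarrow> 0 \<le> e \<Longrightarrow> e \<le> e0 \<Longrightarrow> \<bar>Im (F (Complex w e))\<bar> \<le> B"
proof -
  have cp: "compact (complex_of_real ` {a..b})" by (intro compact_continuous_image continuous_intros) auto
  have sub: "complex_of_real ` {a..b} \<subseteq> U" using U(2) assms by auto
  obtain e0 where e0: "e0 > 0" "(\<Union>x\<in>complex_of_real ` {a..b}. cball x e0) \<subseteq> U"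
    using compact_subset_open_imp_cball_epsilon_subset[OF cp U(1) sub] by blast
  have in_U: "Complex w e \<in> U" if "a \<le> w" "w \<le> b" "0 \<le> e" "e \<le> e0" for w e
  proof -
    have "dist (complex_of_real w) (Complex w e) = e"
      using that by (simp add: dist_norm cmod_def)
    then show ?thesis using e0(2) that by (auto simp: subset_eq)
  qed
  have c2: "compact ((\<lambda>(w, e). Complex w e) ` ({a..b} \<times> {0..e0}))"
    by (intro compact_continuous_image compact_Times) (auto simp: case_prod_unfold Complex_eq intro!: continuous_intros)
  have "compact ((\<lambda>z. F z) ` ((\<lambda>(w, e). Complex w e) ` ({a..b} \<times> {0..e0})))"
    using in_U by (intro compact_continuous_image[OF _ c2] continuous_on_subset[OF F]) auto
  then have "bounded ((\<lambda>z. F z) ` ((\<lambda>(w, e). Complex w e) ` ({a..b} \<times> {0..e0})))"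
    by (rule compact_imp_bounded)
  then obtain B where B0: "\<forall>y\<in>(\<lambda>z. F z) ` ((\<lambda>(w, e). Complex w e) ` ({a..b} \<times> {0..e0})). cmod y \<le> B"
    unfolding bounded_iff by blast
  have B: "cmod (F (Complex w e)) \<le> B" if "a \<le> w" "w \<le> b" "0 \<le> e" "e \<le> e0" for w e
    using B0 that by force
  show ?thesis
    by (rule that[OF e0(1) in_U]) (use B abs_Im_le_cmod order_trans in \<open>blast+\<close>)
qed

lemma F_boundary:
  assumes "w > 0" "e \<longlonglongrightarrow> 0"
  shows "(\<lambda>n. F (Complex w (e n))) \<longlonglongrightarrow> F (complex_of_real w)"
proof -
  have "isCont F (complex_of_real w)"
    using F U assms(1) continuous_on_eq_continuous_at by blast
  moreover have "(\<lambda>n. Complex w (e n)) \<longlonglongrightarrow> complex_of_real w"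
    using tendsto_Complex[OF tendsto_const assms(2), of w] by (simp add: complex_of_real_def)
  ultimately show ?thesis by (rule isCont_tendsto_compose)
qed

lemma density_isCont: "x > 0 \<Longrightarrow> isCont \<rho> x"
proof -
  assume "x > 0"
  then have "isCont F (complex_of_real x)"
    using F U continuous_on_eq_continuous_at by blast
  then have "isCont (\<lambda>x. F (complex_of_real x)) x"
    by (rule isCont_o2[rotated]) (intro continuous_intros)
  then show ?thesis
    unfolding \<rho>_def by (intro continuous_intros) auto
qed

lemma density_continuous: "continuous_on {0<..} \<rho>"
  by (intro continuous_at_imp_continuous_on ballI density_isCont) simp

lemma density_nonneg:
  assumes "w > 0" shows "\<rho> w \<ge> 0"
proof -
  obtain e0 B where e0: "e0 > 0" "\<And>e. 0 \<le> e \<Longrightarrow> e \<le> e0 \<Longrightarrow> Complex w e \<in> U"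
    using thick_interval[OF assms, of w] by (metis order_refl)
  have "(\<lambda>n. Im (F (Complex w (e0 / real (Suc n))))) \<longlonglongrightarrow> Im (F (complex_of_real w))"
    by (intro tendsto_Im F_boundary assms) real_asymp
  moreover have "Im (F (Complex w (e0 / real (Suc n)))) \<ge> 0" for n
  proof -
    have "e0 / real (Suc n) \<le> e0 / 1" using e0 by (intro divide_left_mono) auto
    then have "Complex w (e0 / real (Suc n)) \<in> U" using e0 by (intro e0(2)) auto
    then show ?thesis
      using e0(1) by (subst Im_transform) (auto intro!: Bochner_Integration.integral_nonneg)
  qed
  ultimately have "Im (F (complex_of_real w)) \<ge> 0"
    by (intro tendsto_lowerbound[where F = sequentially]) auto
  then show ?thesis by (simp add: \<rho>_def)
qed

lemma density_integrable: "0 < a \<Longrightarrow> set_integrable lborel {a..b} \<rho>"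
  by (intro borel_integrable_atLeastAtMost' continuous_on_subset[OF density_continuous]) auto

text \<open>Stieltjes-Perron inversion. At height \<open>e\<close> the imaginary part of
  \<open>F\<close> is a Poisson integral of \<open>M\<close>; integrated over \<open>w\<close>, with
  the order of integration exchanged, it becomes a difference of arctangents, whose limit is
  \<open>pi\<close> inside the interval, \<open>pi / 2\<close> at its ends and 0 outside.\<close>

lemma inversion_half_endpoints:
  assumes ab: "0 < a" "a < b"
  shows "measure M {a<..<b} + measure M {a} / 2 + measure M {b} / 2 = (LINT w:{a..b}|lborel. \<rho> w)"
proof -
  obtain e0 B where e0: "e0 > 0" "\<And>w e. a \<le> w \<Longrightarrow> w \<le> b \<Longrightarrow> 0 \<le> e \<Longrightarrow> e \<le> e0 \<Longrightarrow> Complex w e \<in> U"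
    "\<And>w e. a \<le> w \<Longrightarrow> w \<le> b \<Longrightarrow> 0 \<le> e \<Longrightarrow> e \<le> e0 \<Longrightarrow> \<bar>Im (F (Complex w e))\<bar> \<le> B"
    using thick_interval[OF ab(1), of b] by metis
  define e where "e = (\<lambda>n. e0 / real (Suc n))"
  have e: "e n > 0" "e n \<le> e0" for n
  proof -
    have "e0 / real (Suc n) \<le> e0 / 1" using e0(1) by (intro divide_left_mono) auto
    then show "e n > 0" "e n \<le> e0" using e0(1) by (auto simp: e_def)
  qed
  have e_lim: "e \<longlonglongrightarrow> 0" unfolding e_def by real_asymp
  interpret P: pair_sigma_finite M lborel
    by (intro pair_sigma_finite.intro sigma_finite_lborel sigma_finite_measure_axioms)
  let ?k = "\<lambda>n x w. indicator {a..b} w * (e n / ((x - w)^2 + (e n)^2))"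
  \<comment> \<open>The kernel is bounded by \<open>1 / e n\<close> and lives on a set of finite
    product measure, so Fubini's theorem applies.\<close>
  have fub: "(\<integral>w. indicator {a..b} w * Im (F (Complex w (e n))) \<partial>lborel) = (\<integral>x. arctan ((b - x) / e n) - arctan ((a - x) / e n) \<partial>M)" for n
  proof -
    have kb: "e n / ((x - w)^2 + (e n)^2) \<le> 1 / e n" "0 \<le> e n / ((x - w)^2 + (e n)^2)" for x w
    proof -
      have "e n / ((x - w)^2 + (e n)^2) \<le> e n / (e n)^2"
        using e[of n] by (intro divide_left_mono) (auto intro!: mult_pos_pos add_nonneg_pos)
      then show "e n / ((x - w)^2 + (e n)^2) \<le> 1 / e n" using e[of n] by (simp add: power2_eq_square)
      show "0 \<le> e n / ((x - w)^2 + (e n)^2)" using e[of n] by simp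
    qed
    have "emeasure M UNIV < top" using emeasure_finite[of UNIV] top.not_eq_extremum[of "emeasure M UNIV"] by simp
    then have "emeasure (M \<Otimes>\<^sub>M lborel) (UNIV \<times> {a..b}) < \<infinity>"
      using ab by (subst lborel.emeasure_pair_measure_Times) (auto simp: ennreal_mult_less_top)
    then have "integrable (M \<Otimes>\<^sub>M lborel) (\<lambda>z. (1 / e n) * indicator (UNIV \<times> {a..b}) z)"
      by (intro integrable_mult_right integrable_real_indicator) auto
    then have int: "integrable (M \<Otimes>\<^sub>M lborel) (\<lambda>(x, w). ?k n x w)"
    proof (rule Bochner_Integration.integrable_bound)
      show "(\<lambda>(x, w). ?k n x w) \<in> borel_measurable (M \<Otimes>\<^sub>M lborel)" by measurable
      show "AE z in M \<Otimes>\<^sub>M lborel. norm (case z of (x, w) \<Rightarrow> ?k n x w) \<le> norm ((1 / e n) * indicator (UNIV \<times> {a..b}) z)"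
        using kb e[of n] by (intro AE_I2) (auto simp: indicator_def split: prod.split)
    qed
    have "(\<integral>w. indicator {a..b} w * Im (F (Complex w (e n))) \<partial>lborel) = (\<integral>w. (\<integral>x. ?k n x w \<partial>M) \<partial>lborel)"
    proof (rule Bochner_Integration.integral_cong[OF refl])
      fix w :: real
      show "indicator {a..b} w * Im (F (Complex w (e n))) = (\<integral>x. ?k n x w \<partial>M)"
        using Im_transform[of w "e n"] e0(2)[of w "e n"] e[of n] by (auto simp: indicator_def)
    qed
    also have "\<dots> = (\<integral>x. (\<integral>w. ?k n x w \<partial>lborel) \<partial>M)"
      by (rule P.Fubini_integral[OF int])
    finally show ?thesis using poisson_kernel_integral(2)[of a b "e n"] ab e[of n] by simp
  qed
  have lim1: "(\<lambda>n. \<integral>w. indicator {a..b} w * Im (F (Complex w (e n))) \<partial>lborel) \<longlonglongrightarrow> (\<integral>w. indicator {a..b} w * Im (F (complex_of_real w)) \<partial>lborel)"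
  proof (rule integral_dominated_convergence[where w = "\<lambda>w. B * indicator {a..b} w"])
    show "(\<lambda>w. indicator {a..b} w * Im (F (complex_of_real w))) \<in> borel_measurable lborel"
    proof -
      have "continuous_on {a..b} (\<lambda>w. pi * \<rho> w)"
        using ab by (intro continuous_on_mult_left continuous_on_subset[OF density_continuous]) auto
      then have "continuous_on {a..b} (\<lambda>w. Im (F (complex_of_real w)))" by (simp add: \<rho>_def)
      then show ?thesis
        using borel_measurable_continuous_on_indicator[of "{a..b}" "\<lambda>w. Im (F (complex_of_real w))"] by simp
    qed
    show "(\<lambda>w. indicator {a..b} w * Im (F (Complex w (e n)))) \<in> borel_measurable lborel" for n
    proof -
      have "continuous_on {a..b} (\<lambda>w. Im (F (Complex w (e n))))"
        using e0(2) e[of n] less_imp_le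
        by (intro continuous_on_Im continuous_on_compose2[OF F]) (auto simp: Complex_eq intro!: continuous_intros)
      then show ?thesis
        using borel_measurable_continuous_on_indicator[of "{a..b}" "\<lambda>w. Im (F (Complex w (e n)))"] by simp
    qed
    show "integrable lborel (\<lambda>w. B * indicator {a..b} w)"
      using emeasure_bounded_finite[of "{a..b}"] by (intro integrable_mult_right integrable_real_indicator) auto
    show "AE w in lborel. (\<lambda>n. indicator {a..b} w * Im (F (Complex w (e n)))) \<longlonglongrightarrow> indicator {a..b} w * Im (F (complex_of_real w))"
      using ab by (intro AE_I2) (auto simp: indicator_def intro!: tendsto_Im F_boundary e_lim)
    show "AE w in lborel. norm (indicator {a..b} w * Im (F (Complex w (e n)))) \<le> B * indicator {a..b} w" for n
      using e0(3) e[of n] by (intro AE_I2) (auto simp: indicator_def)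
  qed
  define \<eta> where "\<eta> = (\<lambda>x. pi * indicator {a<..<b} x + (pi / 2) * indicator {a} x + (pi / 2) * indicator {b} x :: real)"
  have lim2: "(\<lambda>n. \<integral>x. arctan ((b - x) / e n) - arctan ((a - x) / e n) \<partial>M) \<longlonglongrightarrow> (\<integral>x. \<eta> x \<partial>M)"
  proof (rule integral_dominated_convergence[where w = "\<lambda>_. pi"])
    show "AE x in M. (\<lambda>n. arctan ((b - x) / e n) - arctan ((a - x) / e n)) \<longlonglongrightarrow> \<eta> x"
    proof (rule AE_I2)
      fix x
      have "(\<lambda>n. arctan ((b - x) / e n) - arctan ((a - x) / e n)) \<longlonglongrightarrow> sgn (b - x) * (pi / 2) - sgn (a - x) * (pi / 2)"
        by (intro tendsto_diff tendsto_arctan_divide e e_lim)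
      also have "sgn (b - x) * (pi / 2) - sgn (a - x) * (pi / 2) = \<eta> x"
        using ab by (auto simp: \<eta>_def indicator_def sgn_if)
      finally show "(\<lambda>n. arctan ((b - x) / e n) - arctan ((a - x) / e n)) \<longlonglongrightarrow> \<eta> x" .
    qed
    show "AE x in M. norm (arctan ((b - x) / e n) - arctan ((a - x) / e n)) \<le> pi" for n
    proof (rule AE_I2)
      show "norm (arctan ((b - x) / e n) - arctan ((a - x) / e n)) \<le> pi" for x
        using arctan_bounded[of "(b - x) / e n"] arctan_bounded[of "(a - x) / e n"] by (simp add: abs_le_iff)
    qed
  qed (auto simp: \<eta>_def)
  have "(\<integral>w. indicator {a..b} w * Im (F (complex_of_real w)) \<partial>lborel) = (\<integral>x. \<eta> x \<partial>M)"
    using lim1 lim2 unfolding fub by (rule LIMSEQ_unique)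
  also have "\<dots> = pi * measure M {a<..<b} + (pi / 2) * measure M {a} + (pi / 2) * measure M {b}"
  proof -
    have i: "integrable M (indicator A :: real \<Rightarrow> real)" if "A \<in> sets borel" for A
      using that emeasure_finite[of A] by (intro integrable_real_indicator) (simp_all add: top.not_eq_extremum[symmetric])
    show ?thesis
      unfolding \<eta>_def
      by (simp add: i)
  qed
  finally have "(\<integral>w. indicator {a..b} w * Im (F (complex_of_real w)) \<partial>lborel) / pi = measure M {a<..<b} + measure M {a} / 2 + measure M {b} / 2"
    by (simp add: field_simps)
  then show ?thesis
    by (simp add: set_lebesgue_integral_def \<rho>_def)
qed

text \<open>Half of an atom at \<open>a\<close> is at most the integral of the density over
  \<open>[a, a + d]\<close>, which is of order \<open>d\<close>.\<close>

lemma no_atoms: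
  assumes "a > 0" shows "measure M {a} = 0"
proof -
  obtain e0 B where e0: "e0 > 0"
    and B0: "\<And>w e. a \<le> w \<Longrightarrow> w \<le> a + 1 \<Longrightarrow> 0 \<le> e \<Longrightarrow> e \<le> e0 \<Longrightarrow> \<bar>Im (F (Complex w e))\<bar> \<le> B"
    by (rule thick_interval[OF assms, of "a + 1"]) blast
  have B: "\<bar>Im (F (Complex w 0))\<bar> \<le> B" if "a \<le> w" "w \<le> a + 1" for w
    using B0[OF that] e0 by simp
  have bd: "measure M {a} \<le> 2 * (d * (B / pi))" if d: "0 < d" "d \<le> 1" for d
  proof -
    have "measure M {a} / 2 \<le> (LINT w:{a..a + d}|lborel. \<rho> w)"
      using inversion_half_endpoints[of a "a + d"] measure_nonneg[of M "{a<..<a + d}"] measure_nonneg[of M "{a + d}"] assms d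
      by linarith
    also have "\<dots> \<le> (LINT w:{a..a + d}|lborel. B / pi)"
    proof (rule set_integral_mono[OF density_integrable[OF assms]])
      show "set_integrable lborel {a..a + d} (\<lambda>w. B / pi)"
        unfolding set_integrable_def real_scaleR_def using emeasure_bounded_finite[of "{a..a + d}"]
        by (intro integrable_mult_left integrable_real_indicator) auto
      show "\<rho> w \<le> B / pi" if "w \<in> {a..a + d}" for w
        using B[of w] that d by (auto simp: \<rho>_def complex_of_real_def intro!: divide_right_mono)
    qed
    also have "\<dots> = d * (B / pi)" using d by (simp add: set_integral_const)
    finally show ?thesis by (simp add: mult_ac)
  qed
  have "((\<lambda>d. 2 * (d * (B / pi))) \<longlongrightarrow> 2 * (0 * (B / pi))) (at_right 0)" by (intro tendsto_intros)
  moreover have "\<forall>\<^sub>F d in at_right 0. measure M {a} \<le> 2 * (d * (B / pi))"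
    unfolding eventually_at_right_field using bd by (intro exI[of _ 1]) auto
  ultimately have "measure M {a} \<le> 0"
    using tendsto_lowerbound by fastforce
  then show ?thesis using measure_nonneg[of M "{a}"] by simp
qed

lemma measure_Ioc:
  assumes "0 < a" "a < b"
  shows "measure M {a<..b} = (LINT w:{a..b}|lborel. \<rho> w)"
proof -
  have "{a<..b} = {a<..<b} \<union> {b}" using assms by auto
  then have "measure M {a<..b} = measure M {a<..<b} + measure M {b}"
    using finite_measure_Union[of "{a<..<b}" "{b}"] by (simp del: Un_insert_right)
  then show ?thesis using inversion_half_endpoints[OF assms] no_atoms[of a] no_atoms[of b] assms by simp
qed

text \<open>Both measures are cut to the open half-line: elsewhere \<open>M\<close> may have atoms,
  for instance from bound states, and \<open>F\<close> gives no information.\<close>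

definition "N1 = density M (indicator {0<..})"
definition "N2 = density lborel (\<lambda>x. ennreal (indicator {0<..} x * \<rho> x))"

lemma density_measurable [measurable]: "(\<lambda>x. indicator {0<..} x * \<rho> x) \<in> borel_measurable borel"
  using borel_measurable_continuous_on_indicator[OF _ density_continuous] by simp

lemma emeasure_N1: "A \<in> sets borel \<Longrightarrow> emeasure N1 A = (\<integral>\<^sup>+x. indicator {0<..} x * indicator A x \<partial>M)"
  by (simp add: N1_def emeasure_density)

lemma emeasure_N2: "A \<in> sets borel \<Longrightarrow> emeasure N2 A = (\<integral>\<^sup>+x. ennreal (indicator {0<..} x * \<rho> x) * indicator A x \<partial>lborel)"
  by (simp add: N2_def emeasure_density)

lemma emeasure_Ioc_eq:
  assumes "0 < a" "a < b"
  shows "emeasure N1 {a<..b} = emeasure N2 {a<..b}"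
proof -
  have "emeasure N1 {a<..b} = (\<integral>\<^sup>+x. indicator {a<..b} x \<partial>M)"
    using assms by (auto simp: emeasure_N1 indicator_def intro!: nn_integral_cong)
  also have "\<dots> = emeasure M {a<..b}" by (intro nn_integral_indicator) simp
  also have "\<dots> = ennreal (LINT w:{a..b}|lborel. \<rho> w)"
    using measure_Ioc[OF assms] by (simp add: emeasure_eq_measure)
  also have "\<dots> = (\<integral>\<^sup>+w. ennreal (indicator {a..b} w *\<^sub>R \<rho> w) \<partial>lborel)"
    unfolding set_lebesgue_integral_def
    using density_integrable[OF assms(1), of b] density_nonneg assms
    by (intro nn_integral_eq_integral[symmetric]) (auto simp: set_integrable_def indicator_def)
  also have "\<dots> = (\<integral>\<^sup>+w. ennreal (indicator {0<..} w * \<rho> w) * indicator {a<..b} w \<partial>lborel)"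
  proof (rule nn_integral_cong_AE)
    show "AE w in lborel. ennreal (indicator {a..b} w *\<^sub>R \<rho> w) = ennreal (indicator {0<..} w * \<rho> w) * indicator {a<..b} w"
      using AE_lborel_singleton[of a] by eventually_elim (use assms in \<open>auto simp: indicator_def\<close>)
  qed
  also have "\<dots> = emeasure N2 {a<..b}" by (simp add: emeasure_N2)
  finally show ?thesis .
qed

lemma emeasure_neg:
  assumes "b \<le> 0" shows "emeasure N1 {a<..b} = 0" "emeasure N2 {a<..b} = 0"
proof -
  have "emeasure N1 {a<..b} = (\<integral>\<^sup>+x. 0 \<partial>M)"
    using assms by (subst emeasure_N1) (auto simp: indicator_def intro!: nn_integral_cong simp del: nn_integral_const)
  moreover have "emeasure N2 {a<..b} = (\<integral>\<^sup>+(x::real). 0 \<partial>lborel)"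
    using assms by (subst emeasure_N2) (auto simp: indicator_def intro!: nn_integral_cong simp del: nn_integral_const)
  ultimately show "emeasure N1 {a<..b} = 0" "emeasure N2 {a<..b} = 0" by simp_all
qed

lemma emeasure_pos_part:
  assumes "A \<in> sets borel"
  shows "emeasure N1 A = emeasure N1 (A \<inter> {0<..})" "emeasure N2 A = emeasure N2 (A \<inter> {0<..})"
  using assms by (auto simp: emeasure_N1 emeasure_N2 indicator_def intro!: nn_integral_cong)

proposition inversion: "N1 = N2"
proof (rule measure_eqI_generator_eq)
  let ?E = "range (\<lambda>(a, b). {a<..b::real})"
  show "Int_stable ?E"
  proof (rule Int_stableI)
    fix A B assume "A \<in> ?E" "B \<in> ?E"
    then obtain a b c d where "A = {a<..b}" "B = {c<..d}" by auto
    then have "A \<inter> B = (\<lambda>(a, b). {a<..b}) (max a c, min b d)" by auto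
    then show "A \<inter> B \<in> ?E" by blast
  qed
  show "?E \<subseteq> Pow UNIV" by simp
  show "sets N1 = sigma_sets UNIV ?E" "sets N2 = sigma_sets UNIV ?E"
    by (simp_all add: N1_def N2_def borel_sigma_sets_Ioc)
  show "range (\<lambda>n::nat. {- real n<..real n}) \<subseteq> ?E" by auto
  show "(\<Union>n::nat. {- real n<..real n}) = UNIV"
  proof -
    have "\<exists>n::nat. x \<in> {- real n<..real n}" for x
    proof -
      obtain n :: nat where "\<bar>x\<bar> < real n" using reals_Archimedean2 by blast
      then show ?thesis by (intro exI[of _ n]) auto
    qed
    then show ?thesis by auto
  qed
  show "emeasure N1 {- real n<..real n} \<noteq> \<infinity>" for n
  proof -
    have "emeasure N1 {- real n<..real n} \<le> (\<integral>\<^sup>+x. 1 \<partial>M)"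
      by (auto simp: emeasure_N1 indicator_def simp del: nn_integral_const intro!: nn_integral_mono)
    then show ?thesis using emeasure_finite[of UNIV] by (auto simp: top_unique)
  qed
  fix X assume "X \<in> ?E"
  then obtain a b where X: "X = {a<..b}" by auto
  show "emeasure N1 X = emeasure N2 X"
  proof (cases "b \<le> 0 \<or> a \<ge> b")
    case True
    then show ?thesis using emeasure_neg[of b a] X by auto
  next
    case False
    then have b: "b > 0" "a < b" by auto
    show ?thesis
    proof (cases "a > 0")
      case True
      then show ?thesis using emeasure_Ioc_eq b X by simp
    next
      case False
      \<comment> \<open>Intervals that reach 0 are exhausted from inside. With \<open>n + 2\<close>
        in the denominator the left end is strictly below \<open>b\<close> already for
        \<open>n = 0\<close>, as \<open>emeasure_Ioc_eq\<close> demands.\<close>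
      define I where "I = (\<lambda>n::nat. {b / real (n + 2)<..b})"
      have I: "X \<inter> {0<..} = (\<Union>n. I n)"
      proof -
        have "\<exists>n::nat. b / real (n + 2) < x" if "x > 0" for x
        proof -
          obtain n :: nat where "b / x < real n" using reals_Archimedean2 by blast
          then show ?thesis using that b by (intro exI[of _ n]) (simp add: field_simps)
        qed
        moreover have "0 < b / real (n + 2)" for n using b by simp
        moreover have "a < x \<and> 0 < x" if "b / real (n + 2) < x" for x n
          using less_trans[OF \<open>0 < b / real (n + 2)\<close> that] False by simp
        ultimately show ?thesis
          using False b unfolding X I_def by (simp add: set_eq_iff) blast
      qed
      have inc: "incseq I"
      proof (rule monoI)
        fix m n :: nat assume "m \<le> n"
        then have "b / real (n + 2) \<le> b / real (m + 2)"
          using b by (intro divide_left_mono) auto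
        then show "I m \<subseteq> I n" unfolding I_def by force
      qed
      have eq: "emeasure N1 (I n) = emeasure N2 (I n)" for n
      proof -
        have "b / real (n + 2) < b / 1" using b by (intro divide_strict_left_mono) auto
        then show ?thesis unfolding I_def using b by (intro emeasure_Ioc_eq) auto
      qed
      have "emeasure N1 (\<Union>n. I n) = (SUP n. emeasure N1 (I n))" "emeasure N2 (\<Union>n. I n) = (SUP n. emeasure N2 (I n))"
        by (intro SUP_emeasure_incseq[symmetric] inc; auto simp: N1_def N2_def I_def)+
      then show ?thesis
        using emeasure_pos_part[of X] X eq unfolding I by simp
    qed
  qed
qed

end

section \<open>Oscillatory integrals of logarithmically singular densities\<close>

lemma integrable_indicator_Ioo: "integrable lborel (indicator {a<..<b} :: real \<Rightarrow> real)"
  using emeasure_bounded_finite[of "{a<..<b}"] by (intro integrable_real_indicator) auto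

lemma set_integrable_const_Ioo: "set_integrable lborel {a<..<b} (\<lambda>x::real. c::real)"
  unfolding set_integrable_def real_scaleR_def
  by (intro integrable_mult_left integrable_indicator_Ioo)

lemma lborel_inverse_square_tail:
  fixes a :: real
  assumes "a > 0"
  shows "set_integrable lborel {a<..} (\<lambda>x. 1 / x^2)" "(LINT x:{a<..}|lborel. 1 / x^2) = 1 / a"
proof -
  let ?F = "\<lambda>x::real. - 1 / x"
  have 1: "((?F \<circ> real_of_ereal) \<longlongrightarrow> ?F a) (at_right (ereal a))"
    unfolding ereal_tendsto_simps using assms by (intro tendsto_intros) auto
  have 2: "((?F \<circ> real_of_ereal) \<longlongrightarrow> 0) (at_left \<infinity>)"
    unfolding ereal_tendsto_simps by real_asymp
  have *: "set_integrable lborel (einterval a \<infinity>) (\<lambda>x. 1 / x^2)" "(LBINT x=a..\<infinity>. 1 / x^2) = 0 - ?F a"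
    by (rule interval_integral_FTC_nonneg[where F = ?F];
        use assms 1 2 in \<open>auto intro!: derivative_eq_intros continuous_intros simp: power2_eq_square\<close>)+
  show "set_integrable lborel {a<..} (\<lambda>x. 1 / x^2)" "(LINT x:{a<..}|lborel. 1 / x^2) = 1 / a"
    using * by (simp_all add: interval_integral_to_infinity_eq)
qed

text \<open>The primitives are \<open>- 1 / ln x\<close> and \<open>1 / (2 * (ln x)^2)\<close>. The
  former produces the main term of the theorem; the latter shows that one more logarithm in the
  density gains one more in the integral.\<close>

lemma lborel_log_singularity:
  fixes h :: real
  assumes "0 < h" "h < 1"
  shows "set_integrable lborel {0<..<h} (\<lambda>x. 1 / (x * (ln x)^2))"
    "(LINT x:{0<..<h}|lborel. 1 / (x * (ln x)^2)) = 1 / \<bar>ln h\<bar>"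
    "set_integrable lborel {0<..<h} (\<lambda>x. 1 / (x * \<bar>ln x\<bar>^3))"
    "(LINT x:{0<..<h}|lborel. 1 / (x * \<bar>ln x\<bar>^3)) = 1 / (2 * (ln h)^2)"
proof -
  have lneg: "ln x < 0" if "0 < x" "x < h" for x using assms that by simp
  have lh: "ln h < 0" using assms by simp
  have z: "(0::ereal) = ereal 0" by simp
  have ei: "einterval 0 (ereal h) = {0<..<h}" by (auto simp: einterval_def z)
  let ?F = "\<lambda>x::real. - 1 / ln x" and ?G = "\<lambda>x::real. 1 / (2 * (ln x)^2)"
  have 1: "((?F \<circ> real_of_ereal) \<longlongrightarrow> 0) (at_right 0)" "((?G \<circ> real_of_ereal) \<longlongrightarrow> 0) (at_right 0)"
    unfolding z ereal_tendsto_simps by real_asymp+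
  have 2: "((?F \<circ> real_of_ereal) \<longlongrightarrow> ?F h) (at_left (ereal h))" "((?G \<circ> real_of_ereal) \<longlongrightarrow> ?G h) (at_left (ereal h))"
    unfolding ereal_tendsto_simps using assms lh by (intro tendsto_intros; simp)+
  have D: "DERIV ?F x :> 1 / (x * (ln x)^2)" "DERIV ?G x :> 1 / (x * \<bar>ln x\<bar>^3)" if "0 < x" "x < h" for x
    using that lneg[OF that]
    by (auto intro!: derivative_eq_intros simp: field_simps power2_eq_square power3_eq_cube)
  have c: "isCont (\<lambda>x. 1 / (x * (ln x)^2)) x" "isCont (\<lambda>x. 1 / (x * \<bar>ln x\<bar>^3)) x" if "0 < x" "x < h" for x
    using that lneg[OF that] by (auto intro!: continuous_intros)
  have F: "set_integrable lborel (einterval 0 h) (\<lambda>x. 1 / (x * (ln x)^2))" "(LBINT x=0..h. 1 / (x * (ln x)^2)) = ?F h - 0"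
    by (rule interval_integral_FTC_nonneg[where F = ?F]; use assms 1 2 D c in \<open>auto simp: z\<close>)+
  have p: "AE x in lborel. 0 < ereal x \<longrightarrow> ereal x < ereal h \<longrightarrow> 0 \<le> 1 / (x * \<bar>ln x\<bar>^3)"
    by (intro AE_I2) (simp add: z)
  have G: "set_integrable lborel (einterval 0 h) (\<lambda>x. 1 / (x * \<bar>ln x\<bar>^3))" "(LBINT x=0..h. 1 / (x * \<bar>ln x\<bar>^3)) = ?G h - 0"
    by (rule interval_integral_FTC_nonneg[where F = ?G, OF _ _ _ p 1(2) 2(2)]; use assms D c in \<open>simp add: z\<close>)+
  show "set_integrable lborel {0<..<h} (\<lambda>x. 1 / (x * (ln x)^2))"
    "(LINT x:{0<..<h}|lborel. 1 / (x * (ln x)^2)) = 1 / \<bar>ln h\<bar>"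
    "set_integrable lborel {0<..<h} (\<lambda>x. 1 / (x * \<bar>ln x\<bar>^3))"
    "(LINT x:{0<..<h}|lborel. 1 / (x * \<bar>ln x\<bar>^3)) = 1 / (2 * (ln h)^2)"
    using F G lh assms by (simp_all add: ei interval_lebesgue_integral_le_eq)
qed

text \<open>The logarithm is bounded by its argument, used at the fourth root of \<open>t\<close>.
  This makes powers of \<open>1 / t\<close> negligible against the logarithmic error.\<close>

lemma ln_sq_le_sqrt:
  assumes "t \<ge> (1::real)"
  shows "(ln t)^2 \<le> 16 * sqrt t"
proof -
  have "ln (sqrt (sqrt t)) \<le> sqrt (sqrt t)"
    using ln_le_minus_one[of "sqrt (sqrt t)"] assms by simp
  then have "ln t \<le> 4 * sqrt (sqrt t)"
    using assms by (simp add: ln_sqrt)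
  then have "(ln t)^2 \<le> (4 * sqrt (sqrt t))^2"
    using assms by (intro power_mono) auto
  then show ?thesis using assms by (simp add: power_mult_distrib)
qed

text \<open>\<open>lip_near\<close> has the size of the derivative of
  \<open>1 / (x * (ln x)^2)\<close>. The regimes overlap so that no pair straddles them: for a shift
  of at most \<open>\<delta> / 2\<close>, a point up to \<open>\<delta> / 2\<close> and its
  translate both lie in the near regime, and beyond \<open>\<delta> / 2\<close> the bound
  \<open>lip_far\<close> applies.\<close>

locale log_singular_density =
  fixes \<rho> :: "real \<Rightarrow> real" and \<kappa> \<delta> C :: real
  assumes meas [measurable]: "\<rho> \<in> borel_measurable borel"
    and int: "set_integrable lborel {0<..} \<rho>"
    and nonneg: "\<And>x. x > 0 \<Longrightarrow> \<rho> x \<ge> 0"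
    and \<delta>: "0 < \<delta>" "\<delta> < 1" and C: "C \<ge> 0"
    and near: "\<And>x. 0 < x \<Longrightarrow> x \<le> \<delta> \<Longrightarrow> \<bar>\<rho> x - \<kappa> / (x * (ln x)^2)\<bar> \<le> C / (x * \<bar>ln x\<bar>^3)"
    and lip_near: "\<And>s t. 0 < s \<Longrightarrow> s \<le> t \<Longrightarrow> t \<le> \<delta> \<Longrightarrow> \<bar>\<rho> s - \<rho> t\<bar> \<le> C * (t - s) / (s^2 * (ln s)^2)"
    and lip_far: "\<And>s t. \<delta> / 2 \<le> s \<Longrightarrow> s \<le> t \<Longrightarrow> \<bar>\<rho> s - \<rho> t\<bar> \<le> C * (t - s)"
    and tail: "\<And>T. T > 0 \<Longrightarrow> (LINT x:{T<..}|lborel. \<rho> x) \<le> C / T^2"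
begin

definition "C2 = \<bar>\<kappa>\<bar> + C / \<bar>ln \<delta>\<bar>"

lemma C2_nonneg: "C2 \<ge> 0"
  using C by (simp add: C2_def)

lemma abs_ln_mono: "0 < x \<Longrightarrow> x \<le> y \<Longrightarrow> y < 1 \<Longrightarrow> \<bar>ln y\<bar> \<le> \<bar>ln x\<bar>" for x y :: real
  using ln_mono[of x y] ln_less_zero[of y] by auto

lemma density_upper:
  assumes "0 < x" "x \<le> \<delta>"
  shows "\<rho> x \<le> C2 / (x * (ln x)^2)"
proof -
  have l: "0 < \<bar>ln \<delta>\<bar>" "\<bar>ln \<delta>\<bar> \<le> \<bar>ln x\<bar>"
    using assms \<delta> abs_ln_mono[of x \<delta>] by auto
  then have lx: "0 < \<bar>ln x\<bar>" by linarith
  have "\<rho> x \<le> \<bar>\<kappa>\<bar> / (x * (ln x)^2) + C / (x * \<bar>ln x\<bar>^3)"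
    using near[OF assms] divide_right_mono[OF abs_ge_self[of \<kappa>], of "x * (ln x)^2"] assms by (simp add: abs_le_iff)
  also have "C / (x * \<bar>ln x\<bar>^3) \<le> C / (x * (\<bar>ln \<delta>\<bar> * (ln x)^2))"
  proof (intro divide_left_mono mult_left_mono)
    have e: "\<bar>ln x\<bar>^3 = \<bar>ln x\<bar> * (ln x)^2"
      by (simp add: power3_eq_cube power2_eq_square)
    show "\<bar>ln \<delta>\<bar> * (ln x)^2 \<le> \<bar>ln x\<bar>^3"
      unfolding e using l by (intro mult_right_mono) auto
    show "0 < x * \<bar>ln x\<bar>^3 * (x * (\<bar>ln \<delta>\<bar> * (ln x)^2))"
      using assms l lx by (intro mult_pos_pos) auto
  qed (use assms C in auto)
  finally show ?thesis
    using l by (simp add: C2_def add_divide_distrib divide_divide_eq_left mult_ac)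
qed

section \<open>Estimates at one fixed time, with half period \<open>h\<close>\<close>

context
  fixes t h L :: real
  assumes t: "t \<ge> 10" and h_def: "h = pi / t" and L_def: "L = \<bar>ln h\<bar>"
    and small: "sqrt h \<le> \<delta> / 2"
begin

lemma h_pos: "h > 0" using t by (simp add: h_def)

lemma sqrt_h: "sqrt h < 1 / 2" "h < 1 / 4" "sqrt h > 0" "h \<le> sqrt h"
proof -
  show 1: "sqrt h < 1 / 2" "sqrt h > 0" using small \<delta> h_pos by auto
  have h: "h = sqrt h * sqrt h" using h_pos by simp
  have "sqrt h * sqrt h \<le> sqrt h * 1" by (intro mult_left_mono; use 1 in linarith)
  then show "h \<le> sqrt h" by (metis h mult.right_neutral)
  have "sqrt h * sqrt h < (1/2) * (1/2)" using 1 by (intro mult_strict_mono) auto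
  then show "h < 1 / 4" using h by simp
qed

lemma ln_h: "ln h < 0" "L > 0" "ln (sqrt h) = - L / 2"
  using sqrt_h h_pos by (auto simp: L_def ln_sqrt)

text \<open>\<open>ln (sqrt h)\<close> is \<open>- L / 2\<close>, so up to \<open>sqrt h\<close> the
  squared logarithm may be replaced by \<open>L^2\<close> at the cost of a factor 4. This makes
  \<open>sqrt h\<close> a convenient splitting point.\<close>

lemma ln_sq_ge:
  assumes "0 < x" "x \<le> sqrt h"
  shows "L^2 / 4 \<le> (ln x)^2" "(ln x)^2 > 0"
proof -
  have "L / 2 \<le> \<bar>ln x\<bar>"
    using abs_ln_mono[of x "sqrt h"] assms sqrt_h ln_h by simp
  then have "(L / 2)^2 \<le> \<bar>ln x\<bar>^2" using ln_h by (intro power_mono) auto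
  then show "L^2 / 4 \<le> (ln x)^2" by (simp add: power_divide)
  moreover have "L^2 > 0" using ln_h by simp
  ultimately show "(ln x)^2 > 0" by linarith
qed

text \<open>On \<open>(0, h)\<close> the phase deviates from 1 by at most \<open>t * x\<close>,
  which cancels the factor \<open>1 / x\<close> of the density; over the length
  \<open>h = pi / t\<close> this costs \<open>pi * C2 / L^2\<close>. Without the phase, the model
  density integrates to \<open>\<kappa> / L\<close> exactly.\<close>

lemma near_part:
  "cmod ((LINT x:{0<..<h}|lborel. exp (- \<i> * complex_of_real (t * x)) * complex_of_real (\<rho> x)) - complex_of_real (\<kappa> / L))
    \<le> (pi * C2 + C) / L^2"
proof -
  have hd: "h < \<delta>" "h < 1" using small sqrt_h \<delta> by auto
  have i1: "set_integrable lborel {0<..<h} \<rho>"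
    by (rule set_integrable_subset[OF int]) auto
  have i2: "set_integrable lborel {0<..<h} (\<lambda>x. complex_of_real (\<rho> x))"
    using i1 unfolding set_integrable_def by (simp add: scaleR_conv_of_real flip: of_real_mult)
  have i3: "set_integrable lborel {0<..<h} (\<lambda>x. exp (- \<i> * complex_of_real (t * x)) * complex_of_real (\<rho> x))"
  proof (rule set_integrable_bound[OF i2])
    show "set_borel_measurable lborel {0<..<h} (\<lambda>x. exp (- \<i> * complex_of_real (t * x)) * complex_of_real (\<rho> x))"
      unfolding set_borel_measurable_def by measurable
  qed (auto simp: norm_mult)
  note ls = lborel_log_singularity[OF h_pos hd(2)]
  have A: "cmod ((LINT x:{0<..<h}|lborel. exp (- \<i> * complex_of_real (t * x)) * complex_of_real (\<rho> x)) - complex_of_real (LINT x:{0<..<h}|lborel. \<rho> x)) \<le> pi * C2 / L^2"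
  proof -
    have "(LINT x:{0<..<h}|lborel. exp (- \<i> * complex_of_real (t * x)) * complex_of_real (\<rho> x)) - complex_of_real (LINT x:{0<..<h}|lborel. \<rho> x)
      = (LINT x:{0<..<h}|lborel. exp (- \<i> * complex_of_real (t * x)) * complex_of_real (\<rho> x) - complex_of_real (\<rho> x))"
      by (subst set_integral_diff(2)[OF i3 i2]) (simp add: set_integral_complex_of_real)
    also have "cmod \<dots> \<le> (LINT x:{0<..<h}|lborel. cmod (exp (- \<i> * complex_of_real (t * x)) * complex_of_real (\<rho> x) - complex_of_real (\<rho> x)))"
      by (intro set_integral_norm_bound set_integral_diff i2 i3)
    also have "\<dots> \<le> (LINT x:{0<..<h}|lborel. t * C2 / L^2)"
    proof (rule set_integral_mono)
      show "set_integrable lborel {0<..<h} (\<lambda>x. cmod (exp (- \<i> * complex_of_real (t * x)) * complex_of_real (\<rho> x) - complex_of_real (\<rho> x)))"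
        by (intro set_integrable_norm set_integral_diff i2 i3)
      show "set_integrable lborel {0<..<h} (\<lambda>x. t * C2 / L^2)"
        by (rule set_integrable_const_Ioo)
      fix x assume x: "x \<in> {0<..<h}"
      have "cmod (exp (- \<i> * complex_of_real (t * x)) * complex_of_real (\<rho> x) - complex_of_real (\<rho> x)) =
          cmod (exp (\<i> * complex_of_real (- (t * x))) - 1) * \<rho> x"
      proof -
        have "exp (- \<i> * complex_of_real (t * x)) * complex_of_real (\<rho> x) - complex_of_real (\<rho> x)
          = (exp (\<i> * complex_of_real (- (t * x))) - 1) * complex_of_real (\<rho> x)"
          by (simp add: algebra_simps)
        then show ?thesis using x nonneg[of x] by (simp only: norm_mult) simp
      qed
      also have "cmod (exp (\<i> * complex_of_real (- (t * x))) - 1) \<le> t * x"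
        using dist_exp_i_1[of "- (t * x)"] x t abs_sin_x_le_abs_x[of "- (t*x) / 2"] by (simp add: norm_minus_commute abs_mult)
      also have "\<rho> x \<le> C2 / (x * (ln x)^2)" using x hd by (intro density_upper) auto
      also have "t * x * (C2 / (x * (ln x)^2)) = t * C2 / (ln x)^2" using x by simp
      also have "\<dots> \<le> t * C2 / L^2"
      proof (rule divide_left_mono)
        have "L \<le> \<bar>ln x\<bar>" using x abs_ln_mono[of x h] hd by (simp add: L_def)
        then have "L^2 \<le> \<bar>ln x\<bar>^2" using ln_h by (intro power_mono) auto
        then show "L^2 \<le> (ln x)^2" by simp
        moreover have "L^2 > 0" using ln_h by simp
        ultimately show "0 < (ln x)^2 * L^2" by (intro mult_pos_pos) linarith+
      qed (use t C2_nonneg in auto)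
      finally show "cmod (exp (- \<i> * complex_of_real (t * x)) * complex_of_real (\<rho> x) - complex_of_real (\<rho> x)) \<le> t * C2 / L^2"
        using x t nonneg[of x] by (simp add: mult_right_mono mult_left_mono)
    qed
    also have "\<dots> = pi * C2 / L^2"
      using h_pos t by (simp add: set_integral_const h_def)
    finally show ?thesis .
  qed
  have B: "\<bar>(LINT x:{0<..<h}|lborel. \<rho> x) - \<kappa> / L\<bar> \<le> C / L^2"
  proof -
    have j: "set_integrable lborel {0<..<h} (\<lambda>x. \<kappa> * (1 / (x * (ln x)^2)))"
      by (intro set_integrable_mult_right ls)
    have "(LINT x:{0<..<h}|lborel. \<rho> x) - \<kappa> / L = (LINT x:{0<..<h}|lborel. \<rho> x - \<kappa> * (1 / (x * (ln x)^2)))"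
      by (subst set_integral_diff(2)[OF i1 j], subst set_integral_mult_right, subst ls(2)) (simp add: L_def)
    also have "\<bar>\<dots>\<bar> \<le> (LINT x:{0<..<h}|lborel. \<bar>\<rho> x - \<kappa> * (1 / (x * (ln x)^2))\<bar>)"
      using set_integral_norm_bound[OF set_integral_diff(1)[OF i1 j]] by simp
    also have "\<dots> \<le> (LINT x:{0<..<h}|lborel. C * (1 / (x * \<bar>ln x\<bar>^3)))"
    proof (intro set_integral_mono set_integrable_abs set_integral_diff(1)[OF i1 j] set_integrable_mult_right ls)
      fix x assume "x \<in> {0<..<h}"
      then have x: "0 < x" "x \<le> \<delta>" using hd by auto
      show "\<bar>\<rho> x - \<kappa> * (1 / (x * (ln x)^2))\<bar> \<le> C * (1 / (x * \<bar>ln x\<bar>^3))"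
        using near[OF x] by (simp only: times_divide_eq_right mult_1_right)
    qed
    also have "\<dots> = C * (1 / (2 * L^2))"
      by (subst set_integral_mult_right, subst ls(4)) (simp add: L_def)
    also have "\<dots> \<le> C / L^2"
      using C ln_h by (simp add: field_simps)
    finally show ?thesis .
  qed
  have "cmod (complex_of_real (LINT x:{0<..<h}|lborel. \<rho> x) - complex_of_real (\<kappa> / L)) \<le> C / L^2"
    using B by (simp flip: of_real_diff add: norm_of_real del: of_real_divide)
  from norm_triangle_mono[OF A this] show ?thesis
    by (simp add: add_divide_distrib)
qed

text \<open>Cut-off between the Lipschitz bound and the tail. Up to constants the former costs
  \<open>h * B = sqrt h\<close> and the latter \<open>1 / B^2 = h\<close>, both negligible against
  \<open>1 / L^2\<close>.\<close>

definition "B = 1 / sqrt h"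

lemma B_pos: "B > 0" using sqrt_h by (simp add: B_def)

text \<open>The bound after averaging over the shift by half a period \<open>h = pi / t\<close>.\<close>
definition "G x = (4 * C * h / L^2) * (indicator {h/2<..} x *\<^sub>R (1 / x^2))
   + (C * h / (ln \<delta>)^2) * (indicator {sqrt h / 2<..} x *\<^sub>R (1 / x^2))
   + (C * h) * indicator {0<..<2 * B} x
   + (indicator {B<..} x *\<^sub>R \<rho> x + indicator {B<..} x *\<^sub>R \<rho> (h + x))
   + (4 * C2 / (L^2 * h)) * indicator {-h<..<h} x" for x :: real

text \<open>For \<open>x \<ge> h\<close> the two terms combine to a difference of densities; on
  \<open>[0, h)\<close> the shifted one stands alone. The summands of \<open>G\<close> serve, in
  their order, \<open>[h, sqrt h]\<close>, \<open>(sqrt h, \<delta> / 2]\<close>,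
  \<open>(\<delta> / 2, B]\<close>, the points beyond \<open>B\<close>, and \<open>[0, h)\<close>.
  The first three and the last have indicators of larger sets, which keeps boundary points out of
  the argument.\<close>

lemma shifted_difference_bound:
  "cmod (indicator {h..} x *\<^sub>R (exp (- \<i> * complex_of_real (t * x)) * complex_of_real (\<rho> x))
     - indicator {0..} x *\<^sub>R (exp (- \<i> * complex_of_real (t * x)) * complex_of_real (\<rho> (h + x)))) \<le> G x"
proof -
  have Gn: "0 \<le> (4 * C * h / L^2) * (indicator {h/2<..} x *\<^sub>R (1 / x^2))"
    "0 \<le> (C * h / (ln \<delta>)^2) * (indicator {sqrt h / 2<..} x *\<^sub>R (1 / x^2))"
    "0 \<le> (C * h) * indicator {0<..<2 * B} x"
    "0 \<le> (indicator {B<..} x *\<^sub>R \<rho> x + indicator {B<..} x *\<^sub>R \<rho> (h + x))"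
    "0 \<le> (4 * C2 / (L^2 * h)) * indicator {-h<..<h} x"
    using C h_pos C2_nonneg B_pos nonneg[of x] nonneg[of "h + x"]
    by (auto simp: indicator_def intro!: mult_nonneg_nonneg)
  consider "x < 0" | "0 \<le> x" "x < h" | "h \<le> x" by linarith
  then show ?thesis
  proof cases
    case 1
    then show ?thesis using Gn h_pos by (simp add: G_def)
  next
    case 2
    have le: "h + x \<le> sqrt h"
    proof -
      have "h = sqrt h * sqrt h" using h_pos by simp
      also have "\<dots> \<le> sqrt h * (1/2)" using sqrt_h by (intro mult_left_mono) auto
      finally show ?thesis using 2 by simp
    qed
    have "\<rho> (h + x) \<le> C2 / ((h + x) * (ln (h + x))^2)"
      using le small \<delta> 2 h_pos by (intro density_upper) auto
    also have "\<dots> \<le> C2 / (h * (L^2 / 4))"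
      using ln_sq_ge[of "h + x"] le 2 h_pos C2_nonneg ln_h
      by (intro divide_left_mono mult_mono mult_pos_pos) auto
    also have "\<dots> = 4 * C2 / (L^2 * h)" by (simp add: mult.commute)
    finally have "\<rho> (h + x) \<le> 4 * C2 / (L^2 * h)" .
    moreover have "\<rho> (h + x) \<ge> 0" using 2 h_pos by (intro nonneg) simp
    ultimately show ?thesis using Gn 2 by (simp add: G_def norm_mult indicator_def)
  next
    case 3
    have xp: "x > 0" using 3 h_pos by simp
    have "cmod (indicator {h..} x *\<^sub>R (exp (- \<i> * complex_of_real (t * x)) * complex_of_real (\<rho> x))
     - indicator {0..} x *\<^sub>R (exp (- \<i> * complex_of_real (t * x)) * complex_of_real (\<rho> (h + x))))
     = cmod (exp (- \<i> * complex_of_real (t * x)) * complex_of_real (\<rho> x - \<rho> (h + x)))"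
      using 3 xp by (simp add: algebra_simps)
    also have "\<dots> = \<bar>\<rho> x - \<rho> (h + x)\<bar>"
      by (simp add: norm_mult flip: of_real_diff)
    also have "\<dots> \<le> G x"
    proof -
      consider "x \<le> sqrt h" | "sqrt h < x" "x \<le> \<delta> / 2" | "\<delta> / 2 < x" "x \<le> B" | "B < x" by linarith
      then show ?thesis
      proof cases
        case 1
        have "\<bar>\<rho> x - \<rho> (h + x)\<bar> \<le> C * ((h + x) - x) / (x^2 * (ln x)^2)"
          using 1 3 xp h_pos small sqrt_h by (intro lip_near) auto
        also have "\<dots> = C * h / (x^2 * (ln x)^2)" by simp
        also have "\<dots> \<le> C * h / (x^2 * (L^2 / 4))"
          using ln_sq_ge[OF xp 1] xp C h_pos ln_h
          by (intro divide_left_mono mult_left_mono mult_pos_pos) auto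
        also have "\<dots> = (4 * C * h / L^2) * (indicator {h/2<..} x *\<^sub>R (1 / x^2))"
          using 3 h_pos by (simp add: mult_ac)
        finally show ?thesis using Gn by (simp add: G_def)
      next
        case 2
        have l: "\<bar>ln \<delta>\<bar> > 0" "\<bar>ln \<delta>\<bar> \<le> \<bar>ln x\<bar>"
          using abs_ln_mono[of x \<delta>] xp 2 \<delta> by auto
        then have l2: "(ln \<delta>)^2 \<le> (ln x)^2" "0 < (ln \<delta>)^2" "0 < (ln x)^2"
          by (auto simp: abs_le_square_iff)
        have "\<bar>\<rho> x - \<rho> (h + x)\<bar> \<le> C * ((h + x) - x) / (x^2 * (ln x)^2)"
          using 2 3 xp h_pos small sqrt_h by (intro lip_near) auto
        also have "\<dots> = C * h / (x^2 * (ln x)^2)" by simp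
        also have "\<dots> \<le> C * h / (x^2 * (ln \<delta>)^2)"
          using l2 xp C h_pos by (intro divide_left_mono mult_left_mono mult_pos_pos) auto
        also have "\<dots> = (C * h / (ln \<delta>)^2) * (indicator {sqrt h / 2<..} x *\<^sub>R (1 / x^2))"
          using 2 sqrt_h by simp
        finally show ?thesis using Gn by (simp add: G_def)
      next
        case 3
        have "\<bar>\<rho> x - \<rho> (h + x)\<bar> \<le> C * (h + x - x)"
          using 3 h_pos by (intro lip_far) auto
        also have "\<dots> = (C * h) * indicator {0<..<2 * B} x"
          using 3 xp B_pos by simp
        finally show ?thesis using Gn by (simp add: G_def)
      next
        case 4
        have "\<bar>\<rho> x - \<rho> (h + x)\<bar> \<le> indicator {B<..} x *\<^sub>R \<rho> x + indicator {B<..} x *\<^sub>R \<rho> (h + x)"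
          using nonneg[of x] nonneg[of "h + x"] 4 xp h_pos by simp
        then show ?thesis using Gn unfolding G_def by linarith
      qed
    qed
    finally show ?thesis .
  qed
qed

lemma integral_indicator_Ioo: "a \<le> b \<Longrightarrow> (\<integral>x. indicator {a<..<b} x \<partial>lborel) = b - a" for a b :: real
  by (simp add: measure_def)

lemma shifted_tail:
  "integrable lborel (\<lambda>x. indicator {B<..} x *\<^sub>R \<rho> (h + x))"
  "(\<integral>x. indicator {B<..} x *\<^sub>R \<rho> (h + x) \<partial>lborel) \<le> C / B^2"
proof -
  have *: "indicator {B + h<..} (h + 1 * x) *\<^sub>R \<rho> (h + 1 * x) = indicator {B<..} x *\<^sub>R \<rho> (h + x)" for x
    by (simp add: indicator_def)
  have **: "indicator {B + h<..} (h + x) = (indicator {B<..} x :: real)" for x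
    by (simp add: indicator_def)
  have i: "set_integrable lborel {B + h<..} \<rho>"
    using B_pos h_pos by (intro set_integrable_subset[OF int]) auto
  then show "integrable lborel (\<lambda>x. indicator {B<..} x *\<^sub>R \<rho> (h + x))"
    unfolding set_integrable_def
    by (subst (asm) lborel_integrable_real_affine_iff[where c=1 and t=h, symmetric]) (auto simp: ** simp del: real_scaleR_def)
  have "(\<integral>x. indicator {B<..} x *\<^sub>R \<rho> (h + x) \<partial>lborel) = (LINT x:{B + h<..}|lborel. \<rho> x)"
    unfolding set_lebesgue_integral_def
    by (subst (2) lborel_integral_real_affine[where c=1 and t=h]) (simp_all add: ** del: real_scaleR_def)
  also have "\<dots> \<le> C / (B + h)^2" using B_pos h_pos by (intro tail) auto
  also have "\<dots> \<le> C / B^2"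
    using C B_pos h_pos by (intro divide_left_mono power_mono mult_pos_pos) auto
  finally show "(\<integral>x. indicator {B<..} x *\<^sub>R \<rho> (h + x) \<partial>lborel) \<le> C / B^2" .
qed

text \<open>An inverse square tail cut at \<open>a\<close> integrates to \<open>1 / a\<close>. With
  the prefactor \<open>h\<close> this is a constant for \<open>a = h / 2\<close>, leaving the order
  \<open>1 / L^2\<close>, and of order \<open>sqrt h\<close> for
  \<open>a = sqrt h / 2\<close>.\<close>

lemma integral_G:
  "integrable lborel G" "integral\<^sup>L lborel G \<le> (8 * C + 8 * C2) / L^2 + (2 * C / (ln \<delta>)^2 + 4 * C) * sqrt h"
proof -
  note isq = lborel_inverse_square_tail[unfolded set_integrable_def set_lebesgue_integral_def]
  have h: "h / 2 > 0" "sqrt h / 2 > 0" using h_pos by auto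
  have tl: "integrable lborel (\<lambda>x. indicator {B<..} x *\<^sub>R \<rho> x)" "(\<integral>x. indicator {B<..} x *\<^sub>R \<rho> x \<partial>lborel) \<le> C / B^2"
    using set_integrable_subset[OF int, of "{B<..}"] tail[OF B_pos] B_pos
    by (auto simp: set_integrable_def set_lebesgue_integral_def simp del: real_scaleR_def)
  note io = integrable_indicator_Ioo
  have "(\<integral>x. indicator {0<..<2 * B} x \<partial>lborel) = 2 * B" "(\<integral>x. indicator {-h<..<h} x \<partial>lborel) = 2 * h"
    using integral_indicator_Ioo[of 0 "2 * B"] integral_indicator_Ioo[of "-h" h] B_pos h_pos by auto
  then have hb: "has_bochner_integral lborel (\<lambda>x. indicator {h/2<..} x *\<^sub>R (1 / x^2)) (1 / (h/2))"
    "has_bochner_integral lborel (\<lambda>x. indicator {sqrt h/2<..} x *\<^sub>R (1 / x^2)) (1 / (sqrt h/2))"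
    "has_bochner_integral lborel (indicator {0<..<2 * B} :: real \<Rightarrow> real) (2 * B)"
    "has_bochner_integral lborel (indicator {-h<..<h} :: real \<Rightarrow> real) (2 * h)"
    "has_bochner_integral lborel (\<lambda>x. indicator {B<..} x *\<^sub>R \<rho> x) (\<integral>x. indicator {B<..} x *\<^sub>R \<rho> x \<partial>lborel)"
    "has_bochner_integral lborel (\<lambda>x. indicator {B<..} x *\<^sub>R \<rho> (h + x)) (\<integral>x. indicator {B<..} x *\<^sub>R \<rho> (h + x) \<partial>lborel)"
    unfolding has_bochner_integral_iff
    by (simp_all only: isq[OF h(1)] isq[OF h(2)] io tl(1) shifted_tail(1) simp_thms)
  have G: "has_bochner_integral lborel G ((4 * C * h / L^2) * (1 / (h / 2)) + (C * h / (ln \<delta>)^2) * (1 / (sqrt h / 2))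
     + (C * h) * (2 * B) + ((\<integral>x. indicator {B<..} x *\<^sub>R \<rho> x \<partial>lborel) + (\<integral>x. indicator {B<..} x *\<^sub>R \<rho> (h + x) \<partial>lborel)) + (4 * C2 / (L^2 * h)) * (2 * h))"
    unfolding G_def[abs_def] by (intro has_bochner_integral_add has_bochner_integral_mult_right hb)
  then show "integrable lborel G"
    by (rule integrable.intros)
  have "integral\<^sup>L lborel G = (4 * C * h / L^2) * (1 / (h / 2)) + (C * h / (ln \<delta>)^2) * (1 / (sqrt h / 2))
     + (C * h) * (2 * B) + ((\<integral>x. indicator {B<..} x *\<^sub>R \<rho> x \<partial>lborel) + (\<integral>x. indicator {B<..} x *\<^sub>R \<rho> (h + x) \<partial>lborel)) + (4 * C2 / (L^2 * h)) * (2 * h)"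
    using G by (rule has_bochner_integral_integral_eq)
  also have "\<dots> \<le> 8 * C / L^2 + (2 * C / (ln \<delta>)^2) * sqrt h + 2 * C * sqrt h + (C * h + C * h) + 8 * C2 / L^2"
  proof (intro add_mono)
    have hh: "h = sqrt h * sqrt h" using h_pos by simp
    show "4 * C * h / L\<^sup>2 * (1 / (h / 2)) \<le> 8 * C / L\<^sup>2" using h_pos by simp
    show "C * h / (ln \<delta>)\<^sup>2 * (1 / (sqrt h / 2)) \<le> 2 * C / (ln \<delta>)\<^sup>2 * sqrt h"
    proof -
      have "C * h / (ln \<delta>)\<^sup>2 * (1 / (sqrt h / 2)) = 2 * C / (ln \<delta>)\<^sup>2 * (h / sqrt h)" by simp
      also have "h / sqrt h = sqrt h" using h_pos by (simp add: real_div_sqrt)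
      finally show ?thesis by simp
    qed
    show "C * h * (2 * B) \<le> 2 * C * sqrt h"
    proof -
      have e: "h * B = sqrt h" using h_pos by (simp add: B_def real_div_sqrt)
      have "C * h * (2 * B) = 2 * C * (h * B)" by (simp only: mult_ac)
      then show ?thesis by (simp only: e order_refl)
    qed
    have "C / B^2 = C * h" using h_pos by (simp add: B_def power_divide)
    then show "(\<integral>x. indicator {B<..} x *\<^sub>R \<rho> x \<partial>lborel) \<le> C * h" "(\<integral>x. indicator {B<..} x *\<^sub>R \<rho> (h + x) \<partial>lborel) \<le> C * h"
      using tl(2) shifted_tail(2) by simp_all
    show "4 * C2 / (L\<^sup>2 * h) * (2 * h) \<le> 8 * C2 / L\<^sup>2" using h_pos by simp
  qed
  also have "\<dots> \<le> (8 * C + 8 * C2) / L^2 + (2 * C / (ln \<delta>)^2 + 4 * C) * sqrt h"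
    using mult_left_mono[OF sqrt_h(4) C] by (simp add: algebra_simps add_divide_distrib)
  finally show "integral\<^sup>L lborel G \<le> (8 * C + 8 * C2) / L^2 + (2 * C / (ln \<delta>)^2 + 4 * C) * sqrt h" .
qed

text \<open>Since \<open>t * h = pi\<close>, translation by \<open>h\<close> reverses the sign of
  the exponential. The integral is therefore half of that of \<open>f - g\<close>, where
  \<open>\<rho> x\<close> and \<open>\<rho> (h + x)\<close> cancel without any derivative of the
  density.\<close>

lemma far_part:
  "cmod (LINT x:{h..}|lborel. exp (- \<i> * complex_of_real (t * x)) * complex_of_real (\<rho> x))
    \<le> (8 * C + 8 * C2) / L^2 + (2 * C / (ln \<delta>)^2 + 4 * C) * sqrt h"
proof -
  define f where "f = (\<lambda>x. indicator {h..} x *\<^sub>R (exp (- \<i> * complex_of_real (t * x)) * complex_of_real (\<rho> x)))"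
  define g where "g = (\<lambda>x. indicator {0..} x *\<^sub>R (exp (- \<i> * complex_of_real (t * x)) * complex_of_real (\<rho> (h + x))))"
  have th: "t * h = pi" using t by (simp add: h_def)
  have fg: "f (h + 1 * x) = - g x" for x
  proof -
    have "exp (- \<i> * complex_of_real (t * (h + x))) = exp (- \<i> * complex_of_real pi) * exp (- \<i> * complex_of_real (t * x))"
      by (simp add: distrib_left th flip: exp_add)
    also have "exp (- \<i> * complex_of_real pi) = -1" by (simp add: exp_minus)
    finally show ?thesis by (simp add: f_def g_def indicator_def)
  qed
  have i: "set_integrable lborel {h..} \<rho>"
    using h_pos by (intro set_integrable_subset[OF int]) auto
  have fi: "integrable lborel f"
    unfolding f_def
  proof (rule Bochner_Integration.integrable_bound[OF i[unfolded set_integrable_def]])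
    show "(\<lambda>x. indicator {h..} x *\<^sub>R (exp (- \<i> * complex_of_real (t * x)) * complex_of_real (\<rho> x))) \<in> borel_measurable lborel"
      by measurable
  qed (auto simp: norm_mult indicator_def)
  have gi: "integrable lborel g"
    using lborel_integrable_real_affine_iff[of 1 f h] fi unfolding fg by simp
  have "integral\<^sup>L lborel f = - integral\<^sup>L lborel g"
    by (subst lborel_integral_real_affine[where c=1 and t=h]) (simp_all add: fg[simplified])
  then have "2 * integral\<^sup>L lborel f = (\<integral>x. f x - g x \<partial>lborel)"
    using fi gi by simp
  then have "2 * cmod (integral\<^sup>L lborel f) = cmod (\<integral>x. f x - g x \<partial>lborel)"
    by (metis norm_mult norm_numeral)
  also have "\<dots> \<le> (\<integral>x. cmod (f x - g x) \<partial>lborel)" by (rule integral_norm_bound)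
  also have "\<dots> \<le> integral\<^sup>L lborel G"
    using fi gi integral_G(1) shifted_difference_bound
    by (intro integral_mono) (auto simp: f_def g_def)
  also note integral_G(2)
  finally have "2 * cmod (integral\<^sup>L lborel f) \<le> (8 * C + 8 * C2) / L\<^sup>2 + (2 * C / (ln \<delta>)\<^sup>2 + 4 * C) * sqrt h" .
  then show ?thesis
    using norm_ge_zero[of "integral\<^sup>L lborel f"] unfolding set_lebesgue_integral_def f_def by linarith
qed

lemma oscillatory_split:
  "cmod ((LINT x:{0<..}|lborel. exp (- \<i> * complex_of_real (t * x)) * complex_of_real (\<rho> x)) - complex_of_real (\<kappa> / L))
    \<le> (pi * C2 + 9 * C + 8 * C2) / L^2 + (2 * C / (ln \<delta>)^2 + 4 * C) * sqrt h"
proof -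
  let ?f = "\<lambda>x. exp (- \<i> * complex_of_real (t * x)) * complex_of_real (\<rho> x)"
  have i: "set_integrable lborel {0<..} ?f"
    unfolding set_integrable_def
  proof (rule Bochner_Integration.integrable_bound[OF int[unfolded set_integrable_def]])
    show "(\<lambda>x. indicator {0<..} x *\<^sub>R ?f x) \<in> borel_measurable lborel"
      by measurable
  qed (auto simp: norm_mult indicator_def)
  have "{0<..} = {0<..<h} \<union> {h..}" using h_pos by auto
  moreover have "(LINT x:{0<..<h} \<union> {h..}|lborel. ?f x) = (LINT x:{0<..<h}|lborel. ?f x) + (LINT x:{h..}|lborel. ?f x)"
  proof (rule set_integral_Un)
    show "set_integrable lborel {0<..<h} ?f" "set_integrable lborel {h..} ?f"
      using h_pos by (intro set_integrable_subset[OF i]; force)+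
  qed auto
  ultimately have "(LINT x:{0<..}|lborel. ?f x) = (LINT x:{0<..<h}|lborel. ?f x) + (LINT x:{h..}|lborel. ?f x)"
    by (simp only:)
  then have e: "(LINT x:{0<..}|lborel. ?f x) - complex_of_real (\<kappa> / L) = ((LINT x:{0<..<h}|lborel. ?f x) - complex_of_real (\<kappa> / L)) + (LINT x:{h..}|lborel. ?f x)"
    by (simp only: add_diff_eq diff_add_eq)
  have "(pi * C2 + C) / L^2 + ((8 * C + 8 * C2) / L^2 + (2 * C / (ln \<delta>)^2 + 4 * C) * sqrt h) =
      (pi * C2 + 9 * C + 8 * C2) / L^2 + (2 * C / (ln \<delta>)^2 + 4 * C) * sqrt h"
    by (simp add: add_divide_distrib)
  then show ?thesis
    unfolding e using norm_triangle_mono[OF near_part far_part] by (simp only:)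
qed

end

proposition oscillatory_asymptotics:
  "\<exists>C' T. \<forall>t\<ge>T. cmod ((LINT x:{0<..}|lborel. exp (- \<i> * complex_of_real (t * x)) * complex_of_real (\<rho> x)) - complex_of_real (\<kappa> / ln t)) \<le> C' / (ln t)^2"
proof -
  define A where "A = pi * C2 + 9 * C + 8 * C2"
  define B' where "B' = 2 * C / (ln \<delta>)^2 + 4 * C"
  have AB: "A \<ge> 0" "B' \<ge> 0" using C C2_nonneg by (auto simp: A_def B'_def)
  \<comment> \<open>\<open>pi^2\<close> makes \<open>ln pi\<close> at most half of
    \<open>ln t\<close>, so that \<open>L = ln t - ln pi\<close> is comparable to
    \<open>ln t\<close>; the last entry is \<open>sqrt h \<le> \<delta> / 2\<close> solved for
    \<open>t\<close>.\<close>
  define T where "T = max (max 10 (pi^2)) (4 * pi / \<delta>^2)"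
  show ?thesis
  proof (intro exI allI impI)
    fix t assume tT: "t \<ge> T"
    define h where "h = pi / t"
    define L where "L = \<bar>ln h\<bar>"
    have t: "t \<ge> 10" "t \<ge> pi^2" "t \<ge> 4 * pi / \<delta>^2" using tT by (auto simp: T_def)
    have lt: "ln t > 0" "ln (pi^2) \<le> ln t" using t ln_mono[of "pi^2" t] by auto
    have lpi: "ln pi > 0" "2 * ln pi \<le> ln t" using pi_gt3 lt(2) by (auto simp: ln_realpow)
    have "ln pi \<le> ln t" using lpi by linarith
    then have Lt: "L = ln t - ln pi" using t by (simp add: L_def h_def ln_div)
    then have L2: "ln t / 2 \<le> L" using lpi by simp
    have hs: "h \<le> (\<delta> / 2)^2" using t \<delta> by (simp add: h_def field_simps)
    then have small: "sqrt h \<le> \<delta> / 2" using real_sqrt_le_mono[OF hs] \<delta> by simp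
    have 1: "cmod ((LINT x:{0<..}|lborel. exp (- \<i> * complex_of_real (t * x)) * complex_of_real (\<rho> x)) - complex_of_real (\<kappa> / L))
      \<le> A / L^2 + B' * sqrt h"
      unfolding A_def B'_def by (rule oscillatory_split[OF t(1) h_def L_def small])
    have "(ln t / 2)^2 \<le> L^2" using L2 lt by (intro power_mono) auto
    then have "A / L^2 \<le> A / ((ln t / 2)^2)" using AB lt L2 by (intro divide_left_mono) auto
    then have 2: "A / L^2 \<le> 4 * A / (ln t)^2" by (simp add: power_divide mult.commute)
    have "sqrt h = sqrt pi / sqrt t" by (simp add: h_def real_sqrt_divide)
    also have "\<dots> \<le> 2 / sqrt t" using t real_sqrt_le_mono[of pi 4] pi_less_4 by (intro divide_right_mono) auto
    also have "\<dots> \<le> 32 / (ln t)^2"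
      using ln_sq_le_sqrt[of t] t lt by (simp add: field_simps)
    finally have 3: "B' * sqrt h \<le> B' * (32 / (ln t)^2)" using AB by (intro mult_left_mono)
    \<comment> \<open>Passing from \<open>L\<close> to \<open>ln t\<close> shifts the logarithm by
      \<open>ln pi\<close>, a change that already belongs to the error.\<close>
    have "\<kappa> / L - \<kappa> / ln t = \<kappa> * ln pi / (L * ln t)" using lt L2 by (simp add: Lt field_simps)
    then have "\<bar>\<kappa> / L - \<kappa> / ln t\<bar> = \<bar>\<kappa>\<bar> * ln pi / (L * ln t)" 
      using abs_of_pos[OF lt(1)] abs_of_pos[OF lpi(1)] lt L2 by (simp add: abs_mult)
    also have "\<dots> \<le> \<bar>\<kappa>\<bar> * ln pi / ((ln t / 2) * ln t)"
    proof (intro divide_left_mono mult_right_mono)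
      show "0 \<le> ln t" "0 < L * ln t * (ln t / 2 * ln t)"
        using lt(1) L2 by (linarith, intro mult_pos_pos) linarith+
    qed (use L2 lpi in auto)
    finally have 4: "cmod (complex_of_real (\<kappa> / L) - complex_of_real (\<kappa> / ln t)) \<le> 2 * \<bar>\<kappa>\<bar> * ln pi / (ln t)^2"
      by (simp add: power2_eq_square mult_ac flip: of_real_diff del: of_real_divide)
    from norm_triangle_mono[OF 1 4]
    have "cmod ((LINT x:{0<..}|lborel. exp (- \<i> * complex_of_real (t * x)) * complex_of_real (\<rho> x)) - complex_of_real (\<kappa> / ln t)) \<le> A / L^2 + B' * sqrt h + 2 * \<bar>\<kappa>\<bar> * ln pi / (ln t)^2"
      by simp
    also have "\<dots> \<le> 4 * A / (ln t)^2 + B' * (32 / (ln t)^2) + 2 * \<bar>\<kappa>\<bar> * ln pi / (ln t)^2"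
      using 2 3 by linarith
    also have "\<dots> = (4 * A + 32 * B' + 2 * \<bar>\<kappa>\<bar> * ln pi) / (ln t)^2"
      by (simp add: add_divide_distrib)
    finally show "cmod ((LINT x:{0<..}|lborel. exp (- \<i> * complex_of_real (t * x)) * complex_of_real (\<rho> x)) - complex_of_real (\<kappa> / ln t)) \<le> (4 * A + 32 * B' + 2 * \<bar>\<kappa>\<bar> * ln pi) / (ln t)^2" .
  qed
qed

end

section \<open>Hermitian matrices and orthogonal projections\<close>

lemma bounded_bilinear_matrix_mult:
  "bounded_bilinear ((**) :: complex^'n^'n \<Rightarrow> complex^'n^'n \<Rightarrow> complex^('n::finite)^'n)"
  unfolding bilinear_conv_bounded_bilinear[symmetric] bilinear_def
  by (auto intro!: linearI simp: matrix_matrix_mult_def vec_eq_iff sum.distrib algebra_simps scaleR_sum_right)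

lemma bounded_bilinear_matrix_vector_mult:
  "bounded_bilinear ((*v) :: complex^'n^'n \<Rightarrow> complex^'n \<Rightarrow> complex^('n::finite))"
  unfolding bilinear_conv_bounded_bilinear[symmetric] bilinear_def
  by (auto intro!: linearI simp: matrix_vector_mult_def vec_eq_iff sum.distrib algebra_simps scaleR_sum_right)

text \<open>Bilinearity is meant over the reals, where conjugation in the first argument is
  harmless. So \<open>cinner\<close> and the matrix products all fall under the one estimate
  \<open>dominated_bilinear\<close>.\<close>

lemma bounded_bilinear_cinner: "bounded_bilinear (cinner :: complex^'n \<Rightarrow> complex^('n::finite) \<Rightarrow> complex)"
  unfolding bilinear_conv_bounded_bilinear[symmetric] bilinear_def
  by (auto intro!: linearI simp: cinner_def sum.distrib algebra_simps scaleR_sum_right)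

lemma bounded_bilinear_cscale: "bounded_bilinear (cscale :: complex \<Rightarrow> complex^'n^'n \<Rightarrow> complex^('n::finite)^'n)"
  unfolding bilinear_conv_bounded_bilinear[symmetric] bilinear_def
  by (auto intro!: linearI simp: cscale_def vec_eq_iff algebra_simps)

lemmas cinner_simps = bounded_bilinear.add_left[OF bounded_bilinear_cinner] bounded_bilinear.add_right[OF bounded_bilinear_cinner]
  bounded_bilinear.diff_left[OF bounded_bilinear_cinner] bounded_bilinear.diff_right[OF bounded_bilinear_cinner]
  bounded_bilinear.zero_left[OF bounded_bilinear_cinner] bounded_bilinear.zero_right[OF bounded_bilinear_cinner]
  bounded_bilinear.minus_left[OF bounded_bilinear_cinner] bounded_bilinear.minus_right[OF bounded_bilinear_cinner]

lemmas matrix_mult_simps = bounded_bilinear.add_left[OF bounded_bilinear_matrix_mult] bounded_bilinear.add_right[OF bounded_bilinear_matrix_mult]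
  bounded_bilinear.diff_left[OF bounded_bilinear_matrix_mult] bounded_bilinear.diff_right[OF bounded_bilinear_matrix_mult]
  bounded_bilinear.zero_left[OF bounded_bilinear_matrix_mult] bounded_bilinear.zero_right[OF bounded_bilinear_matrix_mult]

lemma cscale_mult: "cscale a A ** B = cscale a (A ** B)" "A ** cscale a B = cscale a (A ** B)"
  by (simp_all add: cscale_def matrix_matrix_mult_def vec_eq_iff sum_distrib_left mult_ac)

lemma cscale_cscale: "cscale a (cscale b A) = cscale (a * b) A" "cscale 1 A = A" "cscale a 0 = 0"
  by (simp_all add: cscale_def vec_eq_iff mult_ac)

lemma cscale_vector: "cscale a A *v x = a *s (A *v x)"
  by (simp add: cscale_def matrix_vector_mult_def vec_eq_iff sum_distrib_left mult_ac)

lemma cinner_vscale: "cinner x (a *s y) = a * cinner x y" "cinner (a *s x) y = cnj a * cinner x y"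
  by (simp_all add: cinner_def sum_distrib_left mult_ac)

lemma cinner_adj: "cinner (A *v x) y = cinner x (mat_adj A *v y)"
proof -
  have "cinner (A *v x) y = (\<Sum>i\<in>UNIV. \<Sum>j\<in>UNIV. cnj (A$i$j) * cnj (x$j) * y$i)"
    by (simp add: cinner_def matrix_vector_mult_def sum_distrib_right)
  also have "\<dots> = (\<Sum>j\<in>UNIV. \<Sum>i\<in>UNIV. cnj (A$i$j) * cnj (x$j) * y$i)"
    by (rule sum.swap)
  also have "\<dots> = cinner x (mat_adj A *v y)"
    by (simp add: cinner_def matrix_vector_mult_def mat_adj_def sum_distrib_left mult_ac)
  finally show ?thesis .
qed

lemma cinner_self: "cinner x x = complex_of_real (\<Sum>i\<in>UNIV. (cmod (x$i))\<^sup>2)"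
  by (simp add: cinner_def mult.commute[of "cnj _"] complex_norm_square del: of_real_power)

lemma cinner_self_eq_0: "cinner x x = 0 \<longleftrightarrow> x = 0"
  by (simp only: cinner_self of_real_eq_0_iff) (simp add: sum_nonneg_eq_0_iff vec_eq_iff)

lemma cinner_axis: "cinner (axis i 1) x = x $ i"
  by (simp add: cinner_def axis_def if_distrib if_distribR cong: if_cong)

lemma cinner_ext: "(\<And>y. cinner y x = 0) \<Longrightarrow> x = 0"
  using cinner_axis[of _ x] by (simp add: vec_eq_iff)

lemma inner_cinner: "x \<bullet> y = Re (cinner x y)" for x y :: "complex^'n::finite"
  by (simp add: cinner_def inner_vec_def inner_complex_def)

lemma mat_adj_mult: "mat_adj (A ** B) = mat_adj B ** mat_adj A"
  by (simp add: mat_adj_def matrix_matrix_mult_def vec_eq_iff mult.commute)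

lemma mat_adj_simps: "mat_adj (A + B) = mat_adj A + mat_adj B" "mat_adj (A - B) = mat_adj A - mat_adj B"
   "mat_adj (mat_adj A) = A" "mat_adj (mat 1) = mat 1" "mat_adj 0 = 0"
  by (auto simp: mat_adj_def vec_eq_iff mat_def)

lemma mat_adj_eqI:
  assumes "\<And>x y. cinner (A *v x) y = cinner x (B *v y)" shows "mat_adj A = B"
proof -
  have "cinner x (mat_adj A *v y - B *v y) = 0" for x y
    using assms[of x y] cinner_adj[of A x y] by (simp add: cinner_simps)
  from cinner_ext[OF this] have "mat_adj A *v y = B *v y" for y by simp
  then show ?thesis by (simp add: matrix_eq)
qed

lemma inverse_exists:
  fixes A :: "complex^'n^'n"
  assumes "\<And>x. A *v x = 0 \<Longrightarrow> x = 0"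
  obtains B where "A ** B = mat 1" "B ** A = mat 1"
  using assms matrix_left_invertible_ker[of A] matrix_left_right_inverse[of A] by metis

section \<open>Complex subspaces and their orthogonal projections\<close>

definition csubspace :: "(complex^'n::finite) set \<Rightarrow> bool" where
  "csubspace S \<longleftrightarrow> 0 \<in> S \<and> (\<forall>x\<in>S. \<forall>y\<in>S. x + y \<in> S) \<and> (\<forall>c. \<forall>x\<in>S. c *s x \<in> S)"

lemma csubspace_real:
  fixes S :: "(complex^'n::finite) set"
  assumes S: "csubspace S"
  shows "subspace S"
proof -
  have "c *\<^sub>R x = complex_of_real c *s x" for c :: real and x :: "complex^'n"
    by (simp add: vec_eq_iff) (simp add: scaleR_conv_of_real)
  then show "subspace S" using S by (simp add: csubspace_def subspace_def)
qed

text \<open>\<open>orthogonal\<close> is the real relation. Applied to \<open>w\<close> and to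
  \<open>\<i> *s w\<close>, both in the complex subspace, it kills the real and the imaginary part
  of \<open>cinner z w\<close>.\<close>

lemma csubspace_decomposition:
  assumes S: "csubspace S"
  shows "\<exists>y\<in>S. \<forall>w\<in>S. cinner w (x - y) = 0"
proof -
  have sp: "span S = S" using csubspace_real[OF S] by (simp add: span_eq_iff)
  obtain y z where yz: "y \<in> span S" "\<And>w. w \<in> span S \<Longrightarrow> orthogonal z w" "x = y + z"
    by (rule orthogonal_subspace_decomp_exists[of S x]) blast
  have "cinner w z = 0" if w: "w \<in> S" for w
  proof -
    have "\<i> *s w \<in> S" using S w by (simp add: csubspace_def)
    then have "Re (cinner z w) = 0" "Re (cinner z (\<i> *s w)) = 0"
      using yz(2) w sp by (auto simp: orthogonal_def inner_cinner)
    then have "cinner z w = 0" by (simp add: cinner_vscale complex_eq_iff)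
    then show ?thesis using cinner_cnj[of w z] by simp
  qed
  then show ?thesis using yz sp by (intro bexI[of _ y]) auto
qed

text \<open>The component in \<open>S\<close> is unique, hence depends linearly on the vector, and
  the matrix of this linear map is the projection.\<close>

lemma orthogonal_projection_exists:
  assumes S: "csubspace S"
  shows "\<exists>P. P ** P = P \<and> mat_adj P = P \<and> range (\<lambda>x. P *v x) = S"
proof -
  obtain p where p: "\<And>x. p x \<in> S" "\<And>x w. w \<in> S \<Longrightarrow> cinner w (x - p x) = 0"
    using csubspace_decomposition[OF S] by metis
  have diff: "x - y \<in> S" if "x \<in> S" "y \<in> S" for x y
    using subspace_diff[OF csubspace_real[OF S] that] .
  have uniq: "p x = y" if "y \<in> S" "\<And>w. w \<in> S \<Longrightarrow> cinner w (x - y) = 0" for x y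
  proof -
    let ?d = "p x - y"
    have d: "?d \<in> S" using diff p(1) that(1) by simp
    have "cinner ?d ?d = cinner ?d (x - y) - cinner ?d (x - p x)"
      by (simp add: cinner_simps)
    then show ?thesis using p(2)[OF d] that(2)[OF d] cinner_self_eq_0[of ?d] by simp
  qed
  have lin: "Vector_Spaces.linear (*s) (*s) p"
  proof (unfold_locales)
    show "p (x + y) = p x + p y" for x y
    proof (rule uniq)
      show "p x + p y \<in> S" using p(1) S by (simp add: csubspace_def)
      fix w assume "w \<in> S"
      then show "cinner w (x + y - (p x + p y)) = 0"
        using p(2)[of w x] p(2)[of w y] by (simp add: cinner_simps)
    qed
    show "p (c *s x) = c *s p x" for c x
    proof (rule uniq)
      show "c *s p x \<in> S" using p(1) S by (simp add: csubspace_def)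
      fix w assume "w \<in> S"
      then show "cinner w (c *s x - c *s p x) = 0"
        using p(2)[of w x] by (simp add: cinner_simps cinner_vscale)
    qed
  qed
  define P where "P = matrix p"
  have Pv: "P *v x = p x" for x unfolding P_def by (rule matrix_works[OF lin])
  have ps: "p x = x" if "x \<in> S" for x by (rule uniq) (use that in \<open>auto simp: cinner_simps\<close>)
  have "P ** P = P"
    by (simp add: matrix_eq matrix_vector_mul_assoc[symmetric] Pv ps p(1))
  moreover have "mat_adj P = P"
  proof (rule mat_adj_eqI)
    fix x y
    have "cinner (p x) (y - p y) = 0" "cinner (p y) (x - p x) = 0" using p by auto
    then have "cinner (p x) y = cinner (p x) (p y)" "cinner (p y) x = cinner (p y) (p x)"
      by (auto simp: cinner_simps)
    then show "cinner (P *v x) y = cinner x (P *v y)"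
      using cinner_cnj[of x "p y"] cinner_cnj[of "p x" "p y"] by (simp add: Pv)
  qed
  moreover have "range (\<lambda>x. P *v x) = S"
    unfolding Pv using p(1) ps by (auto simp: image_iff) metis
  ultimately show ?thesis by blast
qed

text \<open>Equal ranges give \<open>P ** Q = Q\<close> and \<open>Q ** P = P\<close>; the adjoint
  of the former reads \<open>Q ** P = Q\<close>. Uniqueness is what the \<open>THE\<close> in
  \<open>orth_proj\<close> asks for.\<close>

lemma orthogonal_projection_unique:
  fixes P Q :: "complex^'n::finite^'n"
  assumes P: "P ** P = P" "mat_adj P = P" and Q: "Q ** Q = Q" "mat_adj Q = Q"
    and r: "range (\<lambda>x. P *v x) = range (\<lambda>x. Q *v x)"
  shows "P = Q"
proof -
  have fixp: "A ** B = B" if "A ** A = A" "range (\<lambda>x. B *v x) \<subseteq> range (\<lambda>x. A *v x)" for A B :: "complex^'n::finite^'n"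
  proof -
    have "A *v (B *v x) = B *v x" for x
    proof -
      have "B *v x \<in> range (\<lambda>x. A *v x)" using that(2) by blast
      then obtain y where e: "B *v x = A *v y" by blast
      have "A *v (A *v y) = A *v y" using \<open>A ** A = A\<close> by (simp add: matrix_vector_mul_assoc)
      then show ?thesis using e by simp
    qed
    then show ?thesis by (simp add: matrix_eq matrix_vector_mul_assoc)
  qed
  have "P ** Q = Q" "Q ** P = P" using fixp P Q r by auto
  then have "mat_adj (P ** Q) = P ** Q" using P Q mat_adj_mult[of P Q] by (metis mat_adj_mult)
  then show ?thesis using \<open>P ** Q = Q\<close> \<open>Q ** P = P\<close> P Q by (metis mat_adj_mult)
qed

lemma orth_proj:
  assumes S: "csubspace S"
  shows "orth_proj S ** orth_proj S = orth_proj S" "mat_adj (orth_proj S) = orth_proj S"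
    "range (\<lambda>x. orth_proj S *v x) = S"
proof -
  have "\<exists>!P. P ** P = P \<and> mat_adj P = P \<and> range (\<lambda>x. P *v x) = S"
    using orthogonal_projection_exists[OF S] orthogonal_projection_unique by (metis (no_types, lifting))
  from theI'[OF this] show "orth_proj S ** orth_proj S = orth_proj S" "mat_adj (orth_proj S) = orth_proj S"
    "range (\<lambda>x. orth_proj S *v x) = S"
    unfolding orth_proj_def by blast+
qed

lemma orth_proj_fixes: "csubspace S \<Longrightarrow> x \<in> S \<Longrightarrow> orth_proj S *v x = x"
  using orth_proj[of S] by (metis (no_types, lifting) imageE matrix_vector_mul_assoc)

lemma csubspace_kernel: "csubspace {x. K *v x = 0}"
  by (auto simp: csubspace_def algebra_simps vec_eq_iff matrix_vector_mult_def sum_distrib_left[symmetric] sum.distrib)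

text \<open>The range of a Hermitian matrix is orthogonal to its kernel. A vector in the double
  complement is thus orthogonal to the range, and \<open>K\<close> annihilates it.\<close>

lemma kernel_double_complement:
  assumes K: "mat_adj K = K"
  shows "ortho_compl (ortho_compl {x. K *v x = 0}) = {x. K *v x = 0}"
proof (intro equalityI subsetI)
  fix x assume x: "x \<in> ortho_compl (ortho_compl {x. K *v x = 0})"
  have "K *v y \<in> ortho_compl {x. K *v x = 0}" for y
    unfolding ortho_compl_def
  proof safe
    fix z assume "K *v z = 0"
    then show "cinner z (K *v y) = 0" using cinner_adj[of K z y] K by (simp add: cinner_simps)
  qed
  then have "cinner (K *v y) x = 0" for y using x by (auto simp: ortho_compl_def)
  then have "cinner y (K *v x) = 0" for y using cinner_adj[of K y x] K by simp
  then show "x \<in> {x. K *v x = 0}" using cinner_ext by blast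
next
  fix x assume x: "x \<in> {x. K *v x = 0}"
  show "x \<in> ortho_compl (ortho_compl {x. K *v x = 0})"
    unfolding ortho_compl_def
  proof (safe)
    fix y assume "\<forall>z\<in>{x. K *v x = 0}. cinner z y = 0"
    then have "cinner x y = 0" using x by blast
    then show "cinner y x = 0" using cinner_cnj[of y x] by simp
  qed
qed

text \<open>The reduced inverse on the kernel and a partial inverse of \<open>K\<close>, the two ingredients of the
  approximate inverse of \<open>K + z log z G + O(z)\<close>.\<close>
lemma reduced_inverse_exists:
  fixes K G :: "complex^'n::finite^'n"
  assumes K: "mat_adj K = K" and G: "mat_adj G = G"
    and pos: "\<And>x. K *v x = 0 \<Longrightarrow> cinner x (G *v x) = 0 \<Longrightarrow> x = 0"
  defines "Q \<equiv> orth_proj {x. K *v x = 0}"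
  obtains R Y where "R ** (Q ** G ** Q) = Q" "R ** Q = R" "Q ** R = R" "mat_adj R = R"
    "R ** G ** R = R" "K ** R = 0" "G ** R + K ** Y = mat 1"
proof -
  note Q = orth_proj[OF csubspace_kernel[of K], folded Q_def]
  have Qk: "K *v (Q *v x) = 0" for x using Q(3) by blast
  have Qf: "Q *v x = x" if "K *v x = 0" for x
    using orth_proj_fixes[OF csubspace_kernel[of K], folded Q_def] that by simp
  have KQ: "K ** Q = 0" by (simp add: matrix_eq matrix_vector_mul_assoc[symmetric] Qk)
  then have QK: "Q ** K = 0" using K Q(2) mat_adj_mult[of K Q] by (simp add: mat_adj_simps)
  \<comment> \<open>The compression of \<open>G\<close> to the kernel, completed by the identity on
    the complement. It is invertible because the form of \<open>G\<close> has no null vector in the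
    kernel, and it commutes with \<open>Q\<close>, so its inverse restricts to the reduced
    inverse.\<close>
  define Z where "Z = Q ** G ** Q + (mat 1 - Q)"
  have QZ: "Q ** Z = Q ** G ** Q" "Z ** Q = Q ** G ** Q"
    by (simp_all add: Z_def matrix_mult_simps matrix_mul_assoc Q) (simp add: matrix_mul_assoc[symmetric] Q)
  have adjZ: "mat_adj Z = Z"
    by (simp add: Z_def mat_adj_simps mat_adj_mult Q G matrix_mul_assoc)
  have "x = 0" if "Z *v x = 0" for x
  proof -
    have 1: "Q *v (G *v (Q *v x)) = 0"
      using arg_cong[OF that, of "\<lambda>y. Q *v y"] QZ(1) by (simp add: matrix_vector_mul_assoc matrix_mul_assoc)
    then have 2: "Q *v x = x"
      using that by (simp add: Z_def matrix_vector_mult_add_rdistrib matrix_vector_mult_diff_rdistrib matrix_vector_mul_assoc matrix_mul_assoc)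
    have "cinner x (G *v x) = cinner (Q *v x) (G *v (Q *v x))" using 2 by simp
    also have "\<dots> = 0" using 1 by (simp add: cinner_adj Q cinner_simps)
    finally show ?thesis using pos Qk[of x] 2 by simp
  qed
  then obtain Zi where Zi: "Z ** Zi = mat 1" "Zi ** Z = mat 1" by (rule inverse_exists)
  have adjZi: "mat_adj Zi = Zi"
  proof -
    have "mat_adj Zi ** Z = mat 1" using arg_cong[OF Zi(1), of mat_adj] by (simp add: mat_adj_mult adjZ mat_adj_simps)
    then have "mat_adj Zi ** Z ** Zi = Zi" by simp
    then show ?thesis by (simp add: matrix_mul_assoc[symmetric] Zi)
  qed
  have com: "Q ** Zi = Zi ** Q"
  proof -
    have "Zi ** (Q ** Z) ** Zi = Zi ** (Z ** Q) ** Zi" by (simp add: QZ)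
    then show ?thesis by (simp add: matrix_mul_assoc[symmetric] Zi) (simp add: matrix_mul_assoc Zi)
  qed
  define R where "R = Zi ** Q"
  have R1: "R ** (Q ** G ** Q) = Q"
    by (simp add: R_def QZ(2)[symmetric]) (metis QZ Zi(2) Q(1) matrix_mul_assoc matrix_mul_lid)
  have R2: "R ** Q = R" by (simp add: R_def matrix_mul_assoc[symmetric] Q)
  have R3: "Q ** R = R" by (simp add: R_def matrix_mul_assoc com) (simp add: matrix_mul_assoc[symmetric] Q)
  have R4: "mat_adj R = R" by (simp add: R_def mat_adj_mult adjZi Q com)
  have R5: "R ** G ** R = R"
  proof -
    have "R ** G ** R = R ** (Q ** G ** Q) ** R" using R2 R3 by (metis matrix_mul_assoc)
    then show ?thesis by (simp add: R1 R3)
  qed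
  have R6: "K ** R = 0" using R3 KQ by (metis matrix_mul_assoc matrix_mult_simps(5))
  have QGR: "Q ** (G ** R) = Q"
  proof -
    have "mat_adj (R ** (Q ** G ** Q)) = Q" using R1 Q by simp
    then have "Q ** G ** Q ** R = Q" by (simp add: mat_adj_mult R4 Q G matrix_mul_assoc)
    then show ?thesis using R3 by (simp add: matrix_mul_assoc[symmetric])
  qed
  \<comment> \<open>The inverse \<open>W\<close> of \<open>K + Q\<close> is a partial inverse of
    \<open>K\<close>: it satisfies \<open>K ** W = mat 1 - Q\<close>.\<close>
  have "x = 0" if "(K + Q) *v x = 0" for x
  proof -
    have s: "K *v x + Q *v x = 0" using that by (simp add: matrix_vector_mult_add_rdistrib)
    have "Q *v (K *v x + Q *v x) = 0" using s by simp
    then have "Q *v x = 0" by (simp add: matrix_vector_right_distrib matrix_vector_mul_assoc QK Q)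
    then show ?thesis using s Qf[of x] by simp
  qed
  then obtain W where W: "(K + Q) ** W = mat 1" by (rule inverse_exists)
  have QW: "Q ** W = Q"
  proof -
    have "Q ** ((K + Q) ** W) = Q" by (simp add: W)
    then show ?thesis by (simp add: matrix_mul_assoc matrix_mult_simps QK Q)
  qed
  have KW: "K ** W = mat 1 - Q"
    using W QW by (simp add: matrix_mult_simps eq_diff_eq)
  \<comment> \<open>\<open>Y\<close> has to repair the defect \<open>mat 1 - G ** R\<close>. Since
    \<open>Q ** (G ** R) = Q\<close>, the range of the defect lies in the complement of the kernel,
    and there \<open>K ** W\<close> acts as the identity.\<close>
  have "G ** R + K ** (W ** (mat 1 - G ** R)) = mat 1"
    by (simp add: matrix_mul_assoc KW) (simp add: matrix_mult_simps QGR)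
  then show ?thesis using that R1 R2 R3 R4 R5 R6 by blast
qed

section \<open>Continuity of determinants and of solutions\<close>

lemma continuous_on_det:
  fixes A :: "'a::topological_space \<Rightarrow> complex^'n::finite^'n"
  assumes "\<And>i j. continuous_on S (\<lambda>z. A z $ i $ j)"
  shows "continuous_on S (\<lambda>z. det (A z))"
  unfolding det_def by (intro continuous_on_sum continuous_on_mult continuous_on_const continuous_on_prod assms)

lemma matrix_inv_eq:
  fixes A :: "complex^'n::finite^'n"
  assumes "det A \<noteq> 0" shows "A ** matrix_inv A = mat 1" "matrix_inv A ** A = mat 1"
proof -
  have "\<exists>B. A ** B = mat 1 \<and> B ** A = mat 1"
    using assms invertible_det_nz[of A] unfolding invertible_def by blast
  from someI_ex[OF this] show "A ** matrix_inv A = mat 1" "matrix_inv A ** A = mat 1"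
    unfolding matrix_inv_def by blast+
qed

text \<open>Cramer's rule writes each component as a quotient of determinants.\<close>

lemma continuous_on_solution:
  fixes A :: "'a::topological_space \<Rightarrow> complex^'n::finite^'n"
  assumes A: "\<And>i j. continuous_on S (\<lambda>z. A z $ i $ j)" and d: "\<And>z. z \<in> S \<Longrightarrow> det (A z) \<noteq> 0"
  shows "continuous_on S (\<lambda>z. (matrix_inv (A z) *v u) $ k)"
proof -
  let ?c = "\<lambda>z. det (\<chi> i j. if j = k then u $ i else A z $ i $ j) / det (A z)"
  have "(matrix_inv (A z) *v u) $ k = ?c z" if "z \<in> S" for z
  proof -
    have "A z *v (matrix_inv (A z) *v u) = u"
      using matrix_inv_eq[OF d[OF that]] by (simp add: matrix_vector_mul_assoc)
    then show ?thesis using cramer[OF d[OF that], of "matrix_inv (A z) *v u" u] by (metis (no_types, lifting) vec_lambda_beta)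
  qed
  moreover have "continuous_on S ?c"
  proof (rule continuous_on_divide[OF continuous_on_det continuous_on_det])
    show "continuous_on S (\<lambda>z. (\<chi> i j. if j = k then u $ i else A z $ i $ j) $ i $ j)" for i j
      using A by (cases "j = k") (auto intro: continuous_intros)
  qed (use A d in auto)
  ultimately show ?thesis by (simp cong: continuous_on_cong)
qed

section \<open>Asymptotics of the resolvent at the threshold\<close>

text \<open>O-notation, uniform on a whole set instead of along a filter. On sets of pairs it
  expresses Lipschitz bounds, and majorants multiply under bounded bilinear maps, so that the
  estimates reduce to bookkeeping of weights.\<close>

definition dominated :: "'p set \<Rightarrow> ('p \<Rightarrow> 'a::real_normed_vector) \<Rightarrow> ('p \<Rightarrow> real) \<Rightarrow> bool" where
  "dominated S f g \<longleftrightarrow> (\<exists>C\<ge>0. \<forall>p\<in>S. norm (f p) \<le> C * g p)"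

lemma dominatedI: "C \<ge> 0 \<Longrightarrow> (\<And>p. p \<in> S \<Longrightarrow> norm (f p) \<le> C * g p) \<Longrightarrow> dominated S f g"
  unfolding dominated_def by blast

lemma dominated_cong: "(\<And>p. p \<in> S \<Longrightarrow> f p = f' p) \<Longrightarrow> dominated S f' g \<Longrightarrow> dominated S f g"
  unfolding dominated_def by simp

lemma dominated_subset: "dominated S f g \<Longrightarrow> T \<subseteq> S \<Longrightarrow> dominated T f g"
  unfolding dominated_def by blast

lemma dominated_compose: "dominated S f g \<Longrightarrow> (\<And>q. q \<in> T \<Longrightarrow> h q \<in> S) \<Longrightarrow> dominated T (\<lambda>q. f (h q)) (\<lambda>q. g (h q))"
  unfolding dominated_def by blast

lemma dominated_const: "dominated S (\<lambda>p. a) (\<lambda>p. 1)"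
  by (rule dominatedI[of "norm a"]) auto

lemma dominated_mono:
  assumes "dominated S f g" "c \<ge> 0" "\<And>p. p \<in> S \<Longrightarrow> g p \<le> c * h p"
  shows "dominated S f h"
proof -
  obtain C where C: "C \<ge> 0" "\<And>p. p \<in> S \<Longrightarrow> norm (f p) \<le> C * g p"
    using assms(1) unfolding dominated_def by blast
  show ?thesis
  proof (rule dominatedI[of "C * c"])
    fix p assume p: "p \<in> S"
    have "norm (f p) \<le> C * g p" by (rule C(2)[OF p])
    also have "\<dots> \<le> C * (c * h p)" using C(1) assms(3)[OF p] by (intro mult_left_mono)
    finally show "norm (f p) \<le> C * c * h p" by (simp add: mult.assoc)
  qed (use C assms in auto)
qed

lemma dominated_add:
  assumes "dominated S f g" "dominated S f' g"
  shows "dominated S (\<lambda>p. f p + f' p) g"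
proof -
  obtain C C' where "C \<ge> 0" "\<And>p. p \<in> S \<Longrightarrow> norm (f p) \<le> C * g p" "C' \<ge> 0" "\<And>p. p \<in> S \<Longrightarrow> norm (f' p) \<le> C' * g p"
    using assms unfolding dominated_def by blast
  then show ?thesis
    by (intro dominatedI[of "C + C'"]) (auto simp: distrib_right intro: norm_triangle_mono)
qed

lemma dominated_minus: "dominated S f g \<Longrightarrow> dominated S (\<lambda>p. - f p) g"
  unfolding dominated_def by simp

lemma dominated_diff:
  assumes "dominated S f g" "dominated S f' g"
  shows "dominated S (\<lambda>p. f p - f' p) g"
  using dominated_add[OF assms(1) dominated_minus[OF assms(2)]] by simp

lemma dominated_bilinear:
  assumes "bounded_bilinear bp" "dominated S f g" "dominated S f' g'"
  shows "dominated S (\<lambda>p. bp (f p) (f' p)) (\<lambda>p. g p * g' p)"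
proof -
  obtain K where K: "K > 0" "\<And>a b. norm (bp a b) \<le> norm a * norm b * K"
    using bounded_bilinear.pos_bounded[OF assms(1)] by blast
  obtain C C' where C: "C \<ge> 0" "\<And>p. p \<in> S \<Longrightarrow> norm (f p) \<le> C * g p" "C' \<ge> 0" "\<And>p. p \<in> S \<Longrightarrow> norm (f' p) \<le> C' * g' p"
    using assms(2,3) unfolding dominated_def by blast
  show ?thesis
  proof (rule dominatedI[of "C * C' * K"])
    fix p assume p: "p \<in> S"
    have "norm (bp (f p) (f' p)) \<le> norm (f p) * norm (f' p) * K" by (rule K)
    also have "\<dots> \<le> (C * g p) * (C' * g' p) * K"
      using K(1) C(2)[OF p] C(4)[OF p] order_trans[OF norm_ge_zero C(2)[OF p]]
      by (intro mult_right_mono mult_mono) auto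
    finally show "norm (bp (f p) (f' p)) \<le> C * C' * K * (g p * g' p)" by (simp add: mult_ac)
  qed (use C K in auto)
qed

lemma dominated_vec:
  fixes f :: "'p \<Rightarrow> 'a::real_normed_vector^'n::finite"
  assumes "\<And>i. dominated S (\<lambda>p. f p $ i) g"
  shows "dominated S f g"
proof -
  obtain C where C: "\<And>i. C i \<ge> 0" "\<And>i p. p \<in> S \<Longrightarrow> norm (f p $ i) \<le> C i * g p"
    using assms unfolding dominated_def by metis
  show ?thesis
  proof (rule dominatedI[of "\<Sum>i\<in>UNIV. C i"])
    fix p assume p: "p \<in> S"
    have "norm (f p) \<le> (\<Sum>i\<in>UNIV. norm (f p $ i))" unfolding norm_vec_def by (rule L2_set_le_sum) simp
    also have "\<dots> \<le> (\<Sum>i\<in>UNIV. C i * g p)" by (intro sum_mono C(2)[OF p])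
    finally show "norm (f p) \<le> (\<Sum>i\<in>UNIV. C i) * g p" by (simp add: sum_distrib_right)
  qed (use C in \<open>auto intro: sum_nonneg\<close>)
qed

lemma dominated_union: 
  assumes "dominated S f (\<lambda>_. 1)" "dominated T f (\<lambda>_. 1)" shows "dominated (S \<union> T) f (\<lambda>_. 1)"
proof -
  obtain C C' where "C \<ge> 0" "\<And>p. p \<in> S \<Longrightarrow> norm (f p) \<le> C * 1" "C' \<ge> 0" "\<And>p. p \<in> T \<Longrightarrow> norm (f p) \<le> C' * 1"
    using assms unfolding dominated_def by blast
  then show ?thesis by (intro dominatedI[of "max C C'"]) (auto simp: le_max_iff_disj)
qed

lemma matrix_mult_norm_bound:
  obtains k where "k > 0" "\<And>(a :: complex^'n::finite^'n) (b :: complex^'n^'n). norm (a ** b) \<le> norm a * norm b * k"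
proof -
  have "\<exists>k>0. \<forall>(a :: complex^'n::finite^'n) (b :: complex^'n^'n). norm (a ** b) \<le> norm a * norm b * k"
    by (rule bounded_bilinear.pos_bounded[OF bounded_bilinear_matrix_mult])
  then show ?thesis using that by (elim exE conjE) simp
qed

lemma divide_difference:
  fixes w a b x :: real
  assumes "w > 0" "a > 0" "a + b > 0"
  shows "x / (w * (a + b)) - x / (w * a) = - (x * b / (w * (a * (a + b))))"
  using assms by (simp add: divide_simps) (simp add: algebra_simps)

section \<open>The logarithm near zero\<close>

definition logL :: "real \<Rightarrow> complex" where "logL w = complex_of_real (ln w) - \<i> * pi"

text \<open>\<open>exp (-2)\<close> is the critical point up to which \<open>x * (ln x)^2\<close>
  increases; it also gives \<open>\<bar>ln w\<bar> \<ge> 2\<close>.\<close>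

definition near0 :: "real set" where "near0 = {0<..exp (-2)}"

lemma near0_log:
  assumes "w \<in> near0"
  shows "w > 0" "w < 1" "\<bar>ln w\<bar> \<ge> 2" "w * \<bar>ln w\<bar>^2 \<le> 16" "w * \<bar>ln w\<bar> \<le> 16"
    "\<bar>ln w\<bar> \<le> cmod (logL w)" "cmod (logL w) \<le> 3 * \<bar>ln w\<bar>" "(cmod (logL w))^2 = (ln w)^2 + pi^2"
proof -
  show w: "w > 0" using assms by (simp add: near0_def)
  have "ln w \<le> -2" using assms ln_mono[of w "exp (-2)"] w by (simp add: near0_def)
  then show l: "\<bar>ln w\<bar> \<ge> 2" by linarith
  show w1: "w < 1" using assms by (simp add: near0_def) (meson exp_less_one_iff le_less_trans neg_less_0_iff_less zero_less_numeral)
  have "(ln (1 / w))^2 \<le> 16 * sqrt (1 / w)" using w w1 by (intro ln_sq_le_sqrt) simp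
  then have "w * (ln w)^2 \<le> w * (16 * sqrt (1 / w))" using w by (intro mult_left_mono) (auto simp: ln_div)
  also have "w * (16 * sqrt (1 / w)) = 16 * (w / sqrt w)" by (simp add: real_sqrt_divide)
  also have "w / sqrt w = sqrt w" using w by (simp add: real_div_sqrt)
  also have "16 * sqrt w \<le> 16" using w1 w by simp
  finally show wl: "w * \<bar>ln w\<bar>^2 \<le> 16" by simp
  have "\<bar>ln w\<bar> * 1 \<le> \<bar>ln w\<bar> * \<bar>ln w\<bar>" using l by (intro mult_left_mono) auto
  then have "\<bar>ln w\<bar> \<le> \<bar>ln w\<bar>^2" by (simp add: power2_eq_square)
  then have "w * \<bar>ln w\<bar> \<le> w * \<bar>ln w\<bar>^2" using w by (intro mult_left_mono) auto
  then show "w * \<bar>ln w\<bar> \<le> 16" using wl by linarith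
  show "\<bar>ln w\<bar> \<le> cmod (logL w)" using abs_Re_le_cmod[of "logL w"] by (simp add: logL_def)
  have "cmod (logL w) \<le> \<bar>ln w\<bar> + pi"
    unfolding logL_def using norm_triangle_ineq4[of "complex_of_real (ln w)" "\<i> * pi"] by (simp add: norm_mult)
  then show "cmod (logL w) \<le> 3 * \<bar>ln w\<bar>" using l pi_less_4 by linarith
  show "(cmod (logL w))^2 = (ln w)^2 + pi^2" by (simp add: logL_def cmod_power2)
qed

text \<open>Lipschitz estimates produce weights at both points of a pair; monotonicity moves them to
  the smaller point.\<close>

lemma near0_mono:
  fixes s t :: real
  assumes "0 < s" "s \<le> t" "t \<le> exp (-2)"
  shows "s * \<bar>ln s\<bar> \<le> t * \<bar>ln t\<bar>" "s * (ln s)^2 \<le> t * (ln t)^2"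
proof -
  have l: "ln x \<le> -2" if "0 < x" "x \<le> t" for x :: real
    using ln_mono[of x "exp (-2)"] that assms by simp
  have "- (s * ln s) \<le> - (t * ln t)"
  proof (rule DERIV_nonneg_imp_nondecreasing[OF assms(2)])
    fix x assume "s \<le> x" "x \<le> t"
    then have x: "0 < x" "ln x \<le> -2" using l assms by auto
    have "DERIV (\<lambda>x. - (x * ln x)) x :> - (ln x + 1)"
      using x by (auto intro!: derivative_eq_intros)
    then show "\<exists>y. DERIV (\<lambda>x. - (x * ln x)) x :> y \<and> 0 \<le> y" using x by (intro exI conjI) auto
  qed
  then show "s * \<bar>ln s\<bar> \<le> t * \<bar>ln t\<bar>" using l[of s] l[of t] assms by simp
  show "s * (ln s)^2 \<le> t * (ln t)^2"
  proof (rule DERIV_nonneg_imp_nondecreasing[OF assms(2)])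
    fix x assume "s \<le> x" "x \<le> t"
    then have x: "0 < x" "ln x \<le> -2" using l assms by auto
    have "DERIV (\<lambda>x. x * (ln x)^2) x :> ln x * (ln x + 2)"
      using x by (auto intro!: derivative_eq_intros simp: power2_eq_square algebra_simps)
    moreover have "0 \<le> ln x * (ln x + 2)" using x by (intro mult_nonpos_nonpos) linarith+
    ultimately show "\<exists>y. DERIV (\<lambda>x. x * (ln x)^2) x :> y \<and> 0 \<le> y" by blast
  qed
qed

definition pairs :: "real \<Rightarrow> (real \<times> real) set" where
  "pairs d = {p. 0 < fst p \<and> fst p \<le> snd p \<and> snd p \<le> d}"

definition far_pairs :: "real \<Rightarrow> (real \<times> real) set" where
  "far_pairs d = {p. d \<le> fst p \<and> fst p \<le> snd p}"

text \<open>\<open>A w\<close> is to be the boundary value of \<open>K(z) - z\<close>, and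
  \<open>c\<close> is to be \<open>lam^2\<close>. \<open>KR\<close> and \<open>GRKY\<close> make
  \<open>R / z + Y\<close> an approximate inverse of \<open>K + z \<Gamma>\<close> for small
  \<open>z\<close>; \<open>adj_R\<close> and \<open>RGR\<close> evaluate the leading term of the
  density.\<close>

locale resolvent_asymptotics =
  fixes A G :: "real \<Rightarrow> complex^'n::finite^'n" and K \<Gamma> R Y :: "complex^'n::finite^'n" and c :: real
  assumes c: "c > 0"
    and det_A: "\<And>w. w > 0 \<Longrightarrow> det (A w) \<noteq> 0"
    and cont_A: "\<And>i j. continuous_on {0<..} (\<lambda>w. A w $ i $ j)"
    and KR: "K ** R = 0" and GRKY: "\<Gamma> ** R + K ** Y = mat 1"
    and adj_R: "mat_adj R = R" and RGR: "R ** \<Gamma> ** R = R"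
    and A_near: "dominated near0 (\<lambda>w. A w - K - cscale (of_real (c * w) * logL w) \<Gamma>) (\<lambda>w. w)"
    and A_lip_near: "dominated (pairs (exp (-2))) (\<lambda>p. A (fst p) - A (snd p)) (\<lambda>p. (snd p - fst p) * \<bar>ln (fst p)\<bar>)"
    and A_lip_far: "\<And>\<eta>. \<eta> > 0 \<Longrightarrow> dominated (far_pairs \<eta>) (\<lambda>p. A (fst p) - A (snd p)) (\<lambda>p. snd p - fst p)"
    and A_large: "dominated {1..} (\<lambda>w. A w + mat (of_real w)) (\<lambda>w. 1)"
    and G_near: "dominated near0 (\<lambda>w. G w - w *\<^sub>R \<Gamma>) (\<lambda>w. w^2)"
    and G_lip: "dominated {p. 0 < fst p \<and> fst p \<le> snd p} (\<lambda>p. G (fst p) - G (snd p)) (\<lambda>p. snd p - fst p)"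
    and G_bounded: "dominated {0<..} G (\<lambda>w. 1)"
begin

section \<open>The approximate inverse and bounds for the inverse\<close>

lemmas bmm = bounded_bilinear_matrix_mult
lemmas bmv = bounded_bilinear_matrix_vector_mult

definition "B w = matrix_inv (A w)"
definition "R0 w = cscale (1 / (of_real (c * w) * logL w)) R"

lemma AB: "w > 0 \<Longrightarrow> A w ** B w = mat 1" and BA: "w > 0 \<Longrightarrow> B w ** A w = mat 1"
  using matrix_inv_eq[OF det_A] by (simp_all add: B_def)

lemma logL_bound: "dominated near0 logL (\<lambda>w. \<bar>ln w\<bar>)"
  by (rule dominatedI[of 3]) (auto simp: near0_log)

lemma R0_bound: "dominated near0 R0 (\<lambda>w. 1 / (w * \<bar>ln w\<bar>))"
proof -
  have "dominated near0 (\<lambda>w. 1 / (of_real (c * w) * logL w)) (\<lambda>w. 1 / (w * \<bar>ln w\<bar>))"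
  proof (rule dominatedI[of "1 / c"])
    fix w assume w: "w \<in> near0"
    note n = near0_log[OF w]
    have "norm (1 / (of_real (c * w) * logL w)) = 1 / (c * (w * cmod (logL w)))"
      using n c by (simp add: norm_divide norm_mult)
    also have "\<dots> \<le> 1 / (c * (w * \<bar>ln w\<bar>))"
      using n c by (intro divide_left_mono mult_left_mono mult_pos_pos) auto
    finally show "norm (1 / (of_real (c * w) * logL w)) \<le> 1 / c * (1 / (w * \<bar>ln w\<bar>))" by simp
  qed (use c in auto)
  from dominated_bilinear[OF bounded_bilinear_cscale this dominated_const[of _ R]]
  show ?thesis by (simp add: R0_def[abs_def])
qed

definition "Er w = A w ** (R0 w + Y) - mat 1"

text \<open>Write \<open>A = D + K + z \<Gamma>\<close>. In the product with
  \<open>R / z + Y\<close> the singular term \<open>K R / z\<close> vanishes and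
  \<open>\<Gamma> R + K Y\<close> is the identity. The remainder is led by \<open>D ** R0\<close>,
  of size \<open>w / (w * \<bar>ln w\<bar>)\<close>: the gain is a single logarithm.\<close>

lemma Er_bound: "dominated near0 Er (\<lambda>w. 1 / \<bar>ln w\<bar>)"
proof -
  let ?D = "\<lambda>w. A w - K - cscale (of_real (c * w) * logL w) \<Gamma>"
  have e: "Er w = ?D w ** R0 w + (cscale (of_real (c * w) * logL w) \<Gamma> ** Y + ?D w ** Y)" if "w \<in> near0" for w
  proof -
    define z where "z = of_real (c * w) * logL w"
    define D where "D = A w - K - cscale z \<Gamma>"
    have "logL w \<noteq> 0" using near0_log[OF that] by auto
    then have nz: "z \<noteq> 0" using near0_log[OF that] c by (auto simp: z_def)
    have 1: "K ** R0 w = 0" by (simp add: R0_def cscale_mult KR cscale_cscale)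
    have z1: "z * (1 / z) = 1" "(1 / z) * z = 1" using nz by simp_all
    have 2: "cscale z \<Gamma> ** R0 w = \<Gamma> ** R"
      unfolding R0_def z_def[symmetric] by (simp only: cscale_mult cscale_cscale z1)
    have "A w = D + K + cscale z \<Gamma>" by (simp add: D_def)
    then have "A w ** (R0 w + Y) = (D + K + cscale z \<Gamma>) ** (R0 w + Y)" by (simp only:)
    also have "\<dots> = D ** R0 w + (cscale z \<Gamma> ** Y + D ** Y) + (\<Gamma> ** R + K ** Y)"
      by (simp add: matrix_mult_simps 1 2)
    finally have "Er w = D ** R0 w + (cscale z \<Gamma> ** Y + D ** Y)" unfolding Er_def GRKY by simp
    then show ?thesis by (simp only: D_def z_def)
  qed
  have nn: "(0::real) \<le> 1" "(0::real) \<le> 16" by auto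
  have i1: "dominated near0 (\<lambda>w. ?D w ** R0 w) (\<lambda>w. 1 / \<bar>ln w\<bar>)"
    by (rule dominated_mono[OF dominated_bilinear[OF bmm A_near R0_bound] nn(1)]) (use near0_log in auto)
  have z: "dominated near0 (\<lambda>w. complex_of_real (c * w)) (\<lambda>w. w)"
    by (rule dominatedI[of c]) (use c near0_log(1)[THEN less_imp_le] in \<open>auto simp: norm_mult\<close>)
  have m: "w * \<bar>ln w\<bar> \<le> 16 * (1 / \<bar>ln w\<bar>)" "w \<le> 16 * (1 / \<bar>ln w\<bar>)" if "w \<in> near0" for w
  proof -
    note n = near0_log[OF that]
    have "\<bar>ln w\<bar> > 0" using n by linarith
    then show "w * \<bar>ln w\<bar> \<le> 16 * (1 / \<bar>ln w\<bar>)" "w \<le> 16 * (1 / \<bar>ln w\<bar>)"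
      using n(4,5) by (simp_all add: pos_le_divide_eq power2_eq_square mult.assoc)
  qed
  have "dominated near0 (\<lambda>w. cscale (of_real (c * w) * logL w) \<Gamma> ** Y) (\<lambda>w. w * \<bar>ln w\<bar> * 1 * 1)"
    by (intro dominated_bilinear[OF bmm] dominated_bilinear[OF bounded_bilinear_cscale]
        dominated_bilinear[OF bounded_bilinear_mult] z logL_bound dominated_const)
  then have i2: "dominated near0 (\<lambda>w. cscale (of_real (c * w) * logL w) \<Gamma> ** Y) (\<lambda>w. 1 / \<bar>ln w\<bar>)"
    by (rule dominated_mono[OF _ nn(2)]) (use m in auto)
  have i3: "dominated near0 (\<lambda>w. ?D w ** Y) (\<lambda>w. 1 / \<bar>ln w\<bar>)"
    by (rule dominated_mono[OF dominated_bilinear[OF bmm A_near dominated_const] nn(2)]) (use m in auto)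
  show ?thesis
    by (rule dominated_cong[OF e dominated_add[OF i1 dominated_add[OF i2 i3]]])
qed

lemma B_eq: "w > 0 \<Longrightarrow> B w = R0 w + Y - B w ** Er w"
proof -
  assume w: "w > 0"
  have "B w ** Er w = (B w ** A w) ** (R0 w + Y) - B w"
    by (simp only: Er_def matrix_mult_simps matrix_mul_assoc matrix_mul_rid)
  then show ?thesis by (simp only: BA[OF w] matrix_mul_lid) simp
qed

lemma X_bound: "dominated near0 (\<lambda>w. R0 w + Y) (\<lambda>w. 1 / (w * \<bar>ln w\<bar>))"
proof (rule dominated_add[OF R0_bound], rule dominated_mono[OF dominated_const, of 16])
  fix w assume "w \<in> near0"
  note n = near0_log[OF this]
  have "w * \<bar>ln w\<bar> > 0" using n by (intro mult_pos_pos) linarith+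
  then show "1 \<le> 16 * (1 / (w * \<bar>ln w\<bar>))" using n(5) by (simp add: pos_le_divide_eq)
qed simp

text \<open>In \<open>B = R0 + Y - B ** Er\<close> the last term is small relative to
  \<open>B\<close> and is absorbed into the left side.\<close>

lemma B_near: "\<exists>\<delta>>0. \<delta> \<le> exp (-2) \<and> dominated {0<..\<delta>} B (\<lambda>w. 1 / (w * \<bar>ln w\<bar>))"
proof -
  obtain k where k: "k > 0" "\<And>(a :: complex^'n^'n) (b :: complex^'n^'n). norm (a ** b) \<le> norm a * norm b * k"
    by (rule matrix_mult_norm_bound) blast
  obtain C where C: "C \<ge> 0" "\<And>w. w \<in> near0 \<Longrightarrow> norm (Er w) \<le> C * (1 / \<bar>ln w\<bar>)"
    using Er_bound unfolding dominated_def by blast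
  obtain C' where C': "C' \<ge> 0" "\<And>w. w \<in> near0 \<Longrightarrow> norm (R0 w + Y) \<le> C' * (1 / (w * \<bar>ln w\<bar>))"
    using X_bound unfolding dominated_def by blast
  \<comment> \<open>For \<open>w \<le> \<delta>\<close> one has
    \<open>\<bar>ln w\<bar> \<ge> 2 * k * C\<close>, which makes \<open>norm (B w ** Er w)\<close>
    at most half of \<open>norm (B w)\<close>.\<close>
  define \<delta> where "\<delta> = min (exp (-2)) (exp (- (2 * k * C)))"
  have "dominated {0<..\<delta>} B (\<lambda>w. 1 / (w * \<bar>ln w\<bar>))"
  proof (rule dominatedI[of "2 * C'"])
    fix w assume w: "w \<in> {0<..\<delta>}"
    then have w0: "w \<in> near0" "w > 0" by (auto simp: near0_def \<delta>_def)
    have lp: "\<bar>ln w\<bar> > 0" using near0_log[OF w0(1)] by linarith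
    have "ln w \<le> - (2 * k * C)" using w w0 ln_mono[of w "exp (- (2 * k * C))"] by (simp add: \<delta>_def)
    then have "2 * k * C \<le> \<bar>ln w\<bar>" by linarith
    then have h: "(C * (1 / \<bar>ln w\<bar>)) * k \<le> 1 / 2" using lp by (simp add: divide_le_eq mult_ac)
    have "norm (B w ** Er w) \<le> norm (B w) * (norm (Er w) * k)" using k(2)[of "B w" "Er w"] by (simp add: mult.assoc)
    also have "\<dots> \<le> norm (B w) * ((C * (1 / \<bar>ln w\<bar>)) * k)"
      using C(2)[OF w0(1)] k(1) by (intro mult_left_mono mult_right_mono) auto
    also have "\<dots> \<le> norm (B w) * (1 / 2)" using h by (intro mult_left_mono) auto
    finally have "norm (B w ** Er w) \<le> norm (B w) / 2" by simp
    moreover have "norm (B w) \<le> norm (R0 w + Y) + norm (B w ** Er w)"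
      by (subst B_eq[OF w0(2)]) (rule norm_triangle_ineq4)
    ultimately show "norm (B w) \<le> 2 * C' * (1 / (w * \<bar>ln w\<bar>))"
      using C'(2)[OF w0(1)] by linarith
  qed (use C' in simp)
  then show ?thesis by (intro exI[of _ \<delta>]) (auto simp: \<delta>_def)
qed

text \<open>Chosen once for the matrices, before a vector is fixed, so that it does not depend on
  \<open>u\<close>.\<close>

definition "\<delta> = (SOME \<delta>. \<delta> > 0 \<and> \<delta> \<le> exp (-2) \<and> dominated {0<..\<delta>} B (\<lambda>w. 1 / (w * \<bar>ln w\<bar>)))"

lemma \<delta>: "\<delta> > 0" "\<delta> \<le> exp (-2)" and B_bound: "dominated {0<..\<delta>} B (\<lambda>w. 1 / (w * \<bar>ln w\<bar>))"
  using someI_ex[of "\<lambda>\<delta>. \<delta> > 0 \<and> \<delta> \<le> exp (-2) \<and> dominated {0<..\<delta>} B (\<lambda>w. 1 / (w * \<bar>ln w\<bar>))", folded \<delta>_def] B_near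
  by blast+

lemma near0I: "w \<in> {0<..\<delta>} \<Longrightarrow> w \<in> near0"
  using \<delta> by (simp add: near0_def)

lemma B_leading: "dominated {0<..\<delta>} (\<lambda>w. B w - R0 w) (\<lambda>w. 1 / (w * \<bar>ln w\<bar>^2))"
proof (rule dominated_cong)
  show "B w - R0 w = Y - B w ** Er w" if "w \<in> {0<..\<delta>}" for w
    using B_eq[of w] that by (simp add: algebra_simps)
  have sub: "{0<..\<delta>} \<subseteq> near0" using near0I by blast
  show "dominated {0<..\<delta>} (\<lambda>w. Y - B w ** Er w) (\<lambda>w. 1 / (w * \<bar>ln w\<bar>^2))"
  proof (rule dominated_diff)
    show "dominated {0<..\<delta>} (\<lambda>w. Y) (\<lambda>w. 1 / (w * \<bar>ln w\<bar>^2))"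
    proof (rule dominated_mono[OF dominated_const, of 16])
      fix w assume "w \<in> {0<..\<delta>}"
      note n = near0_log[OF near0I[OF this]]
      have "w * \<bar>ln w\<bar>^2 > 0" using n by (intro mult_pos_pos zero_less_power) linarith+
      then show "1 \<le> 16 * (1 / (w * \<bar>ln w\<bar>^2))" using n(4) by (simp add: pos_le_divide_eq)
    qed simp
    show "dominated {0<..\<delta>} (\<lambda>w. B w ** Er w) (\<lambda>w. 1 / (w * \<bar>ln w\<bar>^2))"
      by (rule dominated_mono[OF dominated_bilinear[OF bmm B_bound dominated_subset[OF Er_bound sub]], of 1])
         (simp_all add: power2_eq_square mult_ac)
  qed
qed

lemma resolvent_identity:
  assumes "s > 0" "t > 0" shows "B s - B t = B s ** (A t - A s) ** B t"
proof -
  have "B s ** (A t - A s) ** B t = B s ** (A t ** B t) - (B s ** A s) ** B t"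
    by (simp only: matrix_mult_simps matrix_mul_assoc)
  then show ?thesis using assms by (simp add: AB BA)
qed

text \<open>At infinity \<open>A w\<close> is \<open>- w\<close> up to a bounded term, so
  \<open>w * norm (B w)\<close> is controlled by a constant and a fixed multiple of
  \<open>norm (B w)\<close>; on the remaining compact interval continuity suffices.\<close>

lemma B_bounded:
  assumes "\<eta> > 0" shows "dominated {\<eta>..} B (\<lambda>w. 1)"
proof -
  obtain k where k: "k > 0" "\<And>(a :: complex^'n^'n) (b :: complex^'n^'n). norm (a ** b) \<le> norm a * norm b * k"
    by (rule matrix_mult_norm_bound) blast
  obtain C where C: "C \<ge> 0" "\<And>w. w \<in> {1..} \<Longrightarrow> norm (A w + mat (of_real w)) \<le> C * 1"
    using A_large unfolding dominated_def by blast
  \<comment> \<open>From \<open>k * C + 1\<close> on, at least one unit of \<open>w\<close> is left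
    after the bounded part of \<open>A\<close> has been absorbed.\<close>
  define N where "N = max \<eta> (k * C + 1)"
  have N: "N \<ge> 1" "N \<ge> \<eta>" using k C by (auto simp: N_def le_max_iff_disj)
  have 1: "dominated {N..} B (\<lambda>w. 1)"
  proof (rule dominatedI[of "norm (mat 1 :: complex^'n^'n)"])
    fix w assume w: "w \<in> {N..}"
    then have w1: "w \<ge> 1" "w \<ge> k * C + 1" using N by (auto simp: N_def)
    have "B w ** mat (of_real w) = w *\<^sub>R B w"
      by (simp add: matrix_matrix_mult_def mat_def vec_eq_iff if_distrib cong: if_cong) (simp add: scaleR_conv_of_real mult.commute)
    then have "w *\<^sub>R B w = B w ** (A w + mat (of_real w)) - mat 1"
      using BA[of w] w1 by (simp add: matrix_mult_simps)
    then have "w * norm (B w) \<le> norm (B w ** (A w + mat (of_real w))) + norm (mat 1 :: complex^'n^'n)"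
      using norm_triangle_ineq4[of "B w ** (A w + mat (of_real w))" "mat 1"] w1 by (metis abs_of_nonneg norm_scaleR order_trans zero_le_one)
    also have "norm (B w ** (A w + mat (of_real w))) \<le> norm (B w) * C * k"
      using k(1) C(2)[of w] w1 by (intro order_trans[OF k(2)] mult_right_mono mult_left_mono) auto
    finally have "norm (B w) * (w - k * C) \<le> norm (mat 1 :: complex^'n^'n)" by (simp add: algebra_simps)
    moreover have "norm (B w) * 1 \<le> norm (B w) * (w - k * C)" using w1 by (intro mult_left_mono) auto
    ultimately show "norm (B w) \<le> norm (mat 1 :: complex^'n^'n) * 1" by simp
  qed simp
  have 2: "dominated {\<eta>..N} B (\<lambda>w. 1)"
  proof (rule dominated_vec, rule dominated_vec)
    fix i j
    have eq: "(B w) $ i $ j = (matrix_inv (A w) *v axis j 1) $ i" for w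
      by (simp add: B_def matrix_vector_mul_component axis_def if_distrib matrix_vector_mult_def cong: if_cong)
    have "continuous_on {\<eta>..N} (\<lambda>w. (matrix_inv (A w) *v axis j 1) $ i)"
      using assms det_A by (intro continuous_on_solution continuous_on_subset[OF cont_A]) auto
    then have "compact ((\<lambda>w. (B w) $ i $ j) ` {\<eta>..N})"
      unfolding eq by (intro compact_continuous_image) auto
    then have "bounded ((\<lambda>w. (B w) $ i $ j) ` {\<eta>..N})" by (rule compact_imp_bounded)
    then obtain a where a: "\<forall>y\<in>(\<lambda>w. (B w) $ i $ j) ` {\<eta>..N}. norm y \<le> a" unfolding bounded_iff by blast
    show "dominated {\<eta>..N} (\<lambda>w. (B w) $ i $ j) (\<lambda>w. 1)"
      by (rule dominatedI[of "max a 0"]) (use a in \<open>auto simp: le_max_iff_disj\<close>)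
  qed
  have "{\<eta>..} \<subseteq> {\<eta>..N} \<union> {N..}" by auto
  then show ?thesis by (rule dominated_subset[OF dominated_union[OF 2 1]])
qed

section \<open>The density belonging to a fixed vector\<close>

context
  fixes u :: "complex^'n"
begin

definition "y w = B w *v u"
definition "y0 w = R0 w *v u"
definition "q w = cinner (y w) (G w *v y w)"
definition "dens w = c * Re (q w)"
definition "kap = Re (cinner u (R *v u)) / c"

lemmas bc = bounded_bilinear_cinner

lemma y_bound: "dominated {0<..\<delta>} y (\<lambda>w. 1 / (w * \<bar>ln w\<bar>))"
  using dominated_bilinear[OF bmv B_bound dominated_const[of _ u]] by (simp add: y_def[abs_def])

lemma y0_bound: "dominated {0<..\<delta>} y0 (\<lambda>w. 1 / (w * \<bar>ln w\<bar>))"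
proof -
  have "dominated {0<..\<delta>} R0 (\<lambda>w. 1 / (w * \<bar>ln w\<bar>))"
    by (rule dominated_subset[OF R0_bound]) (use near0I in blast)
  from dominated_bilinear[OF bmv this dominated_const[of _ u]] show ?thesis by (simp add: y0_def[abs_def])
qed

lemma y_leading: "dominated {0<..\<delta>} (\<lambda>w. y w - y0 w) (\<lambda>w. 1 / (w * \<bar>ln w\<bar>^2))"
  using dominated_bilinear[OF bmv B_leading dominated_const[of _ u]]
  by (simp add: y_def[abs_def] y0_def[abs_def] matrix_vector_mult_diff_rdistrib)

lemma G_leading: "dominated {0<..\<delta>} (\<lambda>w. G w - w *\<^sub>R \<Gamma>) (\<lambda>w. w^2)"
  by (rule dominated_subset[OF G_near]) (use near0I in blast)

lemma G_small: "dominated {0<..\<delta>} G (\<lambda>w. w)"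
proof (rule dominated_cong)
  show "G w = (G w - w *\<^sub>R \<Gamma>) + w *\<^sub>R \<Gamma>" for w by simp
  show "dominated {0<..\<delta>} (\<lambda>w. (G w - w *\<^sub>R \<Gamma>) + w *\<^sub>R \<Gamma>) (\<lambda>w. w)"
  proof (rule dominated_add)
    show "dominated {0<..\<delta>} (\<lambda>w. G w - w *\<^sub>R \<Gamma>) (\<lambda>w. w)"
    proof (rule dominated_mono[OF G_leading, of 1])
      fix w assume "w \<in> {0<..\<delta>}"
      then have "0 < w" "w < 1" using near0_log[OF near0I] by auto
      then show "w^2 \<le> 1 * w" by (simp add: power2_eq_square)
    qed simp
    show "dominated {0<..\<delta>} (\<lambda>w. w *\<^sub>R \<Gamma>) (\<lambda>w. w)"
      by (rule dominatedI[of "norm \<Gamma>"]) auto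
  qed
qed

lemma l_pos: "w \<in> {0<..\<delta>} \<Longrightarrow> 0 < w \<and> 0 < \<bar>ln w\<bar> \<and> w * \<bar>ln w\<bar> \<le> 16 \<and> 2 \<le> \<bar>ln w\<bar>"
  using near0_log(1,3,5)[OF near0I] by force

text \<open>The form has size \<open>1 / (w * (ln w)^2)\<close>. Replacing \<open>y\<close> by
  \<open>y0\<close> in one slot gains a logarithm; replacing \<open>G w\<close> by
  \<open>w *\<^sub>R \<Gamma>\<close> gains a factor \<open>w\<close>, which is worth more since
  \<open>w * \<bar>ln w\<bar>\<close> is bounded.\<close>

lemma q_leading: "dominated {0<..\<delta>} (\<lambda>w. q w - cinner (y0 w) ((w *\<^sub>R \<Gamma>) *v y0 w)) (\<lambda>w. 1 / (w * \<bar>ln w\<bar>^3))"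
proof (rule dominated_cong)
  show "q w - cinner (y0 w) ((w *\<^sub>R \<Gamma>) *v y0 w) =
     cinner (y w - y0 w) (G w *v y w) + (cinner (y0 w) (G w *v (y w - y0 w)) + cinner (y0 w) ((G w - w *\<^sub>R \<Gamma>) *v y0 w))" for w
    by (simp add: q_def cinner_simps matrix_vector_mult_diff_rdistrib matrix_vector_mult_diff_distrib)
  show "dominated {0<..\<delta>} (\<lambda>w. cinner (y w - y0 w) (G w *v y w) + (cinner (y0 w) (G w *v (y w - y0 w)) + cinner (y0 w) ((G w - w *\<^sub>R \<Gamma>) *v y0 w))) (\<lambda>w. 1 / (w * \<bar>ln w\<bar>^3))"
  proof (intro dominated_add)
    show "dominated {0<..\<delta>} (\<lambda>w. cinner (y w - y0 w) (G w *v y w)) (\<lambda>w. 1 / (w * \<bar>ln w\<bar>^3))"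
      by (rule dominated_mono[OF dominated_bilinear[OF bc y_leading dominated_bilinear[OF bmv G_small y_bound]], of 1])
         (auto dest!: l_pos simp: power2_eq_square power3_eq_cube)
    show "dominated {0<..\<delta>} (\<lambda>w. cinner (y0 w) (G w *v (y w - y0 w))) (\<lambda>w. 1 / (w * \<bar>ln w\<bar>^3))"
      by (rule dominated_mono[OF dominated_bilinear[OF bc y0_bound dominated_bilinear[OF bmv G_small y_leading]], of 1])
         (auto dest!: l_pos simp: power2_eq_square power3_eq_cube)
    show "dominated {0<..\<delta>} (\<lambda>w. cinner (y0 w) ((G w - w *\<^sub>R \<Gamma>) *v y0 w)) (\<lambda>w. 1 / (w * \<bar>ln w\<bar>^3))"
    proof (rule dominated_mono[OF dominated_bilinear[OF bc y0_bound dominated_bilinear[OF bmv G_leading y0_bound]], of 16])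
      fix w assume "w \<in> {0<..\<delta>}"
      then have l: "0 < w" "0 < \<bar>ln w\<bar>" "w * \<bar>ln w\<bar> \<le> 16" using l_pos by auto
      have "1 / (w * \<bar>ln w\<bar>) * (w\<^sup>2 * (1 / (w * \<bar>ln w\<bar>))) = (w * \<bar>ln w\<bar>) * (1 / (w * \<bar>ln w\<bar>^3))"
        using l by (simp add: power2_eq_square power3_eq_cube)
      also have "\<dots> \<le> 16 * (1 / (w * \<bar>ln w\<bar>^3))"
        using l by (intro mult_right_mono) auto
      finally show "1 / (w * \<bar>ln w\<bar>) * (w\<^sup>2 * (1 / (w * \<bar>ln w\<bar>))) \<le> 16 * (1 / (w * \<bar>ln w\<bar>^3))" .
    qed simp
  qed
qed

text \<open>\<open>R ** \<Gamma> ** R = R\<close> collapses the form to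
  \<open>cinner u (R *v u)\<close>, and the scalar prefactors bring in the squared modulus of
  \<open>logL w\<close>. Its \<open>pi^2\<close> is discarded in \<open>dens_near\<close>, at the
  cost of two further logarithms.\<close>

lemma leading_term:
  assumes "w \<in> {0<..\<delta>}"
  shows "c * Re (cinner (y0 w) ((w *\<^sub>R \<Gamma>) *v y0 w)) = kap / (w * ((ln w)^2 + pi^2))"
proof -
  note n = near0_log[OF near0I[OF assms]]
  define z where "z = 1 / (of_real (c * w) * logL w)"
  have y0: "y0 w = z *s (R *v u)" by (simp add: y0_def R0_def z_def cscale_vector)
  have "(w *\<^sub>R \<Gamma>) *v x = complex_of_real w *s (\<Gamma> *v x)" for x
    by (simp add: matrix_vector_mult_def vec_eq_iff scaleR_sum_right sum_distrib_left) (simp add: scaleR_conv_of_real mult_ac)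
  then have "cinner (y0 w) ((w *\<^sub>R \<Gamma>) *v y0 w) = complex_of_real w * (z * cnj z) * cinner (R *v u) (\<Gamma> *v (R *v u))"
    unfolding y0 by (simp add: cinner_vscale vec.scale mult_ac)
  also have "cinner (R *v u) (\<Gamma> *v (R *v u)) = cinner u (R *v u)"
    by (simp add: cinner_adj adj_R matrix_vector_mul_assoc matrix_mul_assoc RGR)
  also have "z * cnj z = complex_of_real ((cmod z)^2)" by (simp add: complex_norm_square del: of_real_power)
  also have "complex_of_real w * complex_of_real ((cmod z)^2) * cinner u (R *v u) = complex_of_real (w * (cmod z)^2) * cinner u (R *v u)"
    by simp
  finally have "Re (cinner (y0 w) ((w *\<^sub>R \<Gamma>) *v y0 w)) = w * (cmod z)^2 * Re (cinner u (R *v u))"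
    by (simp only: times_complex.sel(1) Re_complex_of_real Im_complex_of_real mult_zero_left diff_0_right)
  moreover have "(cmod z)^2 = 1 / (c^2 * w^2 * ((ln w)^2 + pi^2))"
    using n by (simp add: z_def norm_divide norm_mult power_divide power_mult_distrib)
  ultimately show ?thesis
    using n(1) c by (simp add: kap_def power2_eq_square)
qed

lemma dens_near: "dominated {0<..\<delta>} (\<lambda>w. dens w - kap / (w * (ln w)^2)) (\<lambda>w. 1 / (w * \<bar>ln w\<bar>^3))"
proof (rule dominated_cong)
  show "dens w - kap / (w * (ln w)^2) = c * Re (q w - cinner (y0 w) ((w *\<^sub>R \<Gamma>) *v y0 w)) + (kap / (w * ((ln w)^2 + pi^2)) - kap / (w * (ln w)^2))" if "w \<in> {0<..\<delta>}" for w
    using leading_term[OF that] by (simp add: dens_def right_diff_distrib)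
  show "dominated {0<..\<delta>} (\<lambda>w. c * Re (q w - cinner (y0 w) ((w *\<^sub>R \<Gamma>) *v y0 w)) + (kap / (w * ((ln w)^2 + pi^2)) - kap / (w * (ln w)^2))) (\<lambda>w. 1 / (w * \<bar>ln w\<bar>^3))"
  proof (rule dominated_add)
    obtain C where C: "C \<ge> 0" "\<And>w. w \<in> {0<..\<delta>} \<Longrightarrow> cmod (q w - cinner (y0 w) ((w *\<^sub>R \<Gamma>) *v y0 w)) \<le> C * (1 / (w * \<bar>ln w\<bar>^3))"
      using q_leading unfolding dominated_def by blast
    show "dominated {0<..\<delta>} (\<lambda>w. c * Re (q w - cinner (y0 w) ((w *\<^sub>R \<Gamma>) *v y0 w))) (\<lambda>w. 1 / (w * \<bar>ln w\<bar>^3))"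
    proof (rule dominatedI[of "c * C"])
      fix w assume w: "w \<in> {0<..\<delta>}"
      let ?x = "q w - cinner (y0 w) ((w *\<^sub>R \<Gamma>) *v y0 w)"
      have "norm (c * Re ?x) = c * \<bar>Re ?x\<bar>" using c by (simp add: abs_mult)
      also have "\<dots> \<le> c * (C * (1 / (w * \<bar>ln w\<bar>^3)))"
        using c C(2)[OF w] abs_Re_le_cmod[of ?x] by (intro mult_left_mono) linarith+
      finally show "norm (c * Re ?x) \<le> c * C * (1 / (w * \<bar>ln w\<bar>^3))" by (simp only: mult.assoc)
    qed (use c C in simp)
    show "dominated {0<..\<delta>} (\<lambda>w. kap / (w * ((ln w)^2 + pi^2)) - kap / (w * (ln w)^2)) (\<lambda>w. 1 / (w * \<bar>ln w\<bar>^3))"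
    proof (rule dominatedI[of "\<bar>kap\<bar> * pi^2"])
      fix w assume "w \<in> {0<..\<delta>}"
      then have l: "0 < w" "0 < \<bar>ln w\<bar>" "2 \<le> \<bar>ln w\<bar>" using l_pos by auto
      define k where "k = \<bar>ln w\<bar>"
      have k: "k > 0" "k \<ge> 2" "(ln w)^2 = k^2" using l by (auto simp: k_def)
      have kp: "k^2 + pi^2 > 0" using k by (simp add: add_pos_nonneg)
      have "kap / (w * (k^2 + pi^2)) - kap / (w * k^2) = - (kap * pi^2 / (w * (k^2 * (k^2 + pi^2))))"
        using l(1) k kp by (intro divide_difference) auto
      then have "norm (kap / (w * (k^2 + pi^2)) - kap / (w * k^2)) = \<bar>kap\<bar> * pi^2 / (w * (k^2 * (k^2 + pi^2)))"
        using l k kp by (simp add: abs_mult)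
      also have "\<dots> \<le> \<bar>kap\<bar> * pi^2 / (w * k^3)"
      proof (intro divide_left_mono mult_left_mono)
        have "k * 1 \<le> k * k" using k by (intro mult_left_mono) auto
        then have "k \<le> k^2 + pi^2" by (simp add: power2_eq_square add_increasing2)
        then have "k^2 * k \<le> k^2 * (k^2 + pi^2)" using k by (intro mult_left_mono) auto
        then show "k^3 \<le> k^2 * (k^2 + pi^2)" by (simp add: power3_eq_cube power2_eq_square)
      qed (use l k kp in auto)
      finally show "norm (kap / (w * ((ln w)^2 + pi^2)) - kap / (w * (ln w)^2)) \<le> \<bar>kap\<bar> * pi^2 * (1 / (w * \<bar>ln w\<bar>^3))"
        unfolding k(3) k_def[symmetric] by simp
    qed simp
  qed
qed

lemma q_difference: "q s - q t = cinner (y s) (G s *v (y s - y t)) + (cinner (y s) ((G s - G t) *v y t) + cinner (y s - y t) (G t *v y t))"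
  by (simp add: q_def cinner_simps matrix_vector_mult_diff_rdistrib matrix_vector_mult_diff_distrib)

lemma y_difference: "s > 0 \<Longrightarrow> t > 0 \<Longrightarrow> y s - y t = B s *v (- (A s - A t) *v y t)"
  by (simp add: y_def matrix_vector_mul_assoc resolvent_identity matrix_mul_assoc flip: matrix_vector_mult_diff_rdistrib)

lemma dens_of_q:
  assumes "dominated S (\<lambda>p. q (fst p) - q (snd p)) g"
  shows "dominated S (\<lambda>p. dens (fst p) - dens (snd p)) g"
proof -
  obtain C where C: "C \<ge> 0" "\<And>p. p \<in> S \<Longrightarrow> cmod (q (fst p) - q (snd p)) \<le> C * g p"
    using assms unfolding dominated_def by blast
  show ?thesis
  proof (rule dominatedI[of "c * C"])
    fix p assume p: "p \<in> S"
    have "norm (dens (fst p) - dens (snd p)) = c * \<bar>Re (q (fst p) - q (snd p))\<bar>"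
      using c by (simp add: dens_def abs_mult flip: right_diff_distrib)
    also have "\<dots> \<le> c * (C * g p)"
      using c C(2)[OF p] abs_Re_le_cmod[of "q (fst p) - q (snd p)"] by (intro mult_left_mono) linarith+
    finally show "norm (dens (fst p) - dens (snd p)) \<le> c * C * g p" by (simp only: mult.assoc)
  qed (use c C in simp)
qed

text \<open>For \<open>s \<le> t\<close> the resolvent identity bounds \<open>y s - y t\<close> by
  the weights \<open>1 / (s * \<bar>ln s\<bar>)\<close>, \<open>(t - s) * \<bar>ln s\<bar>\<close>
  and \<open>1 / (t * \<bar>ln t\<bar>)\<close>. The logarithm lost in the Lipschitz bound of
  \<open>A\<close> cancels against the one gained in \<open>B\<close>, and \<open>near0_mono\<close>
  trades \<open>t\<close> for \<open>s\<close>.\<close>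

lemma dens_lip_near: "dominated (pairs \<delta>) (\<lambda>p. dens (fst p) - dens (snd p)) (\<lambda>p. (snd p - fst p) / ((fst p)^2 * (ln (fst p))^2))"
proof (rule dens_of_q, rule dominated_cong[OF q_difference])
  have fs: "fst p \<in> {0<..\<delta>}" "snd p \<in> {0<..\<delta>}" if "p \<in> pairs \<delta>" for p using that by (auto simp: pairs_def)
  note y1 = dominated_compose[where h = fst, OF y_bound fs(1)] and y2 = dominated_compose[where h = snd, OF y_bound fs(2)]
    and B1 = dominated_compose[where h = fst, OF B_bound fs(1)] and G1 = dominated_compose[where h = fst, OF G_small fs(1)] and G2 = dominated_compose[where h = snd, OF G_small fs(2)]
  have A1: "dominated (pairs \<delta>) (\<lambda>p. - (A (fst p) - A (snd p))) (\<lambda>p. (snd p - fst p) * \<bar>ln (fst p)\<bar>)"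
    by (rule dominated_minus, rule dominated_subset[OF A_lip_near]) (use \<delta> in \<open>auto simp: pairs_def\<close>)
  have G12: "dominated (pairs \<delta>) (\<lambda>p. G (fst p) - G (snd p)) (\<lambda>p. snd p - fst p)"
    by (rule dominated_subset[OF G_lip]) (auto simp: pairs_def)
  have lp: "0 < fst p" "0 < snd p" "0 < \<bar>ln (fst p)\<bar>" "0 < \<bar>ln (snd p)\<bar>" "fst p \<le> snd p"
    "fst p * \<bar>ln (fst p)\<bar> \<le> snd p * \<bar>ln (snd p)\<bar>" "fst p * (ln (fst p))^2 \<le> snd p * (ln (snd p))^2"
    if "p \<in> pairs \<delta>" for p
    using l_pos[OF fs(1)[OF that]] l_pos[OF fs(2)[OF that]] near0_mono[of "fst p" "snd p"] that \<delta> by (auto simp: pairs_def)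
  have y12: "dominated (pairs \<delta>) (\<lambda>p. y (fst p) - y (snd p)) (\<lambda>p. (snd p - fst p) / (fst p * (snd p * \<bar>ln (snd p)\<bar>)))"
  proof (rule dominated_cong)
    show "y (fst p) - y (snd p) = B (fst p) *v (- (A (fst p) - A (snd p)) *v y (snd p))" if "p \<in> pairs \<delta>" for p
      using lp[OF that] by (intro y_difference) auto
    show "dominated (pairs \<delta>) (\<lambda>p. B (fst p) *v (- (A (fst p) - A (snd p)) *v y (snd p))) (\<lambda>p. (snd p - fst p) / (fst p * (snd p * \<bar>ln (snd p)\<bar>)))"
    proof (rule dominated_mono[OF dominated_bilinear[OF bmv B1 dominated_bilinear[OF bmv A1 y2]], where c = 1])
      fix p assume "p \<in> pairs \<delta>"
      note l = lp[OF this]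
      show "1 / (fst p * \<bar>ln (fst p)\<bar>) * ((snd p - fst p) * \<bar>ln (fst p)\<bar> * (1 / (snd p * \<bar>ln (snd p)\<bar>)))
         \<le> 1 * ((snd p - fst p) / (fst p * (snd p * \<bar>ln (snd p)\<bar>)))" using l by simp
    qed simp_all
  qed
  have final: "(snd p - fst p) / ((fst p * \<bar>ln (fst p)\<bar>) * (snd p * \<bar>ln (snd p)\<bar>)) \<le> (snd p - fst p) / ((fst p)^2 * (ln (fst p))^2)"
    "(snd p - fst p) / (fst p * (snd p * (ln (snd p))^2)) \<le> (snd p - fst p) / ((fst p)^2 * (ln (fst p))^2)" if "p \<in> pairs \<delta>" for p
  proof -
    note l = lp[OF that]
    have e: "(fst p)^2 * (ln (fst p))^2 = (fst p * \<bar>ln (fst p)\<bar>) * (fst p * \<bar>ln (fst p)\<bar>)"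
      "(fst p)^2 * (ln (fst p))^2 = fst p * (fst p * (ln (fst p))^2)"
      by (simp_all add: power2_eq_square)
    have ne: "0 < (ln (fst p))^2" "0 < (ln (snd p))^2" using l(3,4) by auto
    show "(snd p - fst p) / ((fst p * \<bar>ln (fst p)\<bar>) * (snd p * \<bar>ln (snd p)\<bar>)) \<le> (snd p - fst p) / ((fst p)^2 * (ln (fst p))^2)"
      unfolding e(1)
      by (intro divide_left_mono mult_left_mono mult_pos_pos l(1-4,6)) (use l in \<open>auto intro: mult_nonneg_nonneg\<close>)
    show "(snd p - fst p) / (fst p * (snd p * (ln (snd p))^2)) \<le> (snd p - fst p) / ((fst p)^2 * (ln (fst p))^2)"
      unfolding e(2)
      by (intro divide_left_mono mult_left_mono mult_pos_pos l(1,2,7) ne) (use l in auto)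
  qed
  show "dominated (pairs \<delta>) (\<lambda>p. cinner (y (fst p)) (G (fst p) *v (y (fst p) - y (snd p))) + (cinner (y (fst p)) ((G (fst p) - G (snd p)) *v y (snd p)) + cinner (y (fst p) - y (snd p)) (G (snd p) *v y (snd p)))) (\<lambda>p. (snd p - fst p) / ((fst p)^2 * (ln (fst p))^2))"
  proof (intro dominated_add)
    show "dominated (pairs \<delta>) (\<lambda>p. cinner (y (fst p)) (G (fst p) *v (y (fst p) - y (snd p)))) (\<lambda>p. (snd p - fst p) / ((fst p)^2 * (ln (fst p))^2))"
    proof (rule dominated_mono[OF dominated_bilinear[OF bc y1 dominated_bilinear[OF bmv G1 y12]], where c = 1])
      fix p assume p: "p \<in> pairs \<delta>"
      have "1 / (fst p * \<bar>ln (fst p)\<bar>) * (fst p * ((snd p - fst p) / (fst p * (snd p * \<bar>ln (snd p)\<bar>)))) = (snd p - fst p) / ((fst p * \<bar>ln (fst p)\<bar>) * (snd p * \<bar>ln (snd p)\<bar>))"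
        using lp[OF p] by simp
      then show "1 / (fst p * \<bar>ln (fst p)\<bar>) * (fst p * ((snd p - fst p) / (fst p * (snd p * \<bar>ln (snd p)\<bar>)))) \<le> 1 * ((snd p - fst p) / ((fst p)^2 * (ln (fst p))^2))"
        using final(1)[OF p] by (simp only: mult_1)
    qed simp_all
    show "dominated (pairs \<delta>) (\<lambda>p. cinner (y (fst p)) ((G (fst p) - G (snd p)) *v y (snd p))) (\<lambda>p. (snd p - fst p) / ((fst p)^2 * (ln (fst p))^2))"
    proof (rule dominated_mono[OF dominated_bilinear[OF bc y1 dominated_bilinear[OF bmv G12 y2]], where c = 1])
      fix p assume p: "p \<in> pairs \<delta>"
      have "1 / (fst p * \<bar>ln (fst p)\<bar>) * ((snd p - fst p) * (1 / (snd p * \<bar>ln (snd p)\<bar>))) = (snd p - fst p) / ((fst p * \<bar>ln (fst p)\<bar>) * (snd p * \<bar>ln (snd p)\<bar>))"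
        by simp
      then show "1 / (fst p * \<bar>ln (fst p)\<bar>) * ((snd p - fst p) * (1 / (snd p * \<bar>ln (snd p)\<bar>))) \<le> 1 * ((snd p - fst p) / ((fst p)^2 * (ln (fst p))^2))"
        using final(1)[OF p] by (simp only: mult_1)
    qed simp_all
    show "dominated (pairs \<delta>) (\<lambda>p. cinner (y (fst p) - y (snd p)) (G (snd p) *v y (snd p))) (\<lambda>p. (snd p - fst p) / ((fst p)^2 * (ln (fst p))^2))"
    proof (rule dominated_mono[OF dominated_bilinear[OF bc y12 dominated_bilinear[OF bmv G2 y2]], where c = 1])
      fix p assume p: "p \<in> pairs \<delta>"
      have "(snd p - fst p) / (fst p * (snd p * \<bar>ln (snd p)\<bar>)) * (snd p * (1 / (snd p * \<bar>ln (snd p)\<bar>))) = (snd p - fst p) / (fst p * (snd p * (ln (snd p))^2))"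
        using lp[OF p] by (simp add: power2_eq_square)
      then show "(snd p - fst p) / (fst p * (snd p * \<bar>ln (snd p)\<bar>)) * (snd p * (1 / (snd p * \<bar>ln (snd p)\<bar>))) \<le> 1 * ((snd p - fst p) / ((fst p)^2 * (ln (fst p))^2))"
        using final(2)[OF p] by (simp only: mult_1)
    qed simp_all
  qed
qed

lemma dens_lip_far:
  assumes "\<eta> > 0"
  shows "dominated (far_pairs \<eta>) (\<lambda>p. dens (fst p) - dens (snd p)) (\<lambda>p. snd p - fst p)"
proof (rule dens_of_q, rule dominated_cong[OF q_difference])
  have fs: "fst p \<in> {\<eta>..}" "snd p \<in> {\<eta>..}" "fst p \<in> {0<..}" "snd p \<in> {0<..}" if "p \<in> far_pairs \<eta>" for p
    using that assms by (auto simp: far_pairs_def)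
  have yb: "dominated {\<eta>..} y (\<lambda>w. 1 * 1)"
    using dominated_bilinear[OF bmv B_bounded[OF assms] dominated_const[of _ u]] by (simp add: y_def[abs_def])
  note y1 = dominated_compose[where h = fst, OF yb fs(1)] and y2 = dominated_compose[where h = snd, OF yb fs(2)]
    and B1 = dominated_compose[where h = fst, OF B_bounded[OF assms] fs(1)]
    and G1 = dominated_compose[where h = fst, OF G_bounded fs(3)] and G2 = dominated_compose[where h = snd, OF G_bounded fs(4)]
    and A1 = dominated_minus[OF A_lip_far[OF assms]]
  have G12: "dominated (far_pairs \<eta>) (\<lambda>p. G (fst p) - G (snd p)) (\<lambda>p. snd p - fst p)"
    by (rule dominated_subset[OF G_lip]) (use assms in \<open>auto simp: far_pairs_def\<close>)
  have y12: "dominated (far_pairs \<eta>) (\<lambda>p. y (fst p) - y (snd p)) (\<lambda>p. snd p - fst p)"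
  proof (rule dominated_cong)
    show "y (fst p) - y (snd p) = B (fst p) *v (- (A (fst p) - A (snd p)) *v y (snd p))" if "p \<in> far_pairs \<eta>" for p
      using fs[OF that] by (intro y_difference) auto
    show "dominated (far_pairs \<eta>) (\<lambda>p. B (fst p) *v (- (A (fst p) - A (snd p)) *v y (snd p))) (\<lambda>p. snd p - fst p)"
      by (rule dominated_mono[OF dominated_bilinear[OF bmv B1 dominated_bilinear[OF bmv A1 y2]], where c = 1]) auto
  qed
  show "dominated (far_pairs \<eta>) (\<lambda>p. cinner (y (fst p)) (G (fst p) *v (y (fst p) - y (snd p))) + (cinner (y (fst p)) ((G (fst p) - G (snd p)) *v y (snd p)) + cinner (y (fst p) - y (snd p)) (G (snd p) *v y (snd p)))) (\<lambda>p. snd p - fst p)"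
  proof (intro dominated_add)
    show "dominated (far_pairs \<eta>) (\<lambda>p. cinner (y (fst p)) (G (fst p) *v (y (fst p) - y (snd p)))) (\<lambda>p. snd p - fst p)"
      by (rule dominated_mono[OF dominated_bilinear[OF bc y1 dominated_bilinear[OF bmv G1 y12]], where c = 1]) auto
    show "dominated (far_pairs \<eta>) (\<lambda>p. cinner (y (fst p)) ((G (fst p) - G (snd p)) *v y (snd p))) (\<lambda>p. snd p - fst p)"
      by (rule dominated_mono[OF dominated_bilinear[OF bc y1 dominated_bilinear[OF bmv G12 y2]], where c = 1]) auto
    show "dominated (far_pairs \<eta>) (\<lambda>p. cinner (y (fst p) - y (snd p)) (G (snd p) *v y (snd p))) (\<lambda>p. snd p - fst p)"
      by (rule dominated_mono[OF dominated_bilinear[OF bc y12 dominated_bilinear[OF bmv G2 y2]], where c = 1]) auto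
  qed
qed

end

end

section \<open>The boundary values of the reduced resolvent\<close>

locale friedrichs_model =
  fixes om :: "'n::finite \<Rightarrow> real" and lam :: real and v :: "'n \<Rightarrow> real \<Rightarrow> complex"
    and pp rr :: "'n \<Rightarrow> 'n \<Rightarrow> complex poly"
  assumes v_L2: "\<And>n. sq_int (v n)"
    and ff_rat: "\<And>m n x. x > 0 \<Longrightarrow>
                  cnj (v m x) * v n x = poly (pp m n) (complex_of_real x) / poly (rr m n) (complex_of_real x)"
    and ff_deg: "\<And>m n. degree (rr m n) \<ge> degree (pp m n) + 2"
    and ff_nozero: "\<And>m n x. x \<ge> 0 \<Longrightarrow> poly (rr m n) (complex_of_real x) \<noteq> 0"
    and ff_zero: "\<And>m n. poly (pp m n) 0 = 0"
    and standing: "\<And>w s. w > 0 \<Longrightarrow> s \<in> {1, -1} \<Longrightarrow>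
                    det (Kpm om lam v s w - mat (complex_of_real w)) \<noteq> 0"
    and det0: "det (Kzero om lam v) = 0"
    and Q2_z: "orth_proj (M2 om lam v) = 0"
begin

section \<open>Rational and logarithmic parts of the self energy\<close>

definition "rat m n z = poly (pp m n) z / poly (rr m n) z"

definition "P m n = (SOME P. degree P \<le> degree (rr m n) \<and>
    (\<forall>z. Im z > 0 \<longrightarrow> poly (rr m n) z * (LINT x:{0<..}|lborel. rat m n (of_real x) / (of_real x - z)) = poly P z - poly (pp m n) z * (Ln z - \<i> * pi)) \<and>
    (\<forall>w>0. ((\<lambda>e. LINT x:({0<..} - {w - e..w + e})|lborel. rat m n (of_real x) / of_real (x - w)) \<longlongrightarrow> pv (\<lambda>x. rat m n (of_real x)) w) (at_right 0) \<and>
       poly (rr m n) (of_real w) * pv (\<lambda>x. rat m n (of_real x)) w = poly P (of_real w) - poly (pp m n) (of_real w) * of_real (ln w)) \<and>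
    (poly (pp m n) 0 = 0 \<longrightarrow> poly (rr m n) 0 * (LINT x:{0<..}|lborel. rat m n (of_real x) / of_real x) = poly P 0))"

lemma P:
  "degree (P m n) \<le> degree (rr m n)"
  "Im z > 0 \<Longrightarrow> poly (rr m n) z * (LINT x:{0<..}|lborel. rat m n (of_real x) / (of_real x - z)) = poly (P m n) z - poly (pp m n) z * (Ln z - \<i> * pi)"
  "w > 0 \<Longrightarrow> ((\<lambda>e. LINT x:({0<..} - {w - e..w + e})|lborel. rat m n (of_real x) / of_real (x - w)) \<longlongrightarrow> pv (\<lambda>x. rat m n (of_real x)) w) (at_right 0)"
  "w > 0 \<Longrightarrow> poly (rr m n) (of_real w) * pv (\<lambda>x. rat m n (of_real x)) w = poly (P m n) (of_real w) - poly (pp m n) (of_real w) * of_real (ln w)"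
  "poly (rr m n) 0 * (LINT x:{0<..}|lborel. rat m n (of_real x) / of_real x) = poly (P m n) 0"
proof -
  note * = someI_ex[OF rational_stieltjes_transform[OF ff_deg[of m n] ff_nozero[of _ m n]], folded rat_def, folded P_def]
  show "degree (P m n) \<le> degree (rr m n)"
    "Im z > 0 \<Longrightarrow> poly (rr m n) z * (LINT x:{0<..}|lborel. rat m n (of_real x) / (of_real x - z)) = poly (P m n) z - poly (pp m n) z * (Ln z - \<i> * pi)"
    "w > 0 \<Longrightarrow> ((\<lambda>e. LINT x:({0<..} - {w - e..w + e})|lborel. rat m n (of_real x) / of_real (x - w)) \<longlongrightarrow> pv (\<lambda>x. rat m n (of_real x)) w) (at_right 0)"
    "w > 0 \<Longrightarrow> poly (rr m n) (of_real w) * pv (\<lambda>x. rat m n (of_real x)) w = poly (P m n) (of_real w) - poly (pp m n) (of_real w) * of_real (ln w)"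
    "poly (rr m n) 0 * (LINT x:{0<..}|lborel. rat m n (of_real x) / of_real x) = poly (P m n) 0"
    using * ff_zero[of m n] by blast+
qed

definition "pr m n z = poly (P m n) z / poly (rr m n) z"

text \<open>Closed form of \<open>K(z) - z\<close> above the axis. Written with the principal
  \<open>Ln\<close>, it continues through the positive axis into the right half-plane.\<close>

definition "Am z = K0 om - mat z - (lam^2) *\<^sub>R (\<chi> m n. pr m n z - rat m n z * (Ln z - \<i> * pi))"

lemma v_rat: "x > 0 \<Longrightarrow> cnj (v m x) * v n x = rat m n (of_real x)"
  using ff_rat by (simp add: rat_def)

lemma rat_cnj: "x > 0 \<Longrightarrow> cnj (rat m n (of_real x)) = rat n m (of_real x)"
  by (simp add: v_rat[symmetric] mult.commute)

lemma Gam_rat: "w > 0 \<Longrightarrow> Gam v w $ m $ n = rat m n (of_real w)"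
  by (simp add: Gam_def v_rat)

lemma Dmat_pv: 
  assumes "w > 0"
  shows "Dmat v w $ m $ n = pv (\<lambda>x. rat m n (of_real x)) w"
    "((\<lambda>e. LINT x:({0<..} - {w - e..w + e})|lborel. rat m n (of_real x) / of_real (x - w)) \<longlongrightarrow> Dmat v w $ m $ n) (at_right 0)"
    "Dmat v w $ m $ n = pr m n (of_real w) - rat m n (of_real w) * of_real (ln w)"
proof -
  have "(LINT x:({0<..} - {w - e..w + e})|lborel. cnj (v m x) * v n x / complex_of_real (x - w)) =
     (LINT x:({0<..} - {w - e..w + e})|lborel. rat m n (of_real x) / complex_of_real (x - w))" for e
    by (rule set_lebesgue_integral_cong) (simp_all add: v_rat)
  then show 1: "Dmat v w $ m $ n = pv (\<lambda>x. rat m n (of_real x)) w"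
    by (simp only: Dmat_def pv_def vec_lambda_beta)
  show "((\<lambda>e. LINT x:({0<..} - {w - e..w + e})|lborel. rat m n (of_real x) / of_real (x - w)) \<longlongrightarrow> Dmat v w $ m $ n) (at_right 0)"
    unfolding 1 using P(3)[OF assms] .
  show "Dmat v w $ m $ n = pr m n (of_real w) - rat m n (of_real w) * of_real (ln w)"
    unfolding 1 pr_def rat_def[of m n "of_real w"] using P(4)[OF assms, of m n] ff_nozero[of w m n] assms
    by (simp add: divide_simps mult.commute)
qed

text \<open>Each truncated integral is Hermitian in \<open>m\<close> and \<open>n\<close>, and the
  symmetry survives the limit.\<close>

lemma Dmat_cnj:
  assumes "w > 0"
  shows "cnj (Dmat v w $ m $ n) = Dmat v w $ n $ m"
proof (rule tendsto_unique)
  show "((\<lambda>e. LINT x:({0<..} - {w - e..w + e})|lborel. rat n m (of_real x) / of_real (x - w)) \<longlongrightarrow> Dmat v w $ n $ m) (at_right 0)"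
    by (rule Dmat_pv(2)[OF assms])
  have "cnj (LINT x:({0<..} - {w - e..w + e})|lborel. rat m n (of_real x) / of_real (x - w)) =
    (LINT x:({0<..} - {w - e..w + e})|lborel. rat n m (of_real x) / of_real (x - w))" for e
    unfolding set_lebesgue_integral_def Bochner_Integration.integral_cnj[symmetric]
    by (intro Bochner_Integration.integral_cong) (auto simp: rat_cnj indicator_def)
  then show "((\<lambda>e. LINT x:({0<..} - {w - e..w + e})|lborel. rat n m (of_real x) / of_real (x - w)) \<longlongrightarrow> cnj (Dmat v w $ m $ n)) (at_right 0)"
    using tendsto_cnj[OF Dmat_pv(2)[OF assms, of m n]] by simp
qed simp

text \<open>The \<open>- \<i> * pi\<close> next to the logarithm becomes the imaginary term of the
  upper boundary value, so the standing assumption turns into invertibility of \<open>Am\<close> on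
  the axis.\<close>

lemma Kpm_Am:
  assumes "w > 0"
  shows "Kpm om lam v 1 w - mat (of_real w) = Am (of_real w)"
proof -
  have "Ln (complex_of_real w) = of_real (ln w)" using assms by (simp add: Ln_of_real)
  then show ?thesis
    by (simp add: vec_eq_iff Kpm_def Am_def cscale_def Dmat_pv(3)[OF assms] Gam_rat[OF assms])
       (simp add: scaleR_conv_of_real algebra_simps)
qed

lemma det_Am: "w > 0 \<Longrightarrow> det (Am (of_real w)) \<noteq> 0"
  using standing[of w 1] Kpm_Am[of w] by simp

lemma S0_pr: "S0 v $ m $ n = pr m n 0"
proof -
  have "S0 v $ m $ n = (LINT x:{0<..}|lborel. rat m n (of_real x) / complex_of_real x)"
    unfolding S0_def vec_lambda_beta by (rule set_lebesgue_integral_cong) (simp_all add: v_rat)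
  then show ?thesis using P(5)[of m n] ff_nozero[of 0 m n] by (simp add: pr_def field_simps)
qed

lemma S0_cnj: "cnj (S0 v $ m $ n) = S0 v $ n $ m"
  unfolding S0_def vec_lambda_beta set_lebesgue_integral_def Bochner_Integration.integral_cnj[symmetric]
  by (intro Bochner_Integration.integral_cong) (auto simp: indicator_def mult.commute)

lemma Kzero_adj: "mat_adj (Kzero om lam v) = Kzero om lam v"
  by (simp add: vec_eq_iff mat_adj_def Kzero_def K0_def S0_cnj)

definition "pq m n = (SOME q. pp m n = [:0, 1:] * q)"

lemma pp_factor: "pp m n = [:0, 1:] * pq m n"
proof -
  have "[:- 0, 1:] dvd pp m n" using ff_zero[of m n] by (simp only: poly_eq_0_iff_dvd[symmetric])
  then have "\<exists>q. pp m n = [:0, 1:] * q" unfolding dvd_def by simp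
  then show ?thesis unfolding pq_def by (rule someI_ex)
qed

lemma Gam1_entry: "Gam1 pp rr $ m $ n = poly (pq m n) 0 / poly (rr m n) 0"
proof -
  have nz: "poly (rr m n) 0 \<noteq> 0" using ff_nozero[of 0 m n] by simp
  have "((\<lambda>z. poly (pp m n) z / poly (rr m n) z) has_field_derivative
      (poly (pderiv (pp m n)) 0 * poly (rr m n) 0 - poly (pp m n) 0 * poly (pderiv (rr m n)) 0) / (poly (rr m n) 0 * poly (rr m n) 0)) (at 0)"
    using nz by (intro DERIV_divide poly_DERIV)
  then have "Gam1 pp rr $ m $ n = poly (pderiv (pp m n)) 0 / poly (rr m n) 0"
    using nz ff_zero[of m n] by (simp add: Gam1_def DERIV_imp_deriv)
  moreover have "poly (pderiv (pp m n)) 0 = poly (pq m n) 0"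
    by (subst pp_factor) (simp add: pderiv_mult pderiv_pCons)
  ultimately show ?thesis by simp
qed

text \<open>Positivity of \<open>Gam\<close>. Up to the factor \<open>lam^2 / w^2\<close> the right
  side is the squared modulus of \<open>fpsi\<close>, which ties the form of \<open>Gam1\<close> to
  the space \<open>M2\<close>.\<close>

lemma fpsi_sq:
  assumes "w > 0"
  shows "cinner x (Gam v w *v x) = complex_of_real ((cmod (\<Sum>n\<in>UNIV. x$n * v n w))^2)"
proof -
  have "complex_of_real ((cmod (\<Sum>n\<in>UNIV. x$n * v n w))^2) = (\<Sum>n\<in>UNIV. x$n * v n w) * cnj (\<Sum>n\<in>UNIV. x$n * v n w)"
    by (simp add: complex_norm_square del: of_real_power)
  also have "\<dots> = (\<Sum>m\<in>UNIV. cnj (x$m) * cnj (v m w)) * (\<Sum>n\<in>UNIV. x$n * v n w)"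
    by (simp add: mult.commute)
  also have "\<dots> = (\<Sum>m\<in>UNIV. \<Sum>n\<in>UNIV. cnj (x$m) * (cnj (v m w) * v n w * x$n))"
    unfolding sum_product by (intro sum.cong refl) (simp add: mult_ac)
  also have "\<dots> = cinner x (Gam v w *v x)"
    by (simp add: cinner_def matrix_vector_mult_def Gam_def sum_distrib_left)
  finally show ?thesis by simp
qed

section \<open>Growth and Lipschitz bounds for the boundary values\<close>

lemma dominated_rat:
  assumes "degree p \<le> degree (rr m n)"
  shows "dominated {0<..} (\<lambda>w. poly p (of_real w) / poly (rr m n) (of_real w)) (\<lambda>w. 1)"
    "dominated {p. 0 \<le> fst p \<and> fst p \<le> snd p} (\<lambda>z. poly p (of_real (fst z)) / poly (rr m n) (of_real (fst z)) - poly p (of_real (snd z)) / poly (rr m n) (of_real (snd z))) (\<lambda>p. snd p - fst p)"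
proof -
  obtain C where "C \<ge> 0" "\<forall>x\<ge>0. cmod (poly p (of_real x) / poly (rr m n) (of_real x)) \<le> C"
    using rational_bounded[OF assms ff_nozero] by blast
  then show "dominated {0<..} (\<lambda>w. poly p (of_real w) / poly (rr m n) (of_real w)) (\<lambda>w. 1)"
    by (intro dominatedI[of C]) auto
  obtain C where C: "C \<ge> 0" "\<forall>s\<ge>0. \<forall>t\<ge>0. cmod (poly p (of_real s) / poly (rr m n) (of_real s) - poly p (of_real t) / poly (rr m n) (of_real t)) \<le> C * \<bar>s - t\<bar>"
    using rational_lipschitz[OF assms ff_nozero] by blast
  show "dominated {p. 0 \<le> fst p \<and> fst p \<le> snd p} (\<lambda>z. poly p (of_real (fst z)) / poly (rr m n) (of_real (fst z)) - poly p (of_real (snd z)) / poly (rr m n) (of_real (snd z))) (\<lambda>p. snd p - fst p)"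
  proof (rule dominatedI[OF C(1)])
    fix z :: "real \<times> real" assume z: "z \<in> {p. 0 \<le> fst p \<and> fst p \<le> snd p}"
    then have "0 \<le> fst z" "0 \<le> snd z" "\<bar>fst z - snd z\<bar> = snd z - fst z" by auto
    then show "cmod (poly p (of_real (fst z)) / poly (rr m n) (of_real (fst z)) - poly p (of_real (snd z)) / poly (rr m n) (of_real (snd z))) \<le> C * (snd z - fst z)"
      using C(2) by metis
  qed
qed

lemma deg_le: "degree (pp m n) \<le> degree (rr m n)" "degree (pq m n) \<le> degree (rr m n)" "degree ([:1, 1:] * pp m n) \<le> degree (rr m n)"
proof -
  show "degree (pp m n) \<le> degree (rr m n)" using ff_deg[of m n] by simp
  show "degree (pq m n) \<le> degree (rr m n)"
  proof (cases "pq m n = 0")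
    case False
    then have "degree (pp m n) = 1 + degree (pq m n)" by (subst pp_factor, subst degree_mult_eq) auto
    then show ?thesis using ff_deg[of m n] by simp
  qed simp
  show "degree ([:1, 1:] * pp m n) \<le> degree (rr m n)"
    using degree_mult_le[of "[:1, 1:]" "pp m n"] ff_deg[of m n] by simp
qed

lemmas rat_bounded = dominated_rat(1)[OF deg_le(1), folded rat_def]
  and rat_lip = dominated_rat(2)[OF deg_le(1), folded rat_def]
  and pr_bounded = dominated_rat(1)[OF P(1), folded pr_def]
  and pr_lip = dominated_rat(2)[OF P(1), folded pr_def]

text \<open>Once the zero at the origin is split off, the cofactor is Lipschitz, so its deviation
  from its value at 0 supplies the second factor \<open>w\<close>.\<close>

lemma rat_near: "dominated near0 (\<lambda>w. rat m n (of_real w) - of_real w * Gam1 pp rr $ m $ n) (\<lambda>w. w^2)"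
proof -
  have "dominated {0<..} (\<lambda>w. poly (pq m n) (of_real 0) / poly (rr m n) (of_real 0) - poly (pq m n) (of_real w) / poly (rr m n) (of_real w)) (\<lambda>w. w - 0)"
    using dominated_compose[OF dominated_rat(2)[OF deg_le(2), of m n], of "{0<..}" "\<lambda>w. (0, w)"] by simp
  then have 1: "dominated near0 (\<lambda>w. - (poly (pq m n) (of_real 0) / poly (rr m n) (of_real 0) - poly (pq m n) (of_real w) / poly (rr m n) (of_real w))) (\<lambda>w. w)"
    by (intro dominated_minus) (auto intro: dominated_subset simp: near0_def)
  have 2: "dominated near0 (\<lambda>w. complex_of_real w) (\<lambda>w. w)"
    by (rule dominatedI[of 1]) (use near0_log(1)[THEN less_imp_le] in auto)
  show ?thesis
    by (rule dominated_cong[OF _ dominated_mono[OF dominated_bilinear[OF bounded_bilinear_mult 2 1], of 1]])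
       (auto simp: rat_def pp_factor[of m n] Gam1_entry power2_eq_square algebra_simps)
qed

lemma rat_small: "dominated near0 (\<lambda>w. rat m n (of_real w)) (\<lambda>w. w)"
proof (rule dominated_cong)
  show "rat m n (of_real w) = (rat m n (of_real w) - of_real w * Gam1 pp rr $ m $ n) + of_real w * Gam1 pp rr $ m $ n" for w by simp
  show "dominated near0 (\<lambda>w. (rat m n (of_real w) - of_real w * Gam1 pp rr $ m $ n) + of_real w * Gam1 pp rr $ m $ n) (\<lambda>w. w)"
  proof (rule dominated_add)
    show "dominated near0 (\<lambda>w. rat m n (of_real w) - of_real w * Gam1 pp rr $ m $ n) (\<lambda>w. w)"
      by (rule dominated_mono[OF rat_near, of 1]) (use near0_log(1,2) less_imp_le in \<open>auto simp: power2_eq_square mult_left_le\<close>)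
    show "dominated near0 (\<lambda>w. of_real w * Gam1 pp rr $ m $ n) (\<lambda>w. w)"
      by (rule dominatedI[of "cmod (Gam1 pp rr $ m $ n)"]) (use near0_log(1)[THEN less_imp_le] in \<open>auto simp: norm_mult\<close>)
  qed
qed

lemma Gam_near: "dominated near0 (\<lambda>w. Gam v w - w *\<^sub>R Gam1 pp rr) (\<lambda>w. w^2)"
proof (rule dominated_vec, rule dominated_vec)
  show "dominated near0 (\<lambda>w. (Gam v w - w *\<^sub>R Gam1 pp rr) $ m $ n) (\<lambda>w. w^2)" for m n
    by (rule dominated_cong[OF _ rat_near]) (use near0_log(1) in \<open>simp add: Gam_rat scaleR_conv_of_real[of _ "_ :: complex"]\<close>)
qed

lemma Gam_lip: "dominated {p. 0 < fst p \<and> fst p \<le> snd p} (\<lambda>p. Gam v (fst p) - Gam v (snd p)) (\<lambda>p. snd p - fst p)"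
proof (rule dominated_vec, rule dominated_vec)
  show "dominated {p. 0 < fst p \<and> fst p \<le> snd p} (\<lambda>p. (Gam v (fst p) - Gam v (snd p)) $ m $ n) (\<lambda>p. snd p - fst p)" for m n
    by (rule dominated_cong[OF _ dominated_subset[OF rat_lip]]) (auto simp: Gam_rat)
qed

lemma Gam_bounded: "dominated {0<..} (Gam v) (\<lambda>w. 1)"
proof (rule dominated_vec, rule dominated_vec)
  show "dominated {0<..} (\<lambda>w. Gam v w $ m $ n) (\<lambda>w. 1)" for m n
    by (rule dominated_cong[OF _ rat_bounded]) (auto simp: Gam_rat)
qed

lemma Am_entry: "w > 0 \<Longrightarrow> Am (of_real w) $ m $ n = (if m = n then of_real (om m) - of_real w else 0) - of_real (lam^2) * (pr m n (of_real w) - rat m n (of_real w) * logL w)"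
  by (simp add: Am_def K0_def mat_def logL_def Ln_of_real) (simp add: scaleR_conv_of_real)

text \<open>\<open>pr m n 0\<close> is the entry of \<open>S0 v\<close>, so \<open>Kzero\<close> is
  the constant term. The remainder of \<open>rat\<close> is quadratic and still of order
  \<open>w\<close> after multiplication by the logarithm.\<close>

lemma Am_near: "dominated near0 (\<lambda>w. Am (of_real w) - Kzero om lam v - cscale (of_real (lam^2 * w) * logL w) (Gam1 pp rr)) (\<lambda>w. w)"
proof (rule dominated_vec, rule dominated_vec)
  fix m n :: 'n
  have L: "dominated near0 logL (\<lambda>w. \<bar>ln w\<bar>)"
    by (rule dominatedI[of 3]) (auto simp: near0_log)
  have w: "dominated near0 (\<lambda>w. if m = n then complex_of_real w else 0) (\<lambda>w. w)"
    by (rule dominatedI[of 1]) (use near0_log(1)[THEN less_imp_le] in auto)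
  have "dominated {0<..} (\<lambda>w. pr m n (of_real 0) - pr m n (of_real w)) (\<lambda>w. w - 0)"
    using dominated_compose[OF pr_lip[of m n], of "{0<..}" "\<lambda>w. (0, w)"] by simp
  then have p: "dominated near0 (\<lambda>w. pr m n 0 - pr m n (of_real w)) (\<lambda>w. w)"
    by (auto intro: dominated_subset simp: near0_def)
  have r: "dominated near0 (\<lambda>w. (rat m n (of_real w) - of_real w * Gam1 pp rr $ m $ n) * logL w) (\<lambda>w. w)"
  proof (rule dominated_mono[OF dominated_bilinear[OF bounded_bilinear_mult rat_near L], of 16])
    fix x assume "x \<in> near0"
    note n = near0_log[OF this]
    show "x^2 * \<bar>ln x\<bar> \<le> 16 * x" using mult_left_mono[OF n(5), of x] n(1) by (simp add: power2_eq_square mult_ac)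
  qed simp
  have "dominated near0 (\<lambda>w. - (if m = n then complex_of_real w else 0) + complex_of_real (lam^2) * ((pr m n 0 - pr m n (of_real w)) + (rat m n (of_real w) - of_real w * Gam1 pp rr $ m $ n) * logL w)) (\<lambda>w. 1 * w)"
    by (intro dominated_add dominated_minus dominated_bilinear[OF bounded_bilinear_mult] dominated_const) (use w p r in \<open>simp_all add: dominated_add\<close>)
  then have "dominated near0 (\<lambda>w. - (if m = n then complex_of_real w else 0) + complex_of_real (lam^2) * ((pr m n 0 - pr m n (of_real w)) + (rat m n (of_real w) - of_real w * Gam1 pp rr $ m $ n) * logL w)) (\<lambda>w. w)"
    by simp
  then show "dominated near0 (\<lambda>w. (Am (of_real w) - Kzero om lam v - cscale (of_real (lam^2 * w) * logL w) (Gam1 pp rr)) $ m $ n) (\<lambda>w. w)"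
  proof (rule dominated_cong[rotated])
    fix w assume "w \<in> near0"
    from near0_log(1)[OF this]
    show "(Am (of_real w) - Kzero om lam v - cscale (of_real (lam^2 * w) * logL w) (Gam1 pp rr)) $ m $ n =
       - (if m = n then complex_of_real w else 0) + complex_of_real (lam^2) * ((pr m n 0 - pr m n (of_real w)) + (rat m n (of_real w) - of_real w * Gam1 pp rr $ m $ n) * logL w)"
      by (simp add: Am_entry Kzero_def K0_def S0_pr cscale_def) (simp add: scaleR_conv_of_real algebra_simps)
  qed
qed

lemma ln_lip: "0 < s \<Longrightarrow> s \<le> t \<Longrightarrow> cmod (logL s - logL t) \<le> (t - s) / s"
proof -
  assume st: "0 < s" "s \<le> t"
  have "cmod (logL s - logL t) = ln t - ln s"
    using st ln_mono[of s t] by (simp add: logL_def flip: of_real_diff)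
  also have "\<dots> \<le> (t - s) / s" using st by (intro ln_diff_le) auto
  finally show ?thesis .
qed

lemma Am_difference:
  assumes "0 < s" "0 < t"
  shows "(Am (of_real s) - Am (of_real t)) $ m $ n = (if m = n then complex_of_real (t - s) else 0)
    - of_real (lam^2) * ((pr m n (of_real s) - pr m n (of_real t)) - (rat m n (of_real s) * logL s - rat m n (of_real t) * logL t))"
  using assms by (simp add: Am_entry algebra_simps)

text \<open>The diagonal and \<open>pr\<close> are Lipschitz on the whole half-line; the product of
  \<open>rat\<close> with the logarithm is what distinguishes the regime near 0 from the one far
  away.\<close>

lemma Am_lip:
  assumes S: "\<And>p. p \<in> S \<Longrightarrow> 0 < fst p \<and> fst p \<le> snd p"
    and g: "c0 \<ge> 0" "\<And>p. p \<in> S \<Longrightarrow> snd p - fst p \<le> c0 * g p"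
    and r: "\<And>m n. dominated S (\<lambda>p. rat m n (of_real (fst p)) * logL (fst p) - rat m n (of_real (snd p)) * logL (snd p)) g"
  shows "dominated S (\<lambda>p. Am (of_real (fst p)) - Am (of_real (snd p))) g"
proof (rule dominated_vec, rule dominated_vec)
  fix m n :: 'n
  have d: "dominated S (\<lambda>p. if m = n then complex_of_real (snd p - fst p) else 0) g"
  proof (rule dominated_mono[OF _ g])
    show "dominated S (\<lambda>p. if m = n then complex_of_real (snd p - fst p) else 0) (\<lambda>p. snd p - fst p)"
    proof (rule dominatedI[of 1])
      fix p assume "p \<in> S"
      then have "norm (complex_of_real (snd p - fst p)) = snd p - fst p" using S by (simp only: norm_of_real) force
      then show "norm (if m = n then complex_of_real (snd p - fst p) else 0) \<le> 1 * (snd p - fst p)"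
        using S[OF \<open>p \<in> S\<close>] by auto
    qed simp
  qed
  have "dominated S (\<lambda>p. pr m n (of_real (fst p)) - pr m n (of_real (snd p))) (\<lambda>p. snd p - fst p)"
    by (rule dominated_subset[OF pr_lip]) (use S in force)
  then have p: "dominated S (\<lambda>p. pr m n (of_real (fst p)) - pr m n (of_real (snd p))) g"
    by (rule dominated_mono[OF _ g])
  have "dominated S (\<lambda>p. of_real (lam^2) * ((pr m n (of_real (fst p)) - pr m n (of_real (snd p))) - (rat m n (of_real (fst p)) * logL (fst p) - rat m n (of_real (snd p)) * logL (snd p)))) (\<lambda>p. 1 * g p)"
    by (intro dominated_bilinear[OF bounded_bilinear_mult dominated_const] dominated_diff p r)
  then have q: "dominated S (\<lambda>p. of_real (lam^2) * ((pr m n (of_real (fst p)) - pr m n (of_real (snd p))) - (rat m n (of_real (fst p)) * logL (fst p) - rat m n (of_real (snd p)) * logL (snd p)))) g"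
    by simp
  show "dominated S (\<lambda>p. (Am (of_real (fst p)) - Am (of_real (snd p))) $ m $ n) g"
    by (rule dominated_cong[OF Am_difference dominated_diff[OF d q]]) (use S in force)+
qed

text \<open>In the product rule \<open>rat\<close>, of order \<open>s\<close>, meets the Lipschitz
  constant \<open>1 / s\<close> of the logarithm and cancels it; the loss of one factor
  \<open>\<bar>ln s\<bar>\<close> comes from the other term.\<close>

lemma Am_lip_near: "dominated (pairs (exp (-2))) (\<lambda>p. Am (of_real (fst p)) - Am (of_real (snd p))) (\<lambda>p. (snd p - fst p) * \<bar>ln (fst p)\<bar>)"
proof (rule Am_lip[of _ 1])
  have mem: "fst p \<in> near0" "snd p \<in> near0" "0 < fst p" "fst p \<le> snd p" if "p \<in> pairs (exp (-2))" for p
    using that by (auto simp: pairs_def near0_def)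
  show "0 < fst p \<and> fst p \<le> snd p" if "p \<in> pairs (exp (-2))" for p using mem that by auto
  show "snd p - fst p \<le> 1 * ((snd p - fst p) * \<bar>ln (fst p)\<bar>)" if "p \<in> pairs (exp (-2))" for p
    using mult_left_mono[of 1 "\<bar>ln (fst p)\<bar>" "snd p - fst p"] near0_log(3)[OF mem(1)[OF that]] mem[OF that] by simp
  fix m n
  have L: "dominated (pairs (exp (-2))) (\<lambda>p. logL (snd p)) (\<lambda>p. \<bar>ln (fst p)\<bar>)"
  proof (rule dominatedI[of 3])
    fix p assume p: "p \<in> pairs (exp (-2))"
    have "\<bar>ln (snd p)\<bar> \<le> \<bar>ln (fst p)\<bar>"
      using ln_mono[of "fst p" "snd p"] mem[OF p] ln_less_zero[of "snd p"] near0_log(1,2)[OF mem(2)[OF p]] by linarith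
    then show "norm (logL (snd p)) \<le> 3 * \<bar>ln (fst p)\<bar>"
      using near0_log(7)[OF mem(2)[OF p]] by linarith
  qed simp
  have r1: "dominated (pairs (exp (-2))) (\<lambda>p. rat m n (of_real (fst p)) - rat m n (of_real (snd p))) (\<lambda>p. snd p - fst p)"
    by (rule dominated_subset[OF rat_lip]) (auto simp: pairs_def)
  have r2: "dominated (pairs (exp (-2))) (\<lambda>p. rat m n (of_real (fst p))) (\<lambda>p. fst p)"
    by (rule dominated_compose[OF rat_small]) (rule mem)
  have l2: "dominated (pairs (exp (-2))) (\<lambda>p. logL (fst p) - logL (snd p)) (\<lambda>p. (snd p - fst p) / fst p)"
    by (rule dominatedI[of 1]) (use ln_lip mem in auto)
  show "dominated (pairs (exp (-2))) (\<lambda>p. rat m n (of_real (fst p)) * logL (fst p) - rat m n (of_real (snd p)) * logL (snd p)) (\<lambda>p. (snd p - fst p) * \<bar>ln (fst p)\<bar>)"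
  proof (rule dominated_cong)
    show "rat m n (of_real (fst p)) * logL (fst p) - rat m n (of_real (snd p)) * logL (snd p) =
       (rat m n (of_real (fst p)) - rat m n (of_real (snd p))) * logL (snd p) + rat m n (of_real (fst p)) * (logL (fst p) - logL (snd p))" for p
      by (simp add: algebra_simps)
    show "dominated (pairs (exp (-2))) (\<lambda>p. (rat m n (of_real (fst p)) - rat m n (of_real (snd p))) * logL (snd p) + rat m n (of_real (fst p)) * (logL (fst p) - logL (snd p))) (\<lambda>p. (snd p - fst p) * \<bar>ln (fst p)\<bar>)"
    proof (rule dominated_add[OF dominated_bilinear[OF bounded_bilinear_mult r1 L]])
      show "dominated (pairs (exp (-2))) (\<lambda>p. rat m n (of_real (fst p)) * (logL (fst p) - logL (snd p))) (\<lambda>p. (snd p - fst p) * \<bar>ln (fst p)\<bar>)"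
      proof (rule dominated_mono[OF dominated_bilinear[OF bounded_bilinear_mult r2 l2], where c = 1])
        fix p assume p: "p \<in> pairs (exp (-2))"
        show "fst p * ((snd p - fst p) / fst p) \<le> 1 * ((snd p - fst p) * \<bar>ln (fst p)\<bar>)"
          using mult_left_mono[of 1 "\<bar>ln (fst p)\<bar>" "snd p - fst p"] near0_log(3)[OF mem(1)[OF p]] mem[OF p] by simp
      qed simp
    qed
  qed
qed simp

lemma logL_growth: 
  assumes "\<eta> > 0" shows "dominated {\<eta>..} (\<lambda>s. logL s / of_real (1 + s)) (\<lambda>s. 1)"
proof (rule dominatedI[of "1 + 1 / \<eta> + 4"])
  fix s assume s: "s \<in> {\<eta>..}"
  then have sp: "s > 0" "1 / s \<le> 1 / \<eta>" using assms by (auto intro: divide_left_mono)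
  \<comment> \<open>The same inequality at \<open>s\<close> and at \<open>1 / s\<close> gives
    \<open>\<bar>ln s\<bar> \<le> s + 1 / \<eta>\<close>; the 4 in the constant stands for
    \<open>pi\<close>.\<close>
  have "ln s \<le> s - 1" "ln (1 / s) \<le> 1 / s - 1" using sp by (auto intro!: ln_le_minus_one)
  moreover have "ln (1 / s) = - ln s" "0 < 1 / \<eta>" using sp assms by (simp_all add: ln_div)
  ultimately have "ln s \<le> s + 1 / \<eta>" "- ln s \<le> s + 1 / \<eta>" using sp by linarith+
  then have "\<bar>ln s\<bar> \<le> s + 1 / \<eta>" by (rule abs_leI)
  moreover have "cmod (logL s) \<le> \<bar>ln s\<bar> + pi"
    unfolding logL_def using norm_triangle_ineq4[of "complex_of_real (ln s)" "\<i> * pi"] by (simp add: norm_mult)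
  moreover have "(1 + 1 / \<eta> + 4) * (1 + s) = s + 1 / \<eta> + 4 + (1 + 1 / \<eta> * s + 4 * s)" by (simp add: algebra_simps add_divide_distrib)
  moreover have "1 / \<eta> * s \<ge> 0" using sp assms by simp
  ultimately have "cmod (logL s) \<le> (1 + 1 / \<eta> + 4) * (1 + s)" using pi_less_4 sp by linarith
  then show "norm (logL s / of_real (1 + s)) \<le> (1 + 1 / \<eta> + 4) * 1"
    using sp by (simp only: norm_divide norm_of_real) (simp add: pos_divide_le_eq)
qed (use assms in simp)

text \<open>The degree gap of 2 lets \<open>rat\<close> carry an extra factor \<open>1 + z\<close>
  and remain bounded and Lipschitz. That factor compensates the growth of the logarithm at
  infinity.\<close>

definition "hr m n z = poly ([:1, 1:] * pp m n) z / poly (rr m n) z"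
lemmas hr_bounded = dominated_rat(1)[OF deg_le(3), folded hr_def]
  and hr_lip = dominated_rat(2)[OF deg_le(3), folded hr_def]

lemma hr_rat: "hr m n z = (1 + z) * rat m n z"
  by (simp add: hr_def rat_def algebra_simps add_divide_distrib)

text \<open>A difference of \<open>rat\<close> is multiplied by an unbounded logarithm. Moving a
  factor \<open>1 + s\<close> from one to the other makes both controllable: \<open>(1 + s)\<close>
  times the difference is a difference of \<open>hr\<close> plus a bounded multiple of
  \<open>t - s\<close>.\<close>

lemma Am_lip_far:
  assumes \<eta>: "\<eta> > 0"
  shows "dominated (far_pairs \<eta>) (\<lambda>p. Am (of_real (fst p)) - Am (of_real (snd p))) (\<lambda>p. snd p - fst p)"
proof (rule Am_lip[of _ 1])
  have mem: "fst p \<in> {\<eta>..}" "0 < fst p" "fst p \<le> snd p" "snd p \<in> {0<..}" if "p \<in> far_pairs \<eta>" for p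
    using that \<eta> by (auto simp: far_pairs_def)
  show "0 < fst p \<and> fst p \<le> snd p" if "p \<in> far_pairs \<eta>" for p using mem that by auto
  fix m n
  have L: "dominated (far_pairs \<eta>) (\<lambda>p. logL (fst p) / of_real (1 + fst p)) (\<lambda>p. 1)"
    by (rule dominated_compose[OF logL_growth[OF \<eta>]]) (rule mem)
  have h: "dominated (far_pairs \<eta>) (\<lambda>p. hr m n (of_real (fst p)) - hr m n (of_real (snd p))) (\<lambda>p. snd p - fst p)"
    by (rule dominated_subset[OF hr_lip]) (use \<eta> in \<open>auto simp: far_pairs_def\<close>)
  have r2: "dominated (far_pairs \<eta>) (\<lambda>p. rat m n (of_real (snd p))) (\<lambda>p. 1)"
    by (rule dominated_compose[OF rat_bounded]) (rule mem)
  have d: "dominated (far_pairs \<eta>) (\<lambda>p. complex_of_real (snd p - fst p)) (\<lambda>p. snd p - fst p)"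
  proof (rule dominatedI[of 1])
    fix p assume "p \<in> far_pairs \<eta>"
    then show "norm (complex_of_real (snd p - fst p)) \<le> 1 * (snd p - fst p)"
      using mem by (simp only: norm_of_real) force
  qed simp
  have l2: "dominated (far_pairs \<eta>) (\<lambda>p. logL (fst p) - logL (snd p)) (\<lambda>p. snd p - fst p)"
  proof (rule dominatedI[of "1 / \<eta>"])
    fix p assume p: "p \<in> far_pairs \<eta>"
    have "norm (logL (fst p) - logL (snd p)) \<le> (snd p - fst p) / fst p" using ln_lip mem[OF p] by auto
    also have "\<dots> \<le> (snd p - fst p) / \<eta>" using mem[OF p] \<eta> by (intro divide_left_mono) auto
    finally show "norm (logL (fst p) - logL (snd p)) \<le> 1 / \<eta> * (snd p - fst p)" by simp
  qed (use \<eta> in simp)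
  show "dominated (far_pairs \<eta>) (\<lambda>p. rat m n (of_real (fst p)) * logL (fst p) - rat m n (of_real (snd p)) * logL (snd p)) (\<lambda>p. snd p - fst p)"
  proof (rule dominated_cong)
    fix p assume "p \<in> far_pairs \<eta>"
    then have "1 + fst p \<noteq> 0" using mem[of p] by auto
    then have nz: "1 + complex_of_real (fst p) \<noteq> 0" by (metis of_real_1 of_real_add of_real_eq_0_iff)
    have e: "(hr m n (of_real (fst p)) - hr m n (of_real (snd p))) + of_real (snd p - fst p) * rat m n (of_real (snd p)) =
       (1 + of_real (fst p)) * (rat m n (of_real (fst p)) - rat m n (of_real (snd p)))"
      by (simp add: hr_rat algebra_simps)
    have "((1 + of_real (fst p)) * (rat m n (of_real (fst p)) - rat m n (of_real (snd p)))) * (logL (fst p) / of_real (1 + fst p)) =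
       (rat m n (of_real (fst p)) - rat m n (of_real (snd p))) * logL (fst p)"
      using nz by simp
    then show "rat m n (of_real (fst p)) * logL (fst p) - rat m n (of_real (snd p)) * logL (snd p) =
       ((hr m n (of_real (fst p)) - hr m n (of_real (snd p))) + of_real (snd p - fst p) * rat m n (of_real (snd p))) * (logL (fst p) / of_real (1 + fst p))
        + rat m n (of_real (snd p)) * (logL (fst p) - logL (snd p))"
      unfolding e by (simp add: algebra_simps)
  next
    show "dominated (far_pairs \<eta>) (\<lambda>p. ((hr m n (of_real (fst p)) - hr m n (of_real (snd p))) + of_real (snd p - fst p) * rat m n (of_real (snd p))) * (logL (fst p) / of_real (1 + fst p))
        + rat m n (of_real (snd p)) * (logL (fst p) - logL (snd p))) (\<lambda>p. snd p - fst p)"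
    proof (rule dominated_add)
      have "dominated (far_pairs \<eta>) (\<lambda>p. of_real (snd p - fst p) * rat m n (of_real (snd p))) (\<lambda>p. snd p - fst p)"
        using dominated_bilinear[OF bounded_bilinear_mult d r2] by simp
      from dominated_bilinear[OF bounded_bilinear_mult dominated_add[OF h this] L]
      show "dominated (far_pairs \<eta>) (\<lambda>p. ((hr m n (of_real (fst p)) - hr m n (of_real (snd p))) + of_real (snd p - fst p) * rat m n (of_real (snd p))) * (logL (fst p) / of_real (1 + fst p))) (\<lambda>p. snd p - fst p)"
        by simp
      show "dominated (far_pairs \<eta>) (\<lambda>p. rat m n (of_real (snd p)) * (logL (fst p) - logL (snd p))) (\<lambda>p. snd p - fst p)"
        using dominated_bilinear[OF bounded_bilinear_mult r2 l2] by simp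
    qed
  qed
qed simp_all

lemma Am_large: "dominated {1..} (\<lambda>w. Am (of_real w) + mat (of_real w)) (\<lambda>w. 1)"
proof (rule dominated_vec, rule dominated_vec)
  fix m n :: 'n
  have p: "dominated {1..} (\<lambda>w. pr m n (of_real w)) (\<lambda>w. 1)" and h: "dominated {1..} (\<lambda>w. hr m n (of_real w)) (\<lambda>w. 1)"
    by (rule dominated_subset[OF pr_bounded] dominated_subset[OF hr_bounded]; force)+
  have "dominated {1..} (\<lambda>w. (if m = n then of_real (om m) else 0) - of_real (lam^2) * (pr m n (of_real w) - hr m n (of_real w) * (logL w / of_real (1 + w)))) (\<lambda>w. 1)"
  proof (rule dominated_diff[OF dominated_const])
    have "dominated {1..} (\<lambda>w. hr m n (of_real w) * (logL w / of_real (1 + w))) (\<lambda>w. 1)"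
      using dominated_bilinear[OF bounded_bilinear_mult h logL_growth] by simp
    from dominated_bilinear[OF bounded_bilinear_mult dominated_const dominated_diff[OF p this], of "of_real (lam^2)"]
    show "dominated {1..} (\<lambda>w. of_real (lam^2) * (pr m n (of_real w) - hr m n (of_real w) * (logL w / of_real (1 + w)))) (\<lambda>w. 1)"
      by simp
  qed
  then show "dominated {1..} (\<lambda>w. (Am (of_real w) + mat (of_real w)) $ m $ n) (\<lambda>w. 1)"
  proof (rule dominated_cong[rotated])
    fix w :: real assume w: "w \<in> {1..}"
    then have "1 + w \<noteq> 0" by auto
    then have nz: "1 + complex_of_real w \<noteq> 0" by (metis of_real_1 of_real_add of_real_eq_0_iff)
    show "(Am (of_real w) + mat (of_real w)) $ m $ n = (if m = n then of_real (om m) else 0) - of_real (lam^2) * (pr m n (of_real w) - hr m n (of_real w) * (logL w / of_real (1 + w)))"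
      using w nz by (simp add: Am_entry mat_def hr_rat)
  qed
qed

lemma Am_continuous: "continuous_on {0<..} (\<lambda>w. Am (of_real w) $ m $ n)"
proof (subst continuous_on_cong[OF refl])
  show "Am (of_real w) $ m $ n = (if m = n then of_real (om m) - of_real w else 0) - of_real (lam^2) * (pr m n (of_real w) - rat m n (of_real w) * logL w)" if "w \<in> {0<..}" for w
    using that by (intro Am_entry) simp
  have "continuous_on {0<..} (\<lambda>w. if m = n then complex_of_real (om m) - of_real w else 0)"
    by (cases "m = n") (auto intro!: continuous_intros)
  then show "continuous_on {0<..} (\<lambda>w. (if m = n then of_real (om m) - of_real w else 0) - of_real (lam^2) * (pr m n (of_real w) - rat m n (of_real w) * logL w))"
    unfolding pr_def rat_def logL_def using ff_nozero[OF less_imp_le] by (intro continuous_intros) auto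
qed

end

section \<open>Consequences of the zero-energy classification\<close>

context friedrichs_model
begin

lemma fpsi_eq: "fpsi lam v x w = (- complex_of_real lam / of_real w) * (\<Sum>n\<in>UNIV. x$n * v n w)"
  by (simp add: fpsi_def)

lemma csubspace_M2: "csubspace (M2 om lam v)"
proof -
  have 0: "fpsi lam v 0 = (\<lambda>x. 0)" by (simp add: fpsi_def fun_eq_iff)
  have a: "fpsi lam v (x + y) = (\<lambda>w. fpsi lam v x w + fpsi lam v y w)" for x y
    by (simp add: fpsi_eq fun_eq_iff distrib_right distrib_left sum.distrib)
  have s: "fpsi lam v (c *s x) = (\<lambda>w. c * fpsi lam v x w)" for c x
    by (simp add: fpsi_eq fun_eq_iff sum_distrib_left mult_ac)
  show ?thesis
    using csubspace_kernel[of "Kzero om lam v"]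
    unfolding csubspace_def M2_def Mspace_def by (auto simp: 0 a s intro: sq_int_add sq_int_cmult)
qed

lemma M2_trivial: "M2 om lam v = {0}"
  using orth_proj(3)[OF csubspace_M2] Q2_z by auto

lemma kernel_nontrivial: "\<exists>x. x \<noteq> 0 \<and> Kzero om lam v *v x = 0"
proof (rule ccontr)
  assume "\<not> ?thesis"
  then have "\<exists>B. B ** Kzero om lam v = mat 1" using matrix_left_invertible_ker[of "Kzero om lam v"] by blast
  then show False using det0 invertible_left_inverse[of "Kzero om lam v"] invertible_det_nz[of "Kzero om lam v"] by blast
qed

text \<open>For \<open>lam = 0\<close> every \<open>fpsi\<close> vanishes, so \<open>M2\<close>
  would be the whole kernel of \<open>Kzero\<close>, which is nontrivial. This provides
  \<open>c > 0\<close> for \<open>c = lam^2\<close>.\<close>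

lemma lam_nonzero: "lam \<noteq> 0"
proof
  assume "lam = 0"
  then have "fpsi lam v x = (\<lambda>w. 0)" for x by (simp add: fpsi_def fun_eq_iff)
  then have "M2 om lam v = Mspace om lam v" by (auto simp: M2_def)
  then show False using kernel_nontrivial M2_trivial by (auto simp: Mspace_def)
qed

text \<open>With \<open>M2\<close> trivial, \<open>M1\<close> is the double complement of the
  kernel.\<close>

lemma M1_kernel: "M1 om lam v = {x. Kzero om lam v *v x = 0}"
proof -
  have "{x + y | x y. x \<in> M0 om lam v \<and> y \<in> M2 om lam v} = M0 om lam v" by (auto simp: M2_trivial)
  then show ?thesis
    unfolding M1_def using kernel_double_complement[OF Kzero_adj] by (simp add: M0_def Mspace_def)
qed

lemma Gam1_adj: "mat_adj (Gam1 pp rr) = Gam1 pp rr"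
proof -
  have lim: "((\<lambda>w. rat m n (of_real w) / of_real w) \<longlongrightarrow> Gam1 pp rr $ m $ n) (at_right 0)" for m n
  proof -
    have nz: "poly (rr m n) 0 \<noteq> 0" using ff_nozero[of 0 m n] by simp
    have "((\<lambda>w. poly (pq m n) (complex_of_real w) / poly (rr m n) (complex_of_real w)) \<longlongrightarrow> poly (pq m n) (complex_of_real 0) / poly (rr m n) (complex_of_real 0)) (at_right 0)"
      using nz by (intro tendsto_intros) auto
    moreover have "\<forall>\<^sub>F w in at_right 0. poly (pq m n) (complex_of_real w) / poly (rr m n) (complex_of_real w) = rat m n (of_real w) / of_real w"
      using eventually_at_right_less[of 0] by eventually_elim (simp add: rat_def pp_factor[of m n])
    ultimately show ?thesis by (simp add: Gam1_entry tendsto_cong)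
  qed
  have "cnj (Gam1 pp rr $ n $ m) = Gam1 pp rr $ m $ n" for m n
  proof (rule tendsto_unique[OF _ _ lim])
    have "\<forall>\<^sub>F w in at_right 0. cnj (rat n m (of_real w) / of_real w) = rat m n (of_real w) / of_real w"
      using eventually_at_right_less[of 0] by eventually_elim (simp add: rat_cnj)
    then show "((\<lambda>w. rat m n (of_real w) / of_real w) \<longlongrightarrow> cnj (Gam1 pp rr $ n $ m)) (at_right 0)"
      by (rule Lim_transform_eventually[OF tendsto_cnj[OF lim[of n m]]])
  qed simp
  then show ?thesis by (simp add: mat_adj_def vec_eq_iff)
qed

text \<open>If the quadratic form of \<open>Gam1\<close> vanishes at \<open>x\<close>, then \<open>fpsi\<close> stays bounded at the origin
  and is therefore square integrable, i.e. \<open>x\<close> belongs to the trivial space \<open>M2\<close>.\<close>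
lemma Gam1_positive:
  assumes K: "Kzero om lam v *v x = 0" and 0: "cinner x (Gam1 pp rr *v x) = 0"
  shows "x = 0"
proof -
  define g where "g = (\<lambda>w. \<Sum>n\<in>UNIV. x$n * v n w)"
  have gs: "sq_int g" unfolding g_def by (intro sq_int_sum sq_int_cmult v_L2)
  then have [measurable]: "g \<in> borel_measurable borel" by (simp add: sq_int_def)
  have "dominated near0 (\<lambda>w. cinner x ((Gam v w - w *\<^sub>R Gam1 pp rr) *v x)) (\<lambda>w. 1 * (w^2 * 1))"
    by (intro dominated_bilinear[OF bounded_bilinear_cinner] dominated_bilinear[OF bounded_bilinear_matrix_vector_mult] dominated_const Gam_near)
  then obtain C where C: "C \<ge> 0" "\<And>w. w \<in> near0 \<Longrightarrow> cmod (cinner x ((Gam v w - w *\<^sub>R Gam1 pp rr) *v x)) \<le> C * (1 * (w^2 * 1))"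
    unfolding dominated_def by blast
  have g_near: "(cmod (g w))^2 \<le> C * w^2" if w: "w \<in> near0" for w
  proof -
    have "(w *\<^sub>R Gam1 pp rr) *v x = w *\<^sub>R (Gam1 pp rr *v x)"
      by (rule bounded_bilinear.scaleR_left[OF bounded_bilinear_matrix_vector_mult])
    then have "cinner x ((w *\<^sub>R Gam1 pp rr) *v x) = 0"
      using 0 by (simp add: bounded_bilinear.scaleR_right[OF bounded_bilinear_cinner])
    then have "cinner x ((Gam v w - w *\<^sub>R Gam1 pp rr) *v x) = complex_of_real ((cmod (g w))^2)"
      using fpsi_sq[OF near0_log(1)[OF w], of x] by (simp add: matrix_vector_mult_diff_rdistrib cinner_simps g_def)
    then have "cmod (complex_of_real ((cmod (g w))^2)) \<le> C * (1 * (w^2 * 1))" using C(2)[OF w] by simp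
    then show ?thesis by (simp only: norm_of_real abs_power2 mult_1 mult_1_right)
  qed
  have f: "fpsi lam v x = (\<lambda>w. (- complex_of_real lam / of_real w) * g w)"
    by (simp add: fpsi_eq g_def fun_eq_iff)
  have fn: "(cmod (fpsi lam v x w))^2 = lam^2 * ((cmod (g w))^2 / w^2)" for w
    by (simp add: f norm_mult norm_divide power_mult_distrib power_divide)
  \<comment> \<open>Up to \<open>exp (-2)\<close> the square of \<open>fpsi\<close> is at most
    \<open>lam^2 * C\<close>, and \<open>4 / (1 + w)^2 \<ge> 1\<close> there; beyond it
    \<open>1 / w^2 \<le> exp 4\<close>. The sum majorises both regimes by an integrable
    function.\<close>
  let ?h = "\<lambda>w. (4 * lam^2 * C) * (1 / (1 + w)^2) + (lam^2 * exp 4) * (cmod (g w))^2"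
  have "set_integrable lborel {0<..} ?h"
    using gs by (intro set_integral_add set_integrable_mult_right set_integrable_inverse_square_shift) (auto simp: sq_int_def)
  then have "set_integrable lborel {0<..} (\<lambda>w. (cmod (fpsi lam v x w))^2)"
  proof (rule set_integrable_bound)
    show "set_borel_measurable lborel {0<..} (\<lambda>w. (cmod (fpsi lam v x w))\<^sup>2)"
      unfolding set_borel_measurable_def f by measurable
    show "AE w in lborel. w \<in> {0<..} \<longrightarrow> norm ((cmod (fpsi lam v x w))\<^sup>2) \<le> norm (?h w)"
    proof (intro AE_I2 impI)
      fix w :: real assume "w \<in> {0<..}"
      then have w: "w > 0" by simp
      have n1: "0 \<le> (4 * lam^2 * C) * (1 / (1 + w)^2)" "0 \<le> (lam^2 * exp 4) * (cmod (g w))^2"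
        using C(1) by (auto intro!: mult_nonneg_nonneg)
      have "(cmod (fpsi lam v x w))^2 \<le> ?h w"
      proof (cases "w \<le> exp (-2)")
        case True
        then have wn: "w \<in> near0" using w by (simp add: near0_def)
        have "(cmod (g w))^2 / w^2 \<le> C" using g_near[OF wn] w by (simp add: divide_le_eq)
        then have "(cmod (fpsi lam v x w))^2 \<le> lam^2 * C" unfolding fn by (intro mult_left_mono) auto
        also have "\<dots> \<le> lam^2 * C * (4 * (1 / (1 + w)^2))"
        proof -
          have "(1 + w)^2 \<le> 2^2" using near0_log(2)[OF wn] w by (intro power_mono) auto
          then have "1 \<le> 4 * (1 / (1 + w)^2)" using w by (simp add: le_divide_eq)
          then show ?thesis using mult_left_mono[of 1 "4 * (1 / (1 + w)^2)" "lam^2 * C"] C(1) by simp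
        qed
        also have "lam^2 * C * (4 * (1 / (1 + w)^2)) = (4 * lam^2 * C) * (1 / (1 + w)^2)" by (simp only: mult_ac)
        finally show ?thesis using n1(2) by linarith
      next
        case False
        then have "exp (-2) ^ 2 \<le> w^2" by (intro power_mono) auto
        then have e4: "exp (- 4) \<le> w^2" by (simp add: power2_eq_square flip: exp_add)
        have "1 / w^2 \<le> exp 4" using e4 w by (simp add: exp_minus field_simps)
        then have "(1 / w^2) * (cmod (g w))^2 \<le> exp 4 * (cmod (g w))^2" by (intro mult_right_mono) auto
        then have "(cmod (fpsi lam v x w))^2 \<le> lam^2 * (exp 4 * (cmod (g w))^2)"
          unfolding fn by (intro mult_left_mono) auto
        also have "lam^2 * (exp 4 * (cmod (g w))^2) = (lam^2 * exp 4) * (cmod (g w))^2" by (simp only: mult_ac)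
        finally show ?thesis using n1(1) by linarith
      qed
      moreover have "0 \<le> ?h w" using n1 by linarith
      ultimately show "norm ((cmod (fpsi lam v x w))\<^sup>2) \<le> norm (?h w)"
        unfolding real_norm_def abs_power2 by (simp only: abs_of_nonneg)
    qed
  qed
  then have "sq_int (fpsi lam v x)" unfolding sq_int_def f by simp
  then have "x \<in> M2 om lam v" using K by (simp add: M2_def Mspace_def)
  then show ?thesis using M2_trivial by simp
qed

lemma reduced_inverse:
  obtains R Y where
    "R ** (orth_proj (M1 om lam v) ** Gam1 pp rr ** orth_proj (M1 om lam v)) = orth_proj (M1 om lam v)"
    "R ** orth_proj (M1 om lam v) = R" "orth_proj (M1 om lam v) ** R = R" "mat_adj R = R"
    "resolvent_asymptotics (\<lambda>w. Am (of_real w)) (Gam v) (Kzero om lam v) (Gam1 pp rr) R Y (lam^2)"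
proof -
  let ?Q = "orth_proj {x. Kzero om lam v *v x = 0}"
  obtain R Y where R: "R ** (?Q ** Gam1 pp rr ** ?Q) = ?Q" "R ** ?Q = R" "?Q ** R = R" "mat_adj R = R"
    "R ** Gam1 pp rr ** R = R" "Kzero om lam v ** R = 0" "Gam1 pp rr ** R + Kzero om lam v ** Y = mat 1"
    by (rule reduced_inverse_exists[OF Kzero_adj Gam1_adj Gam1_positive]) blast
  have "resolvent_asymptotics (\<lambda>w. Am (of_real w)) (Gam v) (Kzero om lam v) (Gam1 pp rr) R Y (lam^2)"
    by (unfold_locales; (rule R Am_continuous Am_near Am_lip_near Am_large Gam_near Gam_lip Gam_bounded
        | erule Am_lip_far det_Am | simp add: lam_nonzero))
  with R show ?thesis using that[of R Y] unfolding M1_kernel by simp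
qed

lemma Am_anti_hermitian:
  assumes "w > 0"
  shows "mat_adj (Am (of_real w)) - Am (of_real w) = cscale (2 * \<i> * of_real (pi * lam^2)) (Gam v w)"
proof -
  have e: "Am (of_real w) $ m $ n = (if m = n then of_real (om m) - of_real w else 0) - of_real (lam^2) * Dmat v w $ m $ n - \<i> * of_real (pi * lam^2) * Gam v w $ m $ n" for m n
    using assms by (simp add: Am_entry Dmat_pv(3) Gam_rat logL_def algebra_simps)
  have "cnj (Am (of_real w) $ n $ m) - Am (of_real w) $ m $ n = 2 * \<i> * of_real (pi * lam^2) * Gam v w $ m $ n" for m n
    unfolding e using assms by (simp add: Dmat_cnj Gam_rat rat_cnj algebra_simps)
  then show ?thesis
    by (simp only: vec_eq_iff mat_adj_def cscale_def vec_lambda_beta vector_minus_component simp_thms)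
qed

text \<open>Substituting \<open>A y = u\<close> turns the imaginary part of
  \<open>cinner u y\<close> into the form of \<open>mat_adj A - A\<close> at \<open>y\<close>, a
  multiple of \<open>Gam\<close> by \<open>Am_anti_hermitian\<close>. This identifies the density of
  the inversion formula with \<open>dens\<close>.\<close>

lemma Im_resolvent:
  fixes u :: "complex^'n"
  assumes w: "w > 0"
  defines "y \<equiv> matrix_inv (Am (of_real w)) *v u"
  shows "Im (cinner u y) = pi * (lam^2 * Re (cinner y (Gam v w *v y)))"
proof -
  let ?A = "Am (of_real w)"
  have Ay: "?A *v y = u"
    unfolding y_def using matrix_inv_eq[OF det_Am[OF w]] by (simp add: matrix_vector_mul_assoc)
  have "cinner u y - cnj (cinner u y) = cinner y (mat_adj ?A *v y) - cinner y (?A *v y)"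
    using cinner_adj[of ?A y y] cinner_cnj[of y u] by (simp add: Ay)
  also have "\<dots> = cinner y ((mat_adj ?A - ?A) *v y)"
    by (simp add: cinner_simps matrix_vector_mult_diff_rdistrib)
  also have "\<dots> = (2 * \<i> * of_real (pi * lam^2)) * cinner y (Gam v w *v y)"
    by (simp add: Am_anti_hermitian[OF w] cscale_vector cinner_vscale)
  also have "cinner y (Gam v w *v y) = of_real (Re (cinner y (Gam v w *v y)))"
    using fpsi_sq[OF w, of y] by simp
  finally have "Im (cinner u y - cnj (cinner u y)) = Im ((2 * \<i> * of_real (pi * lam^2)) * of_real (Re (cinner y (Gam v w *v y))))"
    by (simp only:)
  then show ?thesis by simp
qed

text \<open>The rational functions may have poles off the half-line and \<open>Am\<close> may be
  singular off the axis. Removing both from the right half-plane leaves the open neighbourhood of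
  the positive axis that \<open>stieltjes_boundary\<close> asks for.\<close>

definition "U0 = {z. 0 < Re z} \<inter> (\<Inter>m. \<Inter>n. {z. poly (rr m n) z \<noteq> 0})"
definition "Ug = {z \<in> U0. det (Am z) \<noteq> 0}"

lemma open_U0: "open U0"
  unfolding U0_def
  by (intro open_Int open_INT finite_class.finite_UNIV ballI open_halfspace_Re_gt open_Collect_neq continuous_intros)

lemma Am_continuous_U0: "continuous_on U0 (\<lambda>z. Am z $ i $ j)"
proof -
  have "Am z $ i $ j = K0 om $ i $ j - (if i = j then z else 0) - of_real (lam^2) * (pr i j z - rat i j z * (Ln z - \<i> * pi))" for z
    by (simp add: Am_def mat_def) (simp add: scaleR_conv_of_real)
  moreover have "continuous_on U0 (\<lambda>z. if i = j then z else 0)" by (cases "i = j") auto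
  moreover have "continuous_on U0 (\<lambda>z. of_real (lam^2) * (pr i j z - rat i j z * (Ln z - \<i> * pi)))"
    unfolding pr_def rat_def by (intro continuous_intros) (auto simp: U0_def complex_nonpos_Reals_iff)
  ultimately show ?thesis by (simp only: continuous_on_diff continuous_on_const)
qed

lemma open_Ug: "open Ug"
proof -
  have "open (U0 \<inter> (\<lambda>z. det (Am z)) -` (- {0}))"
    by (rule continuous_open_preimage[OF continuous_on_det[OF Am_continuous_U0] open_U0]) (intro open_Compl closed_singleton)
  moreover have "Ug = U0 \<inter> (\<lambda>z. det (Am z)) -` (- {0})" by (auto simp: Ug_def)
  ultimately show ?thesis by simp
qed

lemma pos_real_Ug: "x > 0 \<Longrightarrow> complex_of_real x \<in> Ug"
  using det_Am ff_nozero[OF less_imp_le] by (auto simp: Ug_def U0_def)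

lemma resolvent_continuous: "continuous_on Ug (\<lambda>z. cinner u (matrix_inv (Am z) *v u))"
  unfolding cinner_def
  by (intro continuous_intros continuous_on_solution continuous_on_subset[OF Am_continuous_U0]) (auto simp: Ug_def)

lemma self_energy:
  assumes z: "Im z > 0" "z \<in> U0"
  shows "(LINT x:{0<..}|lborel. cnj (v m x) * (v n x / (of_real x - z))) = pr m n z - rat m n z * (Ln z - \<i> * pi)"
proof -
  have "(LINT x:{0<..}|lborel. cnj (v m x) * (v n x / (of_real x - z))) = (LINT x:{0<..}|lborel. rat m n (of_real x) / (of_real x - z))"
    by (rule set_lebesgue_integral_cong) (simp_all flip: v_rat)
  moreover have "poly (rr m n) z \<noteq> 0" using z by (auto simp: U0_def)
  ultimately show ?thesis using P(2)[OF z(1), of m n] unfolding pr_def rat_def[of m n z] by (simp add: field_simps)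
qed

text \<open>The second component of \<open>(H - z) w = u\<close> dictates the continuum part of
  \<open>w\<close>. Inserted into the first it produces the self energy, and the equation becomes
  \<open>Am z *v c = uu\<close>.\<close>

lemma resolvent_vector:
  fixes uu :: "complex^'n"
  assumes z: "Im z > 0" "z \<in> Ug"
  defines "c \<equiv> matrix_inv (Am z) *v uu"
  defines "w \<equiv> (c, \<lambda>x. \<Sum>n\<in>UNIV. (- complex_of_real lam * c $ n) * (v n x / (of_real x - z)))"
  shows "inD w" "Hop om lam v w = hlin 1 (uu, \<lambda>x. 0) z w" "hinner (uu, \<lambda>x. 0) w = cinner uu c"
proof -
  have nz: "complex_of_real x - z \<noteq> 0" for x using z by (auto simp: complex_eq_iff)
  have b: "cmod (1 / (complex_of_real x - z)) \<le> 1 / Im z" for x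
    using abs_Im_le_cmod[of "complex_of_real x - z"] z nz[of x]
    by (simp add: norm_divide) (intro divide_left_mono mult_pos_pos; simp)
  have s1: "sq_int (\<lambda>x. v n x / (of_real x - z))" for n
  proof -
    have "sq_int (\<lambda>x. (1 / (complex_of_real x - z)) * v n x)"
      by (rule sq_int_bounded_mult[OF v_L2 _ b]) measurable
    then show ?thesis by simp
  qed
  \<comment> \<open>Membership in the domain: \<open>x / (x - z) = 1 + z / (x - z)\<close> removes
    the unbounded factor.\<close>
  have s2: "sq_int (\<lambda>x. of_real x * (v n x / (of_real x - z)))" for n
  proof -
    have "sq_int (\<lambda>x. v n x + z * (v n x / (of_real x - z)))"
      by (intro sq_int_add sq_int_cmult s1 v_L2)
    moreover have "v n x + z * (v n x / (of_real x - z)) = of_real x * (v n x / (of_real x - z))" for x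
      using nz[of x] by (simp add: field_simps)
    ultimately show ?thesis by simp
  qed
  have "sq_int (\<lambda>x. \<Sum>n\<in>UNIV. (- complex_of_real lam * c $ n) * (of_real x * (v n x / (of_real x - z))))"
    by (intro sq_int_sum sq_int_cmult s2)
  moreover have "(\<lambda>x. complex_of_real x * snd w x) = (\<lambda>x. \<Sum>n\<in>UNIV. (- complex_of_real lam * c $ n) * (of_real x * (v n x / (of_real x - z))))"
    by (simp add: w_def sum_distrib_left mult.left_commute fun_eq_iff)
  moreover have w1: "sq_int (snd w)"
    unfolding w_def snd_conv by (intro sq_int_sum sq_int_cmult s1)
  ultimately show "inD w" by (simp add: inD_def inH_def)
  have zU0: "z \<in> U0" and dz: "det (Am z) \<noteq> 0" using z by (auto simp: Ug_def)
  have Ac: "Am z *v c = uu"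
    unfolding c_def using matrix_inv_eq[OF dz] by (simp add: matrix_vector_mul_assoc)
  define Sg where "Sg = (\<lambda>m n. pr m n z - rat m n z * (Ln z - \<i> * pi))"
  have I: "(LINT x:{0<..}|lborel. cnj (v m x) * snd w x) = (\<Sum>n\<in>UNIV. (- complex_of_real lam * c $ n) * Sg m n)" for m
  proof -
    have int: "set_integrable lborel {0<..} (\<lambda>x. (- complex_of_real lam * c $ n) * (cnj (v m x) * (v n x / (of_real x - z))))" for n
      by (intro set_integrable_mult_right sq_int_product v_L2 s1)
    have "(LINT x:{0<..}|lborel. cnj (v m x) * snd w x) = (LINT x:{0<..}|lborel. \<Sum>n\<in>UNIV. (- complex_of_real lam * c $ n) * (cnj (v m x) * (v n x / (of_real x - z))))"
      by (simp add: w_def sum_distrib_left mult.left_commute)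
    also have "\<dots> = (\<Sum>n\<in>UNIV. LINT x:{0<..}|lborel. (- complex_of_real lam * c $ n) * (cnj (v m x) * (v n x / (of_real x - z))))"
      using int unfolding set_lebesgue_integral_def set_integrable_def scaleR_sum_right
      by (intro Bochner_Integration.integral_sum) auto
    also have "\<dots> = (\<Sum>n\<in>UNIV. (- complex_of_real lam * c $ n) * Sg m n)"
      unfolding set_integral_mult_right self_energy[OF z(1) zU0] Sg_def ..
    finally show ?thesis .
  qed
  have comp: "of_real (om m) * c $ m + of_real lam * (\<Sum>n\<in>UNIV. (- complex_of_real lam * c $ n) * Sg m n) = uu $ m + z * c $ m" for m
  proof -
    have "(Am z *v c) $ m = (\<Sum>n\<in>UNIV. (if m = n then of_real (om m) - z else 0) * c $ n - of_real (lam^2) * Sg m n * c $ n)"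
      unfolding Am_def Sg_def matrix_vector_mult_def K0_def mat_def
      by (simp, intro sum.cong refl) (simp add: scaleR_conv_of_real algebra_simps)
    also have "\<dots> = (of_real (om m) - z) * c $ m - (\<Sum>n\<in>UNIV. of_real (lam^2) * Sg m n * c $ n)"
      unfolding sum_subtractf by (simp add: if_distrib if_distribR cong: if_cong)
    also have "(\<Sum>n\<in>UNIV. of_real (lam^2) * Sg m n * c $ n) = - (of_real lam * (\<Sum>n\<in>UNIV. (- complex_of_real lam * c $ n) * Sg m n))"
      by (simp add: sum_distrib_left sum_negf power2_eq_square mult_ac)
    finally show ?thesis by (simp add: Ac algebra_simps)
  qed
  have snd: "complex_of_real x * snd w x + complex_of_real lam * (\<Sum>n\<in>UNIV. fst w $ n * v n x) = z * snd w x" for x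
  proof -
    have "complex_of_real x * snd w x - z * snd w x = (\<Sum>n\<in>UNIV. (complex_of_real x - z) * ((- complex_of_real lam * c $ n) * (v n x / (of_real x - z))))"
      by (simp only: w_def snd_conv sum_distrib_left sum_subtractf[symmetric] left_diff_distrib)
    also have "\<dots> = (\<Sum>n\<in>UNIV. - (complex_of_real lam * (c $ n * v n x)))"
      using nz[of x] by (intro sum.cong refl) (simp add: field_simps)
    finally show ?thesis by (simp add: w_def sum_negf sum_distrib_left algebra_simps)
  qed
  have "fst w = c" by (simp add: w_def)
  then show "Hop om lam v w = hlin 1 (uu, \<lambda>x. 0) z w"
  proof (intro prod_eqI)
    show "fst (Hop om lam v w) = fst (hlin 1 (uu, \<lambda>x. 0) z w)"
      unfolding Hop_def hlin_def fst_conv I \<open>fst w = c\<close> comp by simp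
    show "snd (Hop om lam v w) = snd (hlin 1 (uu, \<lambda>x. 0) z w)"
      unfolding Hop_def hlin_def snd_conv snd by simp
  qed
  show "hinner (uu, \<lambda>x. 0) w = cinner uu c"
    by (simp add: hinner_def w_def)
qed

end

section \<open>The reduced evolution\<close>

locale friedrichs_evolution = friedrichs_model om lam v pp rr
  for om :: "'n::finite \<Rightarrow> real" and lam :: real and v :: "'n \<Rightarrow> real \<Rightarrow> complex" and pp rr :: "'n \<Rightarrow> 'n \<Rightarrow> complex poly" +
  fixes E :: "real set \<Rightarrow> 'n hvec \<Rightarrow> 'n hvec"
  assumes E_spec: "is_spectral_measure_of om lam v E"
begin

sublocale spec: hamiltonian_spectral_measure om lam v E
  by unfold_locales (rule v_L2 E_spec)+

lemma inD_discrete: "inD (uu, \<lambda>x. 0)"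
  by (simp add: inD_def inH_def)

lemma stieltjes_boundary_spec:
  "stieltjes_boundary (spec_meas E (uu, \<lambda>x. 0)) (\<lambda>z. cinner uu (matrix_inv (Am z) *v uu)) Ug"
proof (rule stieltjes_boundary.intro)
  show "finite_measure (spec_meas E (uu, \<lambda>x. 0))"
    by (rule spec.finite_measure_spec[OF inD_inH[OF inD_discrete]])
  show "sets (spec_meas E (uu, \<lambda>x. 0)) = sets borel" by simp
  show "open Ug" "\<And>x. x > 0 \<Longrightarrow> complex_of_real x \<in> Ug"
    by (rule open_Ug, erule pos_real_Ug)
  show "continuous_on Ug (\<lambda>z. cinner uu (matrix_inv (Am z) *v uu))" by (rule resolvent_continuous)
  show "(\<integral>x. 1 / (complex_of_real x - z) \<partial>spec_meas E (uu, \<lambda>x. 0)) = cinner uu (matrix_inv (Am z) *v uu)"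
    if "z \<in> Ug" "Im z > 0" for z
    using spec.resolvent_integral[OF inD_discrete resolvent_vector(1)[OF that(2,1)] _ resolvent_vector(2)[OF that(2,1)]]
      resolvent_vector(3)[OF that(2,1)] that(2) by simp
qed

text \<open>On the half-line the spectral measure is \<open>\<rho>\<close> times Lebesgue measure by
  inversion, and \<open>\<rho>\<close> is \<open>dens\<close> by \<open>Im_resolvent\<close>; so the
  threshold bounds on \<open>dens\<close> are exactly the hypotheses of the oscillatory
  estimate.\<close>

proposition vector_asymptotics:
  assumes RA: "resolvent_asymptotics (\<lambda>w. Am (of_real w)) (Gam v) (Kzero om lam v) (Gam1 pp rr) R Y (lam^2)"
  shows "\<exists>C T. \<forall>t\<ge>T. cmod ((LINT x:{0<..}|spec_meas E (uu, \<lambda>x. 0). exp (- \<i> * complex_of_real (t * x)))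
      - complex_of_real (Re (cinner uu (R *v uu)) / lam^2 / ln t)) \<le> C / (ln t)^2"
proof -
  let ?M = "spec_meas E (uu, \<lambda>x. 0)"
  interpret RA: resolvent_asymptotics "\<lambda>w. Am (of_real w)" "Gam v" "Kzero om lam v" "Gam1 pp rr" R Y "lam^2"
    by (rule RA)
  interpret SB: stieltjes_boundary ?M "\<lambda>z. cinner uu (matrix_inv (Am z) *v uu)" Ug
    by (rule stieltjes_boundary_spec)
  define \<rho> where "\<rho> = (\<lambda>x. indicator {0<..} x * SB.\<rho> x)"
  have [measurable]: "\<rho> \<in> borel_measurable borel" unfolding \<rho>_def by (rule SB.density_measurable)
  have \<rho>_dens: "\<rho> x = RA.dens uu x" if "x > 0" for x
    using Im_resolvent[OF that, of uu] that
    by (simp add: \<rho>_def SB.\<rho>_def RA.dens_def RA.q_def RA.y_def RA.B_def)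
  have \<rho>_nonneg: "\<rho> x \<ge> 0" for x
    using SB.density_nonneg[of x] by (simp add: \<rho>_def indicator_def)
  have N2: "SB.N2 = density lborel (\<lambda>x. ennreal (\<rho> x))" by (simp add: SB.N2_def \<rho>_def)
  have N1: "SB.N1 = density ?M (\<lambda>x. ennreal (indicator {0<..} x))" by (simp add: SB.N1_def ennreal_indicator)
  have measure_eq: "emeasure ?M A = (\<integral>\<^sup>+x. ennreal (\<rho> x) * indicator A x \<partial>lborel)" if A: "A \<in> sets borel" "A \<subseteq> {0<..}" for A
  proof -
    have "emeasure SB.N1 A = (\<integral>\<^sup>+x. indicator {0<..} x * indicator A x \<partial>?M)"
      using A by (intro SB.emeasure_N1)
    also have "\<dots> = (\<integral>\<^sup>+x. indicator A x \<partial>?M)"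
      using A by (intro nn_integral_cong) (auto simp: indicator_def)
    also have "\<dots> = emeasure ?M A"
      using A by (intro nn_integral_indicator) simp
    finally have "emeasure ?M A = emeasure SB.N2 A" by (simp add: SB.inversion)
    then show ?thesis using A by (simp add: N2 emeasure_density)
  qed
  have int_A: "set_integrable lborel A \<rho>" "(LINT x:A|lborel. \<rho> x) = measure ?M A" if A: "A \<in> sets borel" "A \<subseteq> {0<..}" for A
  proof -
    have "(\<integral>\<^sup>+x. ennreal (indicator A x *\<^sub>R \<rho> x) \<partial>lborel) = (\<integral>\<^sup>+x. ennreal (\<rho> x) * indicator A x \<partial>lborel)"
      by (intro nn_integral_cong) (auto simp: indicator_def)
    also have "\<dots> = emeasure ?M A" by (rule measure_eq[OF A, symmetric])
    also have "\<dots> = ennreal (measure ?M A)" by (rule SB.emeasure_eq_measure)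
    finally have e: "(\<integral>\<^sup>+x. ennreal (indicator A x *\<^sub>R \<rho> x) \<partial>lborel) = ennreal (measure ?M A)" .
    have "has_bochner_integral lborel (\<lambda>x. indicator A x *\<^sub>R \<rho> x) (measure ?M A)"
      using A \<rho>_nonneg by (intro has_bochner_integral_nn_integral[OF _ _ _ e]) auto
    then show "set_integrable lborel A \<rho>" "(LINT x:A|lborel. \<rho> x) = measure ?M A"
      by (auto simp: set_integrable_def set_lebesgue_integral_def has_bochner_integral_iff)
  qed
  define C0 where "C0 = (\<integral>x. x^2 \<partial>?M)"
  have C0: "C0 \<ge> 0" by (simp add: C0_def)
  obtain C1 where C1: "C1 \<ge> 0" "\<And>w. w \<in> {0<..RA.\<delta>} \<Longrightarrow> norm (RA.dens uu w - RA.kap uu / (w * (ln w)^2)) \<le> C1 * (1 / (w * \<bar>ln w\<bar>^3))"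
    using RA.dens_near[of uu] unfolding dominated_def by blast
  obtain C2 where C2: "C2 \<ge> 0" "\<And>p. p \<in> pairs RA.\<delta> \<Longrightarrow> norm (RA.dens uu (fst p) - RA.dens uu (snd p)) \<le> C2 * ((snd p - fst p) / ((fst p)^2 * (ln (fst p))^2))"
    using RA.dens_lip_near[of uu] unfolding dominated_def by blast
  have "RA.\<delta> / 2 > 0" using RA.\<delta> by simp
  then obtain C3 where C3: "C3 \<ge> 0" "\<And>p. p \<in> far_pairs (RA.\<delta> / 2) \<Longrightarrow> norm (RA.dens uu (fst p) - RA.dens uu (snd p)) \<le> C3 * (snd p - fst p)"
    using RA.dens_lip_far[of "RA.\<delta> / 2" uu] unfolding dominated_def by blast
  \<comment> \<open>\<open>log_singular_density\<close> has one constant for all its bounds; the sum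
    majorises each of the four.\<close>
  define C where "C = C0 + C1 + C2 + C3"
  have le_C: "C0 * a \<le> C * a" "C1 * a \<le> C * a" "C2 * a \<le> C * a" "C3 * a \<le> C * a" if "a \<ge> 0" for a
    using that C0 C1(1) C2(1) C3(1) by (auto simp: C_def intro!: mult_right_mono)
  have d1: "RA.\<delta> < 1" using RA.\<delta>(2) by (meson exp_less_one_iff le_less_trans neg_less_0_iff_less zero_less_numeral)
  interpret LS: log_singular_density \<rho> "RA.kap uu" RA.\<delta> C
  proof
    show "\<rho> \<in> borel_measurable borel" by measurable
    show "set_integrable lborel {0<..} \<rho>" by (rule int_A) auto
    show "\<rho> x \<ge> 0" for x by (rule \<rho>_nonneg)
    show "RA.\<delta> > 0" "RA.\<delta> < 1" by (rule RA.\<delta> d1)+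
    show "C \<ge> 0" using C0 C1 C2 C3 by (simp add: C_def)
    show "\<bar>\<rho> x - RA.kap uu / (x * (ln x)^2)\<bar> \<le> C / (x * \<bar>ln x\<bar>^3)" if x: "0 < x" "x \<le> RA.\<delta>" for x
    proof -
      have "\<bar>\<rho> x - RA.kap uu / (x * (ln x)^2)\<bar> \<le> C1 * (1 / (x * \<bar>ln x\<bar>^3))"
        using C1(2)[of x] x \<rho>_dens[of x] by (simp add: real_norm_def[symmetric] del: real_norm_def)
      also have "\<dots> \<le> C * (1 / (x * \<bar>ln x\<bar>^3))" using x by (intro le_C) simp
      finally show ?thesis by simp
    qed
    show "\<bar>\<rho> s - \<rho> t\<bar> \<le> C * (t - s) / (s^2 * (ln s)^2)" if st: "0 < s" "s \<le> t" "t \<le> RA.\<delta>" for s t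
    proof -
      have "\<bar>\<rho> s - \<rho> t\<bar> \<le> C2 * ((t - s) / (s^2 * (ln s)^2))"
        using C2(2)[of "(s, t)"] st \<rho>_dens[of s] \<rho>_dens[of t] by (simp add: pairs_def)
      also have "\<dots> \<le> C * ((t - s) / (s^2 * (ln s)^2))" using st by (intro le_C) simp
      finally show ?thesis by simp
    qed
    show "\<bar>\<rho> s - \<rho> t\<bar> \<le> C * (t - s)" if st: "RA.\<delta> / 2 \<le> s" "s \<le> t" for s t
    proof -
      have "\<bar>\<rho> s - \<rho> t\<bar> \<le> C3 * (t - s)"
        using C3(2)[of "(s, t)"] st \<open>RA.\<delta> / 2 > 0\<close> \<rho>_dens[of s] \<rho>_dens[of t] by (simp add: far_pairs_def)
      also have "\<dots> \<le> C * (t - s)" using st by (intro le_C) simp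
      finally show ?thesis .
    qed
    show "(LINT x:{T<..}|lborel. \<rho> x) \<le> C / T^2" if T: "T > 0" for T
    proof -
      have "(LINT x:{T<..}|lborel. \<rho> x) = measure ?M {T<..}" using T by (intro int_A(2)) auto
      also have "\<dots> \<le> C0 * (1 / T^2)" unfolding C0_def using spec.spec_tail[OF inD_discrete T] by simp
      also have "\<dots> \<le> C * (1 / T^2)" by (intro le_C) simp
      finally show ?thesis by simp
    qed
  qed
  have transfer: "(LINT x:{0<..}|?M. exp (- \<i> * complex_of_real (t * x))) = (LINT x:{0<..}|lborel. exp (- \<i> * complex_of_real (t * x)) * complex_of_real (\<rho> x))" for t
  proof -
    let ?g = "\<lambda>x. exp (- \<i> * complex_of_real (t * x))"
    have "(LINT x:{0<..}|?M. ?g x) = integral\<^sup>L SB.N1 ?g"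
      unfolding N1 set_lebesgue_integral_def by (subst integral_density) auto
    also have "\<dots> = integral\<^sup>L SB.N2 ?g" by (simp only: SB.inversion)
    also have "\<dots> = (\<integral>x. \<rho> x *\<^sub>R ?g x \<partial>lborel)"
      unfolding N2 using \<rho>_nonneg by (intro integral_density) auto
    also have "\<dots> = (LINT x:{0<..}|lborel. ?g x * complex_of_real (\<rho> x))"
      unfolding set_lebesgue_integral_def
      by (intro Bochner_Integration.integral_cong) (auto simp: \<rho>_def indicator_def scaleR_conv_of_real)
    finally show ?thesis .
  qed
  have "RA.kap uu = Re (cinner uu (R *v uu)) / lam^2" by (simp add: RA.kap_def)
  then show ?thesis using LS.oscillatory_asymptotics unfolding transfer by simp
qed

lemma ket_combination: "hlin 1 (ket m) a (ket n) = (axis m 1 + a *s axis n 1, \<lambda>x. 0)"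
  by (simp add: hlin_def ket_def vec_eq_iff)

text \<open>For Hermitian \<open>R\<close> taking the real part loses nothing, so the four
  coefficients of the scalar asymptotics recombine to an entry of \<open>R\<close>.\<close>

lemma quadratic_form_polarisation:
  assumes "mat_adj R = R"
  shows "(1/4) * (\<Sum>k<4::nat. cnj (\<i>^k) * complex_of_real (Re (cinner (axis m 1 + \<i>^k *s axis n 1) (R *v (axis m 1 + \<i>^k *s axis n 1))))) = R $ m $ n"
proof -
  have real: "complex_of_real (Re (cinner x (R *v x))) = cinner x (R *v x)" for x
  proof -
    have "cnj (cinner x (R *v x)) = cinner x (R *v x)"
      using cinner_adj[of R x x] assms cinner_cnj[of x "R *v x"] by simp
    then show ?thesis by (simp add: complex_eq_iff)
  qed
  have entry: "cinner (axis i 1) (R *v axis j 1) = R $ i $ j" for i j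
    unfolding cinner_axis by (simp add: matrix_vector_mult_def axis_def if_distrib cong: if_cong)
  have q: "cinner (axis m 1 + a *s axis n 1) (R *v (axis m 1 + a *s axis n 1)) = R$m$m + a * R$m$n + cnj a * R$n$m + a * cnj a * R$n$n" for a
    by (simp add: matrix_vector_right_distrib vec.scale cinner_simps cinner_vscale entry algebra_simps)
  have "(1/4) * (\<Sum>k<4::nat. cnj (\<i>^k) * (a + \<i>^k * b + cnj (\<i>^k) * c + \<i>^k * cnj (\<i>^k) * d)) = b" for a b c d
    unfolding sum_lessThan_4 by (simp add: power2_eq_square power3_eq_cube algebra_simps)
  then show ?thesis
    unfolding real unfolding q .
qed

proposition reduced_evolution_asymptotics:
  assumes RA: "resolvent_asymptotics (\<lambda>w. Am (of_real w)) (Gam v) (Kzero om lam v) (Gam1 pp rr) R Y (lam^2)"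
    and R: "mat_adj R = R"
  shows "\<exists>C T. \<forall>t\<ge>T. cmod (U_red E m n t - R$m$n / complex_of_real (lam^2 * ln t)) \<le> C / (ln t)^2"
proof -
  define x where "x = (\<lambda>k. axis m 1 + \<i>^k *s axis n (1::complex))"
  define I where "I = (\<lambda>k t. LINT y:{0<..}|spec_meas E (x k, \<lambda>x. 0). exp (- \<i> * complex_of_real (t * y)))"
  define \<kappa> where "\<kappa> = (\<lambda>k. Re (cinner (x k) (R *v x k)))"
  have "\<exists>C T. \<forall>t\<ge>T. cmod (I k t - complex_of_real (\<kappa> k / lam^2 / ln t)) \<le> C / (ln t)^2" for k
    unfolding I_def \<kappa>_def by (rule vector_asymptotics[OF RA])
  then obtain C T where CT: "\<And>k t. t \<ge> T k \<Longrightarrow> cmod (I k t - complex_of_real (\<kappa> k / lam^2 / ln t)) \<le> C k / (ln t)^2"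
    by metis
  have U: "U_red E m n t = (1/4) * (\<Sum>k<4::nat. cnj (\<i>^k) * I k t)" for t
    by (simp only: U_red_def ket_combination I_def x_def)
  have \<kappa>: "(1/4) * (\<Sum>k<4::nat. cnj (\<i>^k) * complex_of_real (\<kappa> k)) = R $ m $ n"
    using quadratic_form_polarisation[OF R, of m n] by (simp only: \<kappa>_def x_def)
  show ?thesis
  proof (intro exI allI impI)
    \<comment> \<open>The four scalar asymptotics hold from different times on; past the largest
      they hold together.\<close>
    fix t assume t: "t \<ge> Max (T ` {..<4})"
    have tk: "t \<ge> T k" if "k < 4" for k using t that by (auto intro: order_trans[rotated])
    have "R$m$n / complex_of_real (lam^2 * ln t) = (1/4) * (\<Sum>k<4::nat. cnj (\<i>^k) * complex_of_real (\<kappa> k / lam^2 / ln t))"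
      unfolding \<kappa>[symmetric] by (simp add: sum_divide_distrib mult_ac)
    then have "U_red E m n t - R$m$n / complex_of_real (lam^2 * ln t) = (1/4) * (\<Sum>k<4::nat. cnj (\<i>^k) * (I k t - complex_of_real (\<kappa> k / lam^2 / ln t)))"
      unfolding U by (simp only: right_diff_distrib sum_subtractf)
    also have "cmod \<dots> \<le> (1/4) * (\<Sum>k<4::nat. cmod (cnj (\<i>^k) * (I k t - complex_of_real (\<kappa> k / lam^2 / ln t))))"
      unfolding norm_mult[of "1/4"] by (intro mult_mono norm_sum) (auto intro: sum_nonneg)
    also have "\<dots> \<le> (1/4) * (\<Sum>k<4::nat. C k / (ln t)^2)"
    proof (intro mult_left_mono sum_mono)
      fix k :: nat assume "k \<in> {..<4}"
      then have "cmod (I k t - complex_of_real (\<kappa> k / lam^2 / ln t)) \<le> C k / (ln t)^2"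
        by (intro CT tk) simp
      moreover have "cmod (cnj (\<i>^k)) = 1" by (simp add: norm_power)
      ultimately show "cmod (cnj (\<i>^k) * (I k t - complex_of_real (\<kappa> k / lam^2 / ln t))) \<le> C k / (ln t)^2"
        by (simp only: norm_mult mult_1)
    qed simp
    also have "\<dots> = ((1/4) * (\<Sum>k<4::nat. C k)) / (ln t)^2" by (simp add: sum_divide_distrib mult_ac)
    finally show "cmod (U_red E m n t - R$m$n / complex_of_real (lam^2 * ln t)) \<le> ((1/4) * (\<Sum>k<4::nat. C k)) / (ln t)^2" .
  qed
qed

end

text \<open>The existential is no weakening: the three equations determine \<open>R\<close>, which
  inverts the compression on \<open>M1\<close> and vanishes on its orthogonal complement.\<close>

theorem theorem2:
  fixes om :: "('n::{finite,linorder}) \<Rightarrow> real"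
    and lam :: real
    and v :: "('n::{finite,linorder}) \<Rightarrow> real \<Rightarrow> complex"
    and pp rr :: "('n::{finite,linorder}) \<Rightarrow> ('n::{finite,linorder}) \<Rightarrow> complex poly"
    and E :: "real set \<Rightarrow> ('n::{finite,linorder}) hvec \<Rightarrow> ('n::{finite,linorder}) hvec"
  assumes om_mono: "mono om"
    and v_L2: "\<And>n. sq_int (v n)"
    and ff_rat: "\<And>m n x. x > 0 \<Longrightarrow>
                  cnj (v m x) * v n x = poly (pp m n) (complex_of_real x) / poly (rr m n) (complex_of_real x)"
    and ff_deg: "\<And>m n. degree (rr m n) \<ge> degree (pp m n) + 2"
    and ff_nozero: "\<And>m n x. x \<ge> 0 \<Longrightarrow> poly (rr m n) (complex_of_real x) \<noteq> 0"
    and ff_zero: "\<And>m n. poly (pp m n) 0 = 0"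
    and standing: "\<And>w s. w > 0 \<Longrightarrow> s \<in> {1, -1} \<Longrightarrow>
                    det (Kpm om lam v s w - mat (complex_of_real w)) \<noteq> 0"
    and E_spec: "is_spectral_measure_of om lam v E"
    and det0: "det (Kzero om lam v) = 0"
    and Q1_nz: "orth_proj (M1 om lam v) \<noteq> 0"
    and Q2_z: "orth_proj (M2 om lam v) = 0"
  shows "\<exists>R :: complex^('n::{finite,linorder})^('n::{finite,linorder}).
           (let Q1 = orth_proj (M1 om lam v) in
              R ** (Q1 ** Gam1 pp rr ** Q1) = Q1 \<and> R ** Q1 = R \<and> Q1 ** R = R) \<and>
           (\<forall>m n. \<exists>C T. \<forall>t\<ge>T.
              cmod (U_red E m n t - R$m$n / complex_of_real (lam^2 * ln t)) \<le> C / (ln t)^2)"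
proof -
  interpret friedrichs_evolution om lam v pp rr E
    by unfold_locales (fact assms)+
  obtain R Y where R:
    "R ** (orth_proj (M1 om lam v) ** Gam1 pp rr ** orth_proj (M1 om lam v)) = orth_proj (M1 om lam v)"
    "R ** orth_proj (M1 om lam v) = R" "orth_proj (M1 om lam v) ** R = R" "mat_adj R = R"
    "resolvent_asymptotics (\<lambda>w. Am (of_real w)) (Gam v) (Kzero om lam v) (Gam1 pp rr) R Y (lam^2)"
    by (rule reduced_inverse) blast
  show ?thesis
    using R(1-3) reduced_evolution_asymptotics[OF R(5,4)] unfolding Let_def by blast
qed

end
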